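(* Let $(S,\mathcal S)$ be a metric space with its Borel $\sigma$-field, let $X=(X_n,n\in\mathbb T)$ be a bifurcating Markov chain on $S$ with initial distribution $\nu$ and $\mathbb T$-transition probability $P$, and let $\Pi$ be a uniform generation-preserving random permutation independent of $X$. Let $F$ be an admissible space of functions with limit probability $\mu$. Let $f:S^3\to\mathbb R$ be measurable and such that $Pf$, $Pf^2$ and $Pf^4$ exist and belong to $F$. Then $n^{-1/2}\big(M_n^{\Pi}(f)-M_n^{\Pi}(Pf)\big)$ converges in distribution, as $n\to\infty$, to $\mathcal N(0,s^2)$, where $s^2=(\mu,Pf^2)-(\mu,(Pf)^2)$.
   Context: Tree. $\mathbb T=\mathbb N^*=\{1,2,\dots\}$ is the binary tree: vertex $n$ has two daughters $2n$ and $2n+1$, the root is $1$. $\mathbb G_q=\{2^q,\dots,2^{q+1}-1\}$ is the $q$th generation, $\mathbb T_r=\bigcup_{q=0}^r\mathbb G_q$, $r_n=\lfloor\log_2 n\rfloor$ is the generation of $n$. $\mathbb T$-transition probability. A map $P:S\times\mathcal S^2\to[0,1]$ ($\mathcal S^2$ the product $\sigma$-field on $S^2$) such that $P(\cdot,A)$ is measurable for all $A\in\mathcal S^2$ and $P(x,\cdot)$ is a probability on $(S^2,\mathcal S^2)$ for all $x\in S$. Put $P_0(x,B)=P(x,B\times S)$, $P_1(x,B)=P(x,S\times B)$, $Q=(P_0+P_1)/2$; $Q^r$ is the $r$th iterate of $Q$ and $Q^rf(x)=\int_S f(y)Q^r(x,dy)$. When defined, $Pf(x)=\int_{S^2}f(y,z)P(x,dy\,dz)$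 for measurable $f:S^2\to\mathbb R$, and $Pf(x)=\int_{S^2}f(x,y,z)P(x,dy\,dz)$ for measurable $f:S^3\to\mathbb R$. $Pf^k$ means $P(f^k)$. Bifurcating Markov chain. On a filtered probability space $(\Omega,\mathcal F,(\mathcal F_r)_{r\in\mathbb N},\mathbb P)$, a family $(X_n,n\in\mathbb T)$ of $S$-valued random variables is a bifurcating Markov chain with initial distribution $\nu$ and $\mathbb T$-transition probability $P$ if $X_n$ is $\mathcal F_{r_n}$-measurable for all $n$, $X_1$ has law $\nu$, and for all $q\in\mathbb N$ and all families $(f_n,n\in\mathbb G_q)$ of bounded measurable functions on $S^2$, $\mathbb E[\prod_{n\in\mathbb G_q}f_n(X_{2n},X_{2n+1})\mid\mathcal F_q]=\prod_{n\in\mathbb G_q}Pf_n(X_n)$. The default filtration is $\mathcal F_r=\sigma(X_i,i\in\mathbb T_r)$. Admissible space. Let $\mathcal B(S)$ be the set of measurable functions $S\to\mathbb R$, and $(f\otimes g)(y,z)=f(y)g(z)$. A linear subspace $F\subset\mathcal B(S)$ is called admissible with limit probability $\mu$ (relative to $P,\nu$) if: (i) $F$ contains the constants; (ii) $f^2\in F$ for all $f\in F$; (iii) for all $f,g\in F$, $f\otimes g\in L^1(P(x,\cdot))$ for all $x\in S$, and $P(f\otimes g)\in F$; (iv) $\mu$ is a probability on $(S,\mathcal S)$ with $F\subset L^1(\mu)$ and $\lim_{r\to\infty}Q^rf(x)=\int_S f\,d\mu$ for all $x\in S$ and $f\in F$; (v) for all $f\in F$ there is $g\in F$ such that $|Q^rf|\le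 g$ for all $r\in\mathbb N$; (vi) $F\subset L^1(\nu)$. (Conditions (i) and (iii) imply that $Q^rf$ is well defined for $f\in F$.) Random permutation. $\Pi$ is a random permutation of $\mathbb N^*$ leaving each $\mathbb G_q$ invariant, whose restrictions to the $\mathbb G_q$ are independent over $q$, each uniform among the $(2^q)!$ permutations of $\mathbb G_q$. Sums. $\Delta_i=(X_i,X_{2i},X_{2i+1})$. $M_n^\Pi(f)=\sum_{i=1}^n f(\Delta_{\Pi(i)})$ for measurable $f:S^3\to\mathbb R$, and $M_n^\Pi(g)=\sum_{i=1}^n g(X_{\Pi(i)})$ for measurable $g:S\to\mathbb R$. $(\mu,g)=\int_S g\,d\mu$. *)

theory Defs
  imports "HOL-Probability.Probability" "HOL-Library.Discrete_Functions"
begin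

text \<open>
  The state space is a type of class \<open>metric_space\<close>.  No separability is assumed, so the \<open>\<sigma>\<close>-field
  \<open>borel \<Otimes>\<^sub>M borel\<close> on pairs may be strictly smaller than the Borel \<open>\<sigma>\<close>-field of the product type;
  the \<open>\<sigma>\<close>-fields on pairs and triples are the product ones throughout.  Vertices of the binary tree
  are the positive elements of \<^typ>\<open>nat\<close>, and the generation of \<open>n\<close> is \<open>floor_log n\<close>.
\<close>

definition generation :: "nat \<Rightarrow> nat set" where
  "generation q = {2 ^ q..<2 ^ (q + 1)}"

lemma mem_generation_iff: "n \<in> generation q \<longleftrightarrow> n \<ge> 1 \<and> floor_log n = q"
proof
  assume "n \<in> generation q"
  hence n: "2 ^ q \<le> n" "n < 2 ^ (q + 1)" by (auto simp: generation_def)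
  hence "n \<ge> 1" by (meson le_trans one_le_numeral one_le_power)
  with n show "n \<ge> 1 \<and> floor_log n = q" by (auto intro!: floor_log_eqI)
next
  assume "n \<ge> 1 \<and> floor_log n = q"
  thus "n \<in> generation q"
    using floor_log_exp2_le[of n] floor_log_exp2_gt[of n] by (auto simp: generation_def)
qed

subsection \<open>Transition kernels\<close>

definition tree_kernel :: "('s::metric_space \<Rightarrow> ('s \<times> 's) measure) \<Rightarrow> bool" where
  "tree_kernel P \<longleftrightarrow> P \<in> borel \<rightarrow>\<^sub>M prob_algebra (borel \<Otimes>\<^sub>M borel)"

definition pair_op :: "('s \<Rightarrow> ('s \<times> 's) measure) \<Rightarrow> ('s \<times> 's \<Rightarrow> real) \<Rightarrow> 's \<Rightarrow> real" where
  "pair_op P f x = (\<integral>(y, z). f (y, z) \<partial>P x)"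

definition triple_op :: "('s \<Rightarrow> ('s \<times> 's) measure) \<Rightarrow> ('s \<times> 's \<times> 's \<Rightarrow> real) \<Rightarrow> 's \<Rightarrow> real" where
  "triple_op P f x = (\<integral>(y, z). f (x, y, z) \<partial>P x)"

text \<open>The Bochner integral is \<open>0\<close> on non-integrable functions, so that \<open>P f\<close> exists has to be said separately.\<close>

definition triple_op_exists :: "('s \<Rightarrow> ('s \<times> 's) measure) \<Rightarrow> ('s \<times> 's \<times> 's \<Rightarrow> real) \<Rightarrow> bool" where
  "triple_op_exists P f \<longleftrightarrow> (\<forall>x. integrable (P x) (\<lambda>(y, z). f (x, y, z)))"

definition mean_kernel :: "('s::metric_space \<Rightarrow> ('s \<times> 's) measure) \<Rightarrow> 's \<Rightarrow> 's measure" where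
  "mean_kernel P x =
     measure_of UNIV (sets borel) (\<lambda>B. (emeasure (P x) (B \<times> UNIV) + emeasure (P x) (UNIV \<times> B)) / 2)"

lemma space_mean_kernel [simp]: "space (mean_kernel P x) = UNIV"
  by (simp add: mean_kernel_def space_measure_of_conv)

lemma sets_mean_kernel [simp, measurable_cong]: "sets (mean_kernel P x) = sets borel"
  unfolding mean_kernel_def using sets.sigma_sets_eq[of borel] by (simp add: sets_measure_of_conv)

lemma emeasure_mean_kernel:
  assumes P: "tree_kernel P" and B: "B \<in> sets borel"
  shows "emeasure (mean_kernel P x) B = (emeasure (P x) (B \<times> UNIV) + emeasure (P x) (UNIV \<times> B)) / 2"
proof -
  have sP [measurable_cong]: "sets (P x) = sets (borel \<Otimes>\<^sub>M borel)"
    using measurable_space[OF P[unfolded tree_kernel_def], of x] by (simp add: space_prob_algebra)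
  let ?m = "\<lambda>B. (emeasure (P x) (B \<times> UNIV) + emeasure (P x) (UNIV \<times> B)) / 2"
  have "emeasure (mean_kernel P x) B = ?m B"
  proof (rule emeasure_measure_of[OF mean_kernel_def])
    show "positive (sets (mean_kernel P x)) ?m" by (simp add: positive_def)
    show "countably_additive (sets (mean_kernel P x)) ?m"
    proof (rule countably_additiveI)
      fix A :: "nat \<Rightarrow> 'a set"
      assume A: "range A \<subseteq> sets (mean_kernel P x)" and d: "disjoint_family A"
      have l: "range (\<lambda>i. A i \<times> UNIV) \<subseteq> sets (P x)" and r: "range (\<lambda>i. UNIV \<times> A i) \<subseteq> sets (P x)"
        using A by (auto simp: sP)
      have dl: "disjoint_family (\<lambda>i. A i \<times> (UNIV :: 'a set))"
       and dr: "disjoint_family (\<lambda>i. (UNIV :: 'a set) \<times> A i)"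
        using d by (fastforce simp: disjoint_family_on_def)+
      have "(\<Sum>i. ?m (A i)) = ((\<Sum>i. emeasure (P x) (A i \<times> UNIV)) + (\<Sum>i. emeasure (P x) (UNIV \<times> A i))) / 2"
        by (simp add: suminf_add ennreal_suminf_divide)
      also have "\<dots> = (emeasure (P x) (\<Union>i. A i \<times> UNIV) + emeasure (P x) (\<Union>i. UNIV \<times> A i)) / 2"
        by (simp only: suminf_emeasure[OF l dl] suminf_emeasure[OF r dr])
      also have "(\<Union>i. A i \<times> (UNIV :: 'a set)) = \<Union>(range A) \<times> UNIV" by auto
      also have "(\<Union>i. (UNIV :: 'a set) \<times> A i) = UNIV \<times> \<Union>(range A)" by auto
      finally show "(\<Sum>i. ?m (A i)) = ?m (\<Union>(range A))" .
    qed
  qed (use B in auto)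
  thus ?thesis .
qed

lemma measurable_mean_kernel:
  assumes P: "tree_kernel P"
  shows "mean_kernel P \<in> borel \<rightarrow>\<^sub>M prob_algebra borel"
proof (rule measurable_prob_algebraI)
  have P': "P \<in> borel \<rightarrow>\<^sub>M subprob_algebra (borel \<Otimes>\<^sub>M borel)"
    using P by (auto simp: tree_kernel_def intro: measurable_prob_algebraD)
  show prob: "prob_space (mean_kernel P x)" for x
  proof
    have "prob_space (P x)" and sP: "sets (P x) = sets (borel \<Otimes>\<^sub>M borel)"
      using measurable_space[OF P[unfolded tree_kernel_def], of x] by (auto simp: space_prob_algebra)
    moreover have "space (P x) = UNIV"
      using sets_eq_imp_space_eq[OF sP] by (simp add: space_pair_measure)
    ultimately have "emeasure (P x) (UNIV \<times> UNIV) = 1"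
      using prob_space.emeasure_space_1[of "P x"] by simp
    thus "emeasure (mean_kernel P x) (space (mean_kernel P x)) = 1"
      using emeasure_mean_kernel[OF P, of UNIV x] by (simp add: ennreal_divide_self)
  qed
  show "mean_kernel P \<in> borel \<rightarrow>\<^sub>M subprob_algebra borel"
  proof (rule measurable_subprob_algebra)
    show "subprob_space (mean_kernel P a)" for a
      using prob by (rule prob_space_imp_subprob_space)
    fix B :: "'a set" assume B: "B \<in> sets borel"
    have "B \<times> UNIV \<in> sets (borel \<Otimes>\<^sub>M (borel :: 'a measure))"
      and "UNIV \<times> B \<in> sets ((borel :: 'a measure) \<Otimes>\<^sub>M borel)"
      using B by auto
    note [measurable] = this[THEN measurable_emeasure_subprob_algebra, THEN measurable_compose[OF P']]
    have "(\<lambda>x. (emeasure (P x) (B \<times> UNIV) + emeasure (P x) (UNIV \<times> B)) / 2) \<in> borel_measurable borel"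
      by measurable
    thus "(\<lambda>a. emeasure (mean_kernel P a) B) \<in> borel_measurable borel"
      by (simp add: emeasure_mean_kernel[OF P B])
  qed simp
qed

primrec kernel_pow :: "('s::metric_space \<Rightarrow> 's measure) \<Rightarrow> nat \<Rightarrow> 's \<Rightarrow> 's measure" where
  "kernel_pow K 0 x = return borel x"
| "kernel_pow K (Suc r) x = bind (K x) (kernel_pow K r)"

definition mean_pow_op ::
    "('s::metric_space \<Rightarrow> ('s \<times> 's) measure) \<Rightarrow> nat \<Rightarrow> ('s \<Rightarrow> real) \<Rightarrow> 's \<Rightarrow> real" where
  "mean_pow_op P r f x = (\<integral>y. f y \<partial>kernel_pow (mean_kernel P) r x)"

subsection \<open>Bifurcating Markov chains\<close>

locale bifurcating_markov_chain =
  prob_space M + filtration "space M" Filt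
  for M :: "'a measure" and Filt :: "nat \<Rightarrow> 'a measure" +
  fixes X :: "nat \<Rightarrow> 'a \<Rightarrow> 's::metric_space"
    and \<nu> :: "'s measure"
    and P :: "'s \<Rightarrow> ('s \<times> 's) measure"
  assumes tree_kernel: "tree_kernel P"
    and subalgebra: "\<And>r. subalgebra M (Filt r)"
    and adapted: "\<And>n. n \<ge> 1 \<Longrightarrow> X n \<in> Filt (floor_log n) \<rightarrow>\<^sub>M borel"
    and initial_law: "distr M borel (X 1) = \<nu>"
    and branching: "\<And>q (h :: nat \<Rightarrow> 's \<times> 's \<Rightarrow> real).
      (\<And>n. n \<in> generation q \<Longrightarrow> h n \<in> borel_measurable (borel \<Otimes>\<^sub>M borel) \<and> bounded (range (h n))) \<Longrightarrow>
      AE \<omega> in M. real_cond_exp M (Filt q) (\<lambda>\<omega>. \<Prod>n\<in>generation q. h n (X (2 * n) \<omega>, X (2 * n + 1) \<omega>)) \<omega>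
        = (\<Prod>n\<in>generation q. pair_op P (h n) (X n \<omega>))"

subsection \<open>Admissible spaces of functions\<close>

locale admissible_space =
  fixes P :: "'s::metric_space \<Rightarrow> ('s \<times> 's) measure"
    and \<nu> :: "'s measure"
    and F :: "('s \<Rightarrow> real) set"
    and \<mu> :: "'s measure"
  assumes F_measurable: "F \<subseteq> borel_measurable borel"
    and add: "\<And>f g. f \<in> F \<Longrightarrow> g \<in> F \<Longrightarrow> (\<lambda>x. f x + g x) \<in> F"
    and scale: "\<And>f c. f \<in> F \<Longrightarrow> (\<lambda>x. c * f x) \<in> F"
    and const: "\<And>c. (\<lambda>_. c) \<in> F"
    and square: "\<And>f. f \<in> F \<Longrightarrow> (\<lambda>x. (f x)\<^sup>2) \<in> F"
    and tensor_integrable: "\<And>f g x. f \<in> F \<Longrightarrow> g \<in> F \<Longrightarrow> integrable (P x) (\<lambda>(y, z). f y * g z)"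
    and tensor: "\<And>f g. f \<in> F \<Longrightarrow> g \<in> F \<Longrightarrow> pair_op P (\<lambda>(y, z). f y * g z) \<in> F"
    and limit_prob: "prob_space \<mu>" "sets \<mu> = sets borel"
    and limit_integrable: "\<And>f. f \<in> F \<Longrightarrow> integrable \<mu> f"
    and ergodic: "\<And>f x. f \<in> F \<Longrightarrow> (\<lambda>r. mean_pow_op P r f x) \<longlonglongrightarrow> (\<integral>y. f y \<partial>\<mu>)"
    and dominated: "\<And>f. f \<in> F \<Longrightarrow> \<exists>g\<in>F. \<forall>r x. \<bar>mean_pow_op P r f x\<bar> \<le> g x"
    and initial_integrable: "\<And>f. f \<in> F \<Longrightarrow> integrable \<nu> f"

subsection \<open>The random permutation\<close>

locale uniform_generation_permutation = prob_space M
  for M :: "'a measure" +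
  fixes \<pi> :: "'a \<Rightarrow> nat \<Rightarrow> nat"
  assumes permutation: "\<And>\<omega>. \<omega> \<in> space M \<Longrightarrow> bij_betw (\<pi> \<omega>) {1..} {1..}"
    and generation_invariant: "\<And>\<omega> q. \<omega> \<in> space M \<Longrightarrow> \<pi> \<omega> ` generation q = generation q"
    and indep_generations:
      "indep_vars (\<lambda>q. PiM (generation q) (\<lambda>_. count_space UNIV))
         (\<lambda>q \<omega>. restrict (\<pi> \<omega>) (generation q)) UNIV"
    and uniform: "\<And>q \<sigma>. \<sigma> permutes generation q \<Longrightarrow>
      prob {\<omega> \<in> space M. \<forall>n\<in>generation q. \<pi> \<omega> n = \<sigma> n} = 1 / fact (2 ^ q)"

text \<open>
  Independence of the two processes, via the \<open>\<sigma>\<close>-fields they generate: the library's \<open>indep_var\<close>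
  requires both variables to have the same value type.
\<close>

definition permutation_indep_chain ::
    "'a measure \<Rightarrow> ('a \<Rightarrow> nat \<Rightarrow> nat) \<Rightarrow> (nat \<Rightarrow> 'a \<Rightarrow> 's::metric_space) \<Rightarrow> bool" where
  "permutation_indep_chain M \<pi> X \<longleftrightarrow>
     prob_space.indep_set M
       (sets (vimage_algebra (space M) (\<lambda>\<omega>. \<lambda>n\<in>{1..}. \<pi> \<omega> n) (PiM {1..} (\<lambda>_. count_space UNIV))))
       (sets (vimage_algebra (space M) (\<lambda>\<omega>. \<lambda>n\<in>{1..}. X n \<omega>) (PiM {1..} (\<lambda>_. borel))))"

subsection \<open>Sums and the limit law\<close>

definition triangle :: "(nat \<Rightarrow> 'a \<Rightarrow> 's) \<Rightarrow> nat \<Rightarrow> 'a \<Rightarrow> 's \<times> 's \<times> 's" where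
  "triangle X i \<omega> = (X i \<omega>, X (2 * i) \<omega>, X (2 * i + 1) \<omega>)"

definition triangle_sum ::
    "('a \<Rightarrow> nat \<Rightarrow> nat) \<Rightarrow> (nat \<Rightarrow> 'a \<Rightarrow> 's) \<Rightarrow> nat \<Rightarrow> ('s \<times> 's \<times> 's \<Rightarrow> real) \<Rightarrow> 'a \<Rightarrow> real" where
  "triangle_sum \<pi> X n f \<omega> = (\<Sum>i=1..n. f (triangle X (\<pi> \<omega> i) \<omega>))"

definition vertex_sum ::
    "('a \<Rightarrow> nat \<Rightarrow> nat) \<Rightarrow> (nat \<Rightarrow> 'a \<Rightarrow> 's) \<Rightarrow> nat \<Rightarrow> ('s \<Rightarrow> real) \<Rightarrow> 'a \<Rightarrow> real" where
  "vertex_sum \<pi> X n g \<omega> = (\<Sum>i=1..n. g (X (\<pi> \<omega> i) \<omega>))"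

text \<open>The normal law with mean \<open>m\<close> and variance \<open>v \<ge> 0\<close>, a point mass in the degenerate case \<open>v = 0\<close>.\<close>

definition normal_law :: "real \<Rightarrow> real \<Rightarrow> real measure" where
  "normal_law m v = (if v = 0 then return borel m else density lborel (normal_density m (sqrt v)))"

end

theory Submission
  imports Defs
begin

text \<open>
  Let \<open>g = f - P f\<close>, \<open>V = P (g\<^sup>2)\<close> and \<open>h = V - s\<^sup>2\<close>.  Given the history up to generation \<open>q\<close>, the
  variables \<open>g (\<Delta>\<^sub>i)\<close> with \<open>i\<close> in generation \<open>q\<close> are independent and centred with variance \<open>V (X\<^sub>i)\<close>, so a
  fourth moment bound puts the conditional characteristic function of a partial sum over \<open>A\<close> close to
  \<open>exp (- t\<^sup>2 / (2 n) \<Sum>\<^sub>A V (X\<^sub>i))\<close>, hence to the constant \<open>exp (- t\<^sup>2 s\<^sup>2 |A| / (2 n))\<close> up to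
  \<open>t\<^sup>2 / (2 n) |\<Sum>\<^sub>A h (X\<^sub>i)|\<close>.  Replacing the generations by constants one after the other compares the
  characteristic function of the whole sum with the Gaussian one.

  The errors vanish by a law of large numbers in \<open>L\<^sup>2\<close>.  For a full generation, the increments
  \<open>h (X\<^sub>2\<^sub>i) + h (X\<^sub>2\<^sub>i\<^sub>+\<^sub>1) - 2 Q h (X\<^sub>i)\<close> are orthogonal, which yields a recursion for the second moment of
  \<open>2\<^sup>-\<^sup>q \<Sum> h (X\<^sub>i)\<close> whose solution tends to \<open>0\<close> because \<open>Q\<^sup>r h \<rightarrow> (\<mu>, h) = 0\<close> with a domination inside \<open>F\<close>.
  For the last, incomplete generation the random permutation turns the sum into a sample without
  replacement, whose mean square is bounded by that of the full generation.  The permutation is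
  eliminated by conditioning on its values on that generation, and Levy's continuity theorem concludes.
\<close>

text \<open>For one fixed permutation the argument would fail: the sampled part of the last
  generation could consist of left daughters only, over which averages of \<open>h\<close> need not
  tend to \<open>(\<mu>, h)\<close>. Only the mean over all permutations is small. This suffices
  because the number of visited vertices is \<open>n\<close> for every permutation, so that the
  Gaussian target is common to all of them, and because the error is linear in the L1 norm of the
  sampled sum of \<open>h\<close>.

  The space \<open>F\<close> is closed under products, by polarisation of squares, but not under
  absolute values or positive parts, and nothing is known about third moments. Hence all dominations
  go through even powers: \<open>\<bar>y\<bar> \<le> 1 + y^2\<close>,
  \<open>\<bar>y\<bar>^3 \<le> y^2 + y^4\<close>, and fourth moments bounded by a member of
  \<open>F\<close>.

  The branching property speaks of products over a whole generation. It is first turned into the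
  conditional law of one pair of daughters given the past and other pairs of the same generation.
  This single form yields both the factorisation of characteristic functions and the orthogonality
  of increments.\<close>

lemma finite_generation [simp]: "finite (generation q)"
  by (simp add: generation_def)

lemma card_generation [simp]: "card (generation q) = 2 ^ q"
  by (simp add: generation_def)

lemma generation_children:
  assumes "n \<in> generation q"
  shows "2 * n \<in> generation (Suc q)" "2 * n + 1 \<in> generation (Suc q)" "Suc (2 * n) \<in> generation (Suc q)"
  using assms by (auto simp: generation_def)

lemma generation_pos: "n \<in> generation q \<Longrightarrow> n \<ge> 1"
  by (simp add: mem_generation_iff)

lemma sum_generation_Suc:
  fixes w :: "nat \<Rightarrow> 'b::comm_monoid_add"
  shows "sum w (generation (Suc q)) = (\<Sum>i\<in>generation q. w (2 * i) + w (2 * i + 1))"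
proof -
  have eq: "generation (Suc q) = (\<lambda>i. 2 * i) ` generation q \<union> (\<lambda>i. 2 * i + 1) ` generation q"
  proof (intro set_eqI iffI)
    fix n assume n: "n \<in> generation (Suc q)"
    hence "n div 2 \<in> generation q" by (auto simp: generation_def)
    moreover have "n = 2 * (n div 2) \<or> n = 2 * (n div 2) + 1" by linarith
    ultimately show "n \<in> (\<lambda>i. 2 * i) ` generation q \<union> (\<lambda>i. 2 * i + 1) ` generation q" by blast
  qed (auto simp: generation_def)
  have d: "(\<lambda>i. 2 * i) ` generation q \<inter> (\<lambda>i. 2 * i + 1) ` generation q = {}"
    by (auto; presburger)
  show ?thesis
    unfolding eq
    by (subst sum.union_disjoint[OF _ _ d])
       (auto simp: sum.reindex inj_on_def sum.distrib)
qed

section \<open>Disintegration along one branching\<close>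

text \<open>\<open>K\<close> is a regular conditional law of \<open>T\<close> given
  \<open>N\<close>, recognised from its values on a generator \<open>G\<close> of \<open>N\<close>.
  Two uniqueness arguments for finite measures are needed: one extends the identity from
  \<open>G\<close> to all of \<open>N\<close>, the other passes from rectangles to the product
  \<open>\<sigma>\<close>-field. No topological assumption on the spaces enters, since the kernel is
  given.\<close>

lemma nn_integral_disintegration:
  fixes T :: "'a \<Rightarrow> 'b" and K :: "'a \<Rightarrow> 'b measure"
  assumes M: "prob_space M" and sub: "subalgebra M N"
    and T [measurable]: "T \<in> M \<rightarrow>\<^sub>M S" and K [measurable]: "K \<in> N \<rightarrow>\<^sub>M prob_algebra S"
    and G: "Int_stable G" "G \<subseteq> Pow (space M)" "space M \<in> G" "sets N = sigma_sets (space M) G"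
    and eq: "\<And>C B. C \<in> G \<Longrightarrow> B \<in> sets S \<Longrightarrow>
      emeasure M (C \<inter> T -` B) = (\<integral>\<^sup>+\<omega>. indicator C \<omega> * emeasure (K \<omega>) B \<partial>M)"
    and F: "F \<in> borel_measurable (N \<Otimes>\<^sub>M S)"
  shows "(\<integral>\<^sup>+\<omega>. F (\<omega>, T \<omega>) \<partial>M) = (\<integral>\<^sup>+\<omega>. \<integral>\<^sup>+t. F (\<omega>, t) \<partial>K \<omega> \<partial>M)"
proof -
  interpret prob_space M by fact
  have spN: "space N = space M" and setsN: "sets N \<subseteq> sets M" using sub by (auto simp: subalgebra_def)
  have idN [measurable]: "(\<lambda>x. x) \<in> M \<rightarrow>\<^sub>M N" using spN setsN by (auto simp: measurable_def)
  have K' [measurable]: "K \<in> N \<rightarrow>\<^sub>M subprob_algebra S" using K by (rule measurable_prob_algebraD)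
  have KM [measurable]: "K \<in> M \<rightarrow>\<^sub>M subprob_algebra S" using measurable_compose[OF idN K'] by simp
  have sK [measurable_cong]: "\<omega> \<in> space M \<Longrightarrow> sets (K \<omega>) = sets S" for \<omega>
    using measurable_space[OF K, of \<omega>] by (simp add: space_prob_algebra spN)
  define L where "L \<omega> = distr (K \<omega>) (N \<Otimes>\<^sub>M S) (\<lambda>t. (\<omega>, t))" for \<omega>
  have L [measurable]: "L \<in> M \<rightarrow>\<^sub>M subprob_algebra (N \<Otimes>\<^sub>M S)"
    unfolding L_def by (rule measurable_distr2[OF _ KM]) measurable
  have ne: "space M \<noteq> {}" by (rule not_empty)
  have gen: "emeasure M (C \<inter> T -` B) = (\<integral>\<^sup>+\<omega>. indicator C \<omega> * emeasure (K \<omega>) B \<partial>M)"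
    if C: "C \<in> sets N" and B [measurable]: "B \<in> sets S" for C B
  proof -
    let ?T = "{\<omega> \<in> space M. T \<omega> \<in> B}"
    have TB: "?T \<in> sets M" by measurable
    \<comment> \<open>For fixed \<open>B\<close> both sides are finite measures in the variable
      \<open>C\<close>. Restricting them to \<open>N\<close> makes the intersection-stable family
      \<open>G\<close> a generator.\<close>
    have "restr_to_subalg (density M (indicator ?T)) N = restr_to_subalg (density M (\<lambda>\<omega>. emeasure (K \<omega>) B)) N"
    proof (rule measure_eqI_generator_eq[OF G(1,2), where A = "\<lambda>_. space M"])
      show "sets (restr_to_subalg (density M (indicator ?T)) N) = sigma_sets (space M) G"
        "sets (restr_to_subalg (density M (\<lambda>\<omega>. emeasure (K \<omega>) B)) N) = sigma_sets (space M) G"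
        using G(4) sub by (subst sets_restr_to_subalg; simp add: subalgebra_def)+
      show "emeasure (restr_to_subalg (density M (indicator ?T)) N) X
          = emeasure (restr_to_subalg (density M (\<lambda>\<omega>. emeasure (K \<omega>) B)) N) X" if X: "X \<in> G" for X
      proof -
        have XN: "X \<in> sets N" using X G(4) by auto
        hence XM [measurable]: "X \<in> sets M" using setsN by auto
        have "emeasure (density M (indicator ?T)) X = emeasure M (X \<inter> T -` B)"
          using TB sets.sets_into_space[OF XM]
          by (subst emeasure_density)
             (auto intro!: arg_cong2[where f=emeasure] simp: indicator_inter_arith[symmetric] nn_integral_indicator)
        also have "\<dots> = emeasure (density M (\<lambda>\<omega>. emeasure (K \<omega>) B)) X"
          by (simp add: eq[OF X B] emeasure_density mult.commute)
        finally show ?thesis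
          using sub XN by (subst (1 2) emeasure_restr_to_subalg) (auto simp: subalgebra_def)
      qed
      show "emeasure (restr_to_subalg (density M (indicator ?T)) N) (space M) \<noteq> \<infinity>"
      proof -
        have "emeasure (density M (indicator ?T)) (space M) = emeasure M ?T"
          using TB by (subst emeasure_density) (auto simp: indicator_inter_arith[symmetric] intro!: arg_cong2[where f=emeasure])
        thus ?thesis
          using sub spN sets.top[of N] by (subst emeasure_restr_to_subalg) (auto simp: subalgebra_def)
      qed
    qed (use G in auto)
    from arg_cong[where f="\<lambda>m. emeasure m C", OF this]
    have "emeasure (density M (indicator ?T)) C = emeasure (density M (\<lambda>\<omega>. emeasure (K \<omega>) B)) C"
      using sub C by (subst (asm) (1 2) emeasure_restr_to_subalg) (auto simp: subalgebra_def)
    moreover have CM [measurable]: "C \<in> sets M" using C setsN by auto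
    moreover have "emeasure (density M (indicator ?T)) C = emeasure M (C \<inter> T -` B)"
      using TB sets.sets_into_space[OF CM]
      by (subst emeasure_density)
         (auto intro!: arg_cong2[where f=emeasure] simp: indicator_inter_arith[symmetric] nn_integral_indicator)
    ultimately show ?thesis by (simp add: emeasure_density mult.commute)
  qed
  \<comment> \<open>\<open>L \<omega>\<close> is the product of the point mass at
    \<open>\<omega>\<close> with \<open>K \<omega>\<close>, so the claim is that the joint law of
    \<open>\<omega>\<close> and \<open>T \<omega>\<close> is the mixture of these. The first
    component carries only \<open>N\<close>, because \<open>F\<close> sees \<open>\<omega>\<close>
    only through \<open>N\<close>.\<close>
  have "distr M (N \<Otimes>\<^sub>M S) (\<lambda>\<omega>. (\<omega>, T \<omega>)) = M \<bind> L"
  proof (rule measure_eqI_generator_eq[OF Int_stable_pair_measure_generator pair_measure_closed,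
        where A = "\<lambda>_. space N \<times> space S"])
    show "sets (distr M (N \<Otimes>\<^sub>M S) (\<lambda>\<omega>. (\<omega>, T \<omega>))) = sigma_sets (space N \<times> space S) {a \<times> b |a b. a \<in> sets N \<and> b \<in> sets S}"
      by (simp add: sets_pair_measure)
    show "sets (M \<bind> L) = sigma_sets (space N \<times> space S) {a \<times> b |a b. a \<in> sets N \<and> b \<in> sets S}"
      using sets_bind_measurable[OF L ne] by (simp add: sets_pair_measure)
    fix X assume "X \<in> {a \<times> b |a b. a \<in> sets N \<and> b \<in> sets S}"
    then obtain C B where X: "X = C \<times> B" and C: "C \<in> sets N" and B: "B \<in> sets S" by auto
    have CM: "C \<in> sets M" using C setsN by auto
    have "emeasure (distr M (N \<Otimes>\<^sub>M S) (\<lambda>\<omega>. (\<omega>, T \<omega>))) X = emeasure M (C \<inter> T -` B)"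
      unfolding X using C B sets.sets_into_space[OF CM]
      by (subst emeasure_distr) (auto intro!: arg_cong2[where f=emeasure])
    also have "\<dots> = (\<integral>\<^sup>+\<omega>. indicator C \<omega> * emeasure (K \<omega>) B \<partial>M)" by (rule gen[OF C B])
    also have "\<dots> = (\<integral>\<^sup>+\<omega>. emeasure (L \<omega>) X \<partial>M)"
    proof (rule nn_integral_cong)
      fix \<omega> assume w: "\<omega> \<in> space M"
      have "(\<lambda>t. (\<omega>, t)) \<in> K \<omega> \<rightarrow>\<^sub>M N \<Otimes>\<^sub>M S"
        using w spN sK[OF w] by (intro measurable_Pair) (auto simp: measurable_ident_sets)
      hence "emeasure (L \<omega>) X = emeasure (K \<omega>) ((\<lambda>t. (\<omega>, t)) -` (C \<times> B) \<inter> space (K \<omega>))"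
        unfolding L_def X using C B by (subst emeasure_distr) auto
      also have "(\<lambda>t. (\<omega>, t)) -` (C \<times> B) \<inter> space (K \<omega>) = (if \<omega> \<in> C then B else {})"
        using sets.sets_into_space[OF B] sets_eq_imp_space_eq[OF sK[OF w]] by auto
      finally show "indicator C \<omega> * emeasure (K \<omega>) B = emeasure (L \<omega>) X" by auto
    qed
    also have "\<dots> = emeasure (M \<bind> L) X"
      unfolding X by (rule emeasure_bind[OF ne L, symmetric]) (use C B in auto)
    finally show "emeasure (distr M (N \<Otimes>\<^sub>M S) (\<lambda>\<omega>. (\<omega>, T \<omega>))) X = emeasure (M \<bind> L) X" .
  next
    interpret D: prob_space "distr M (N \<Otimes>\<^sub>M S) (\<lambda>\<omega>. (\<omega>, T \<omega>))" by (rule prob_space_distr) measurable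
    show "emeasure (distr M (N \<Otimes>\<^sub>M S) (\<lambda>\<omega>. (\<omega>, T \<omega>))) (space N \<times> space S) \<noteq> \<infinity>"
      by simp
  qed auto
  hence "(\<integral>\<^sup>+z. F z \<partial>distr M (N \<Otimes>\<^sub>M S) (\<lambda>\<omega>. (\<omega>, T \<omega>))) = (\<integral>\<^sup>+\<omega>. \<integral>\<^sup>+z. F z \<partial>L \<omega> \<partial>M)"
    using nn_integral_bind[OF F L] by simp
  moreover have "(\<integral>\<^sup>+z. F z \<partial>distr M (N \<Otimes>\<^sub>M S) (\<lambda>\<omega>. (\<omega>, T \<omega>))) = (\<integral>\<^sup>+\<omega>. F (\<omega>, T \<omega>) \<partial>M)"
    by (rule nn_integral_distr) (use F in measurable)
  moreover have "(\<integral>\<^sup>+z. F z \<partial>L \<omega>) = (\<integral>\<^sup>+t. F (\<omega>, t) \<partial>K \<omega>)" if w: "\<omega> \<in> space M" for \<omega>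
    unfolding L_def
    by (rule nn_integral_distr)
       (use F w spN sK[OF w] in \<open>auto intro!: measurable_Pair simp: measurable_ident_sets\<close>)
  ultimately show ?thesis by (simp cong: nn_integral_cong)
qed

text \<open>Pushing \<open>L x\<close> forward along \<open>y \<mapsto> (x, y)\<close> moves the
  dependence on \<open>x\<close> from the integrand into the measure, leaving a fixed
  integrand.\<close>

lemma integral_measurable_subprob_algebra2:
  fixes f :: "_ \<Rightarrow> _ \<Rightarrow> 'c::{banach, second_countable_topology}"
  assumes f [measurable]: "(\<lambda>(x, y). f x y) \<in> borel_measurable (M \<Otimes>\<^sub>M N)"
    and L [measurable]: "L \<in> M \<rightarrow>\<^sub>M subprob_algebra N"
  shows "(\<lambda>x. integral\<^sup>L (L x) (f x)) \<in> borel_measurable M"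
proof -
  note measurable_distr2[measurable]
  have "(\<lambda>x. integral\<^sup>L (distr (L x) (M \<Otimes>\<^sub>M N) (\<lambda>y. (x, y))) (\<lambda>(x, y). f x y)) \<in> borel_measurable M"
    by measurable
  then show ?thesis
    by (rule measurable_cong[THEN iffD1, rotated]) (simp add: integral_distr)
qed

lemma measurable_pair_measure_cong_id:
  assumes "(\<lambda>x. x) \<in> M \<rightarrow>\<^sub>M N"
  shows "(\<lambda>z. z) \<in> M \<Otimes>\<^sub>M S \<rightarrow>\<^sub>M N \<Otimes>\<^sub>M S"
  using measurable_Pair[OF measurable_compose[OF measurable_fst assms] measurable_snd, of S] by simp

text \<open>Integrability is assumed only for the composed function. The inner integrals of the
  positive and negative parts are then finite merely almost everywhere, which is why they pass
  through \<open>enn2real\<close> before being subtracted.\<close>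

lemma integral_disintegration:
  fixes T :: "'a \<Rightarrow> 'b" and K :: "'a \<Rightarrow> 'b measure" and F :: "'a \<times> 'b \<Rightarrow> real"
  assumes nn: "\<And>F :: 'a \<times> 'b \<Rightarrow> ennreal. F \<in> borel_measurable (N \<Otimes>\<^sub>M S) \<Longrightarrow>
      (\<integral>\<^sup>+\<omega>. F (\<omega>, T \<omega>) \<partial>M) = (\<integral>\<^sup>+\<omega>. \<integral>\<^sup>+t. F (\<omega>, t) \<partial>K \<omega> \<partial>M)"
    and sub: "subalgebra M N" and K [measurable]: "K \<in> N \<rightarrow>\<^sub>M prob_algebra S"
    and F [measurable]: "F \<in> borel_measurable (N \<Otimes>\<^sub>M S)"
    and int: "integrable M (\<lambda>\<omega>. F (\<omega>, T \<omega>))"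
  shows "(\<integral>\<omega>. F (\<omega>, T \<omega>) \<partial>M) = (\<integral>\<omega>. \<integral>t. F (\<omega>, t) \<partial>K \<omega> \<partial>M)"
proof -
  have spN: "space N = space M" and setsN: "sets N \<subseteq> sets M" using sub by (auto simp: subalgebra_def)
  have idN [measurable]: "(\<lambda>x. x) \<in> M \<rightarrow>\<^sub>M N" using spN setsN by (auto simp: measurable_def)
  have K' [measurable]: "K \<in> N \<rightarrow>\<^sub>M subprob_algebra S" using K by (rule measurable_prob_algebraD)
  have KM [measurable]: "K \<in> M \<rightarrow>\<^sub>M subprob_algebra S" using measurable_compose[OF idN K'] by simp
  have sK: "\<omega> \<in> space M \<Longrightarrow> sets (K \<omega>) = sets S" for \<omega>
    using measurable_space[OF K, of \<omega>] by (simp add: space_prob_algebra spN)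
  define p where "p \<omega> = (\<integral>\<^sup>+t. ennreal (F (\<omega>, t)) \<partial>K \<omega>)" for \<omega>
  define m where "m \<omega> = (\<integral>\<^sup>+t. ennreal (- F (\<omega>, t)) \<partial>K \<omega>)" for \<omega>
  have FM [measurable]: "F \<in> borel_measurable (M \<Otimes>\<^sub>M S)"
    by (rule measurable_compose[OF _ F, where f = "\<lambda>z. z", simplified])
       (rule measurable_pair_measure_cong_id[OF idN])
  have [measurable]: "p \<in> borel_measurable M" "m \<in> borel_measurable M"
    unfolding p_def m_def
    by (rule nn_integral_measurable_subprob_algebra2[OF _ KM]; simp add: case_prod_unfold)+
  have p: "(\<integral>\<^sup>+\<omega>. ennreal (F (\<omega>, T \<omega>)) \<partial>M) = (\<integral>\<^sup>+\<omega>. p \<omega> \<partial>M)"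
    unfolding p_def by (rule nn[of "\<lambda>z. ennreal (F z)"]) measurable
  have m: "(\<integral>\<^sup>+\<omega>. ennreal (- F (\<omega>, T \<omega>)) \<partial>M) = (\<integral>\<^sup>+\<omega>. m \<omega> \<partial>M)"
    unfolding m_def by (rule nn[of "\<lambda>z. ennreal (- F z)"]) measurable
  have fin: "(\<integral>\<^sup>+\<omega>. p \<omega> \<partial>M) \<noteq> \<infinity>" "(\<integral>\<^sup>+\<omega>. m \<omega> \<partial>M) \<noteq> \<infinity>"
    using int unfolding real_integrable_def p m by auto
  have ae: "AE \<omega> in M. p \<omega> \<noteq> \<infinity>" "AE \<omega> in M. m \<omega> \<noteq> \<infinity>"
    using nn_integral_PInf_AE[OF _ fin(1)] nn_integral_PInf_AE[OF _ fin(2)] by auto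
  have intp: "integrable M (\<lambda>\<omega>. enn2real (p \<omega>))" "(\<integral>\<omega>. enn2real (p \<omega>) \<partial>M) = enn2real (\<integral>\<^sup>+\<omega>. p \<omega> \<partial>M)"
    and intm: "integrable M (\<lambda>\<omega>. enn2real (m \<omega>))" "(\<integral>\<omega>. enn2real (m \<omega>) \<partial>M) = enn2real (\<integral>\<^sup>+\<omega>. m \<omega> \<partial>M)"
  proof -
    have e: "(\<integral>\<^sup>+\<omega>. ennreal (enn2real (p \<omega>)) \<partial>M) = (\<integral>\<^sup>+\<omega>. p \<omega> \<partial>M)"
      "(\<integral>\<^sup>+\<omega>. ennreal (enn2real (m \<omega>)) \<partial>M) = (\<integral>\<^sup>+\<omega>. m \<omega> \<partial>M)"
      using ae by (auto intro!: nn_integral_cong_AE simp: less_top)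
    show "integrable M (\<lambda>\<omega>. enn2real (p \<omega>))" "integrable M (\<lambda>\<omega>. enn2real (m \<omega>))"
      using fin e by (auto intro!: integrableI_nonneg simp: less_top)
    show "(\<integral>\<omega>. enn2real (p \<omega>) \<partial>M) = enn2real (\<integral>\<^sup>+\<omega>. p \<omega> \<partial>M)"
      "(\<integral>\<omega>. enn2real (m \<omega>) \<partial>M) = enn2real (\<integral>\<^sup>+\<omega>. m \<omega> \<partial>M)"
      using e by (subst integral_eq_nn_integral; simp)+
  qed
  have "(\<integral>\<omega>. \<integral>t. F (\<omega>, t) \<partial>K \<omega> \<partial>M) = (\<integral>\<omega>. enn2real (p \<omega>) - enn2real (m \<omega>) \<partial>M)"
  proof (rule integral_cong_AE)
    show "(\<lambda>\<omega>. \<integral>t. F (\<omega>, t) \<partial>K \<omega>) \<in> borel_measurable M"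
      by (rule integral_measurable_subprob_algebra2[OF _ KM]) (simp add: case_prod_unfold)
    show "AE \<omega> in M. (\<integral>t. F (\<omega>, t) \<partial>K \<omega>) = enn2real (p \<omega>) - enn2real (m \<omega>)"
      using ae AE_space
    proof eventually_elim
      case (elim \<omega>)
      have "(\<lambda>t. F (\<omega>, t)) \<in> borel_measurable (K \<omega>)"
        using elim spN sK[of \<omega>] by (subst measurable_cong_sets[OF sK refl]) auto
      hence "integrable (K \<omega>) (\<lambda>t. F (\<omega>, t))"
        using elim by (auto simp: real_integrable_def p_def m_def)
      thus ?case by (simp add: real_lebesgue_integral_def p_def m_def)
    qed
  qed measurable
  also have "\<dots> = enn2real (\<integral>\<^sup>+\<omega>. p \<omega> \<partial>M) - enn2real (\<integral>\<^sup>+\<omega>. m \<omega> \<partial>M)"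
    using intp intm by simp
  also have "\<dots> = (\<integral>\<omega>. F (\<omega>, T \<omega>) \<partial>M)"
    using int by (simp add: real_lebesgue_integral_def p m)
  finally show ?thesis ..
qed

text \<open>A uniform bound makes every inner integral converge, so real and imaginary parts can be
  treated separately.\<close>

lemma complex_integral_disintegration:
  fixes T :: "'a \<Rightarrow> 'b" and K :: "'a \<Rightarrow> 'b measure" and F :: "'a \<times> 'b \<Rightarrow> complex"
  assumes M: "prob_space M"
    and nn: "\<And>F :: 'a \<times> 'b \<Rightarrow> ennreal. F \<in> borel_measurable (N \<Otimes>\<^sub>M S) \<Longrightarrow>
      (\<integral>\<^sup>+\<omega>. F (\<omega>, T \<omega>) \<partial>M) = (\<integral>\<^sup>+\<omega>. \<integral>\<^sup>+t. F (\<omega>, t) \<partial>K \<omega> \<partial>M)"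
    and sub: "subalgebra M N" and K [measurable]: "K \<in> N \<rightarrow>\<^sub>M prob_algebra S"
    and T [measurable]: "T \<in> M \<rightarrow>\<^sub>M S"
    and F [measurable]: "F \<in> borel_measurable (N \<Otimes>\<^sub>M S)" and bound: "\<And>z. norm (F z) \<le> B"
  shows "(\<integral>\<omega>. F (\<omega>, T \<omega>) \<partial>M) = (\<integral>\<omega>. \<integral>t. F (\<omega>, t) \<partial>K \<omega> \<partial>M)"
proof -
  interpret prob_space M by fact
  have spN: "space N = space M" and setsN: "sets N \<subseteq> sets M" using sub by (auto simp: subalgebra_def)
  have idN [measurable]: "(\<lambda>x. x) \<in> M \<rightarrow>\<^sub>M N" using spN setsN by (auto simp: measurable_def)
  have K' [measurable]: "K \<in> N \<rightarrow>\<^sub>M subprob_algebra S" using K by (rule measurable_prob_algebraD)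
  have KM [measurable]: "K \<in> M \<rightarrow>\<^sub>M subprob_algebra S" using measurable_compose[OF idN K'] by simp
  have sK: "\<omega> \<in> space M \<Longrightarrow> sets (K \<omega>) = sets S" and pK: "\<omega> \<in> space M \<Longrightarrow> prob_space (K \<omega>)" for \<omega>
    using measurable_space[OF K, of \<omega>] by (simp_all add: space_prob_algebra spN)
  have FM [measurable]: "F \<in> borel_measurable (M \<Otimes>\<^sub>M S)"
    by (rule measurable_compose[OF _ F, where f = "\<lambda>z. z", simplified])
       (rule measurable_pair_measure_cong_id[OF idN])
  have int1: "integrable M (\<lambda>\<omega>. F (\<omega>, T \<omega>))"
    by (rule integrable_const_bound[where B=B]) (auto simp: bound)
  have intK: "integrable (K \<omega>) (\<lambda>t. F (\<omega>, t))" if w: "\<omega> \<in> space M" for \<omega>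
  proof -
    interpret Kw: prob_space "K \<omega>" using pK[OF w] .
    have "(\<lambda>t. F (\<omega>, t)) \<in> borel_measurable (K \<omega>)"
      using w spN by (subst measurable_cong_sets[OF sK refl]) auto
    thus ?thesis by (intro Kw.integrable_const_bound[where B=B]) (auto simp: bound)
  qed
  have Re: "(\<integral>t. Re (F (\<omega>, t)) \<partial>K \<omega>) = Re (\<integral>t. F (\<omega>, t) \<partial>K \<omega>)"
    and Im: "(\<integral>t. Im (F (\<omega>, t)) \<partial>K \<omega>) = Im (\<integral>t. F (\<omega>, t) \<partial>K \<omega>)" if w: "\<omega> \<in> space M" for \<omega>
    using intK[OF w] by (simp_all)
  have [measurable]: "(\<lambda>\<omega>. \<integral>t. F (\<omega>, t) \<partial>K \<omega>) \<in> borel_measurable M"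
    by (rule integral_measurable_subprob_algebra2[OF _ KM]) (simp add: case_prod_unfold)
  have nb: "norm (\<integral>t. F (\<omega>, t) \<partial>K \<omega>) \<le> B" if w: "\<omega> \<in> space M" for \<omega>
  proof -
    interpret Kw: prob_space "K \<omega>" using pK[OF w] .
    have "norm (\<integral>t. F (\<omega>, t) \<partial>K \<omega>) \<le> (\<integral>t. norm (F (\<omega>, t)) \<partial>K \<omega>)" by (rule integral_norm_bound)
    also have "\<dots> \<le> B"
      using intK[OF w] by (intro Kw.integral_le_const) (auto simp: bound)
    finally show ?thesis .
  qed
  have int2: "integrable M (\<lambda>\<omega>. \<integral>t. F (\<omega>, t) \<partial>K \<omega>)"
    by (rule integrable_const_bound[where B=B]) (auto simp: nb)
  have "(\<integral>\<omega>. Re (F (\<omega>, T \<omega>)) \<partial>M) = (\<integral>\<omega>. \<integral>t. Re (F (\<omega>, t)) \<partial>K \<omega> \<partial>M)"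
    using int1 by (intro integral_disintegration[OF nn sub K, where F = "\<lambda>z. Re (F z)"]) auto
  also have "\<dots> = (\<integral>\<omega>. Re (\<integral>t. F (\<omega>, t) \<partial>K \<omega>) \<partial>M)"
    by (intro Bochner_Integration.integral_cong refl Re)
  finally have R: "(\<integral>\<omega>. Re (F (\<omega>, T \<omega>)) \<partial>M) = (\<integral>\<omega>. Re (\<integral>t. F (\<omega>, t) \<partial>K \<omega>) \<partial>M)" .
  have "(\<integral>\<omega>. Im (F (\<omega>, T \<omega>)) \<partial>M) = (\<integral>\<omega>. \<integral>t. Im (F (\<omega>, t)) \<partial>K \<omega> \<partial>M)"
    using int1 by (intro integral_disintegration[OF nn sub K, where F = "\<lambda>z. Im (F z)"]) auto
  also have "\<dots> = (\<integral>\<omega>. Im (\<integral>t. F (\<omega>, t) \<partial>K \<omega>) \<partial>M)"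
    by (intro Bochner_Integration.integral_cong refl Im)
  finally have I: "(\<integral>\<omega>. Im (F (\<omega>, T \<omega>)) \<partial>M) = (\<integral>\<omega>. Im (\<integral>t. F (\<omega>, t) \<partial>K \<omega>) \<partial>M)" .
  show ?thesis
    using R I int1 int2 by (intro complex_eqI) simp_all
qed

section \<open>Conditional law of one pair of daughters\<close>

context bifurcating_markov_chain
begin

lemma P_measurable [measurable]: "P \<in> borel \<rightarrow>\<^sub>M prob_algebra (borel \<Otimes>\<^sub>M borel)"
  using tree_kernel by (simp add: tree_kernel_def)

lemma P_measurable_subprob [measurable]: "P \<in> borel \<rightarrow>\<^sub>M subprob_algebra (borel \<Otimes>\<^sub>M borel)"
  by (rule measurable_prob_algebraD) measurable

lemma prob_space_P: "prob_space (P x)"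
  and sets_P [measurable_cong]: "sets (P x) = sets (borel \<Otimes>\<^sub>M borel)"
  using measurable_space[OF P_measurable, of x] by (simp_all add: space_prob_algebra)

lemma space_P [simp]: "space (P x) = UNIV"
  using sets_eq_imp_space_eq[OF sets_P, of x] by (simp add: space_pair_measure)

lemma space_Filt [simp]: "space (Filt q) = space M"
  using subalgebra[of q] by (simp add: subalgebra_def)

lemma measurable_from_Filt: "Z \<in> Filt q \<rightarrow>\<^sub>M N \<Longrightarrow> Z \<in> M \<rightarrow>\<^sub>M N"
  by (rule measurable_from_subalg[OF subalgebra])

lemma Filt_mono: "q \<le> r \<Longrightarrow> Z \<in> Filt q \<rightarrow>\<^sub>M N \<Longrightarrow> Z \<in> Filt r \<rightarrow>\<^sub>M N"
  using sets_F_mono[of q r] by (auto simp: measurable_def)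

lemma X_measurable_Filt: "n \<in> generation q \<Longrightarrow> X n \<in> Filt q \<rightarrow>\<^sub>M borel"
  using adapted[of n] by (auto simp: mem_generation_iff)

lemma X_measurable: "n \<ge> 1 \<Longrightarrow> X n \<in> M \<rightarrow>\<^sub>M borel"
  using adapted[of n] by (auto intro: measurable_from_Filt)

definition daughters :: "nat \<Rightarrow> 'a \<Rightarrow> 's \<times> 's" where
  "daughters n \<omega> = (X (2 * n) \<omega>, X (2 * n + 1) \<omega>)"

lemma daughters_measurable: "n \<ge> 1 \<Longrightarrow> daughters n \<in> M \<rightarrow>\<^sub>M borel \<Otimes>\<^sub>M borel"
  unfolding daughters_def by (intro measurable_Pair X_measurable) auto

lemma daughters_measurable_Filt:
  "n \<in> generation q \<Longrightarrow> daughters n \<in> Filt (Suc q) \<rightarrow>\<^sub>M borel \<Otimes>\<^sub>M borel"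
  unfolding daughters_def using generation_children[of n q]
  by (intro measurable_Pair X_measurable_Filt) auto

text \<open>
  Adjoining daughters of other vertices of the same generation to \<open>Filt q\<close> expresses the conditional
  independence within a generation.
\<close>

definition Filt_daughters :: "nat \<Rightarrow> nat set \<Rightarrow> 'a measure" where
  "Filt_daughters q I = sigma (space M)
     {A \<inter> (\<Inter>i\<in>I. daughters i -` B i) |A B. A \<in> sets (Filt q) \<and> (\<forall>i. B i \<in> sets (borel \<Otimes>\<^sub>M borel))}"

lemma space_Filt_daughters [simp]: "space (Filt_daughters q I) = space M"
  unfolding Filt_daughters_def by (simp add: space_measure_of_conv)

lemma sets_Filt_daughters:
  "sets (Filt_daughters q I) = sigma_sets (space M)
     {A \<inter> (\<Inter>i\<in>I. daughters i -` B i) |A B. A \<in> sets (Filt q) \<and> (\<forall>i. B i \<in> sets (borel \<Otimes>\<^sub>M borel))}"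
  unfolding Filt_daughters_def
  by (rule sets_measure_of) (use sets.sets_into_space[of _ "Filt q" for q] in fastforce)

lemma cylinder_sets:
  assumes A: "A \<in> sets (Filt q)" and B: "\<And>i. B i \<in> sets (borel \<Otimes>\<^sub>M borel)" and I: "I \<subseteq> generation q"
  shows "A \<inter> (\<Inter>i\<in>I. daughters i -` B i) \<in> sets M"
proof -
  have AM: "A \<in> sets M" using A subalgebra[of q] by (auto simp: subalgebra_def)
  \<comment> \<open>The intersection over an empty index set is \<open>UNIV\<close> and not
    \<open>space M\<close>, so \<open>I = {}\<close> has to be separated before each preimage is cut
    down to \<open>space M\<close>.\<close>
  have "A \<inter> (\<Inter>i\<in>I. daughters i -` B i) = (if I = {} then A else A \<inter> (\<Inter>i\<in>I. daughters i -` B i \<inter> space M))"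
    using sets.sets_into_space[OF AM] by auto
  also have "\<dots> \<in> sets M"
  proof (cases "I = {}")
    case False
    have "finite I" using I by (rule finite_subset) simp
    moreover have "daughters i -` B i \<inter> space M \<in> sets M" if "i \<in> I" for i
      using that I generation_pos by (intro measurable_sets[OF daughters_measurable B]) auto
    ultimately have "(\<Inter>i\<in>I. daughters i -` B i \<inter> space M) \<in> sets M"
      using False by (intro sets.finite_INT) auto
    thus ?thesis using False sets.Int[OF AM] by presburger
  qed (use AM in simp)
  finally show ?thesis .
qed

lemma subalgebra_Filt_daughters:
  assumes "I \<subseteq> generation q"
  shows "subalgebra M (Filt_daughters q I)"
  unfolding subalgebra_def sets_Filt_daughters
  using assms by (auto intro!: sets.sigma_sets_subset cylinder_sets)

lemma Filt_le_Filt_daughters: "Z \<in> Filt q \<rightarrow>\<^sub>M N \<Longrightarrow> Z \<in> Filt_daughters q I \<rightarrow>\<^sub>M N"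
proof (rule measurableI)
  fix A assume Z: "Z \<in> Filt q \<rightarrow>\<^sub>M N" and A: "A \<in> sets N"
  have "Z -` A \<inter> space M \<in> sets (Filt q)" using measurable_sets[OF Z A] by simp
  moreover have "Z -` A \<inter> space M = (Z -` A \<inter> space M) \<inter> (\<Inter>i\<in>I. daughters i -` UNIV)" by simp
  moreover have "UNIV \<in> sets (borel \<Otimes>\<^sub>M (borel :: 's measure))"
    using sets.top[of "borel \<Otimes>\<^sub>M (borel :: 's measure)"] by (simp add: space_pair_measure)
  ultimately show "Z -` A \<inter> space (Filt_daughters q I) \<in> sets (Filt_daughters q I)"
    unfolding sets_Filt_daughters space_Filt_daughters
    by (intro sigma_sets.Basic CollectI exI[of _ "Z -` A \<inter> space M"] exI[of _ "\<lambda>_. UNIV"]) auto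
qed (auto dest: measurable_space)

lemma daughters_measurable_Filt_daughters:
  assumes i: "i \<in> I"
  shows "daughters i \<in> Filt_daughters q I \<rightarrow>\<^sub>M borel \<Otimes>\<^sub>M borel"
proof (rule measurableI)
  fix A :: "('s \<times> 's) set" assume A: "A \<in> sets (borel \<Otimes>\<^sub>M borel)"
  have "UNIV \<in> sets (borel \<Otimes>\<^sub>M (borel :: 's measure))"
    using sets.top[of "borel \<Otimes>\<^sub>M (borel :: 's measure)"] by (simp add: space_pair_measure)
  moreover have "daughters i -` A \<inter> space M = space M \<inter> (\<Inter>j\<in>I. daughters j -` (if j = i then A else UNIV))"
    using i by auto
  moreover have "space M \<in> sets (Filt q)" using sets.top[of "Filt q"] by simp
  ultimately show "daughters i -` A \<inter> space (Filt_daughters q I) \<in> sets (Filt_daughters q I)"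
    unfolding sets_Filt_daughters space_Filt_daughters using A
    by (intro sigma_sets.Basic CollectI exI[of _ "space M"] exI[of _ "\<lambda>j. if j = i then A else UNIV"]) auto
qed (simp add: space_pair_measure)

lemma pair_op_measurable:
  assumes "h \<in> borel_measurable (borel \<Otimes>\<^sub>M borel)"
  shows "pair_op P h \<in> borel_measurable borel"
  unfolding pair_op_def using assms
  by (intro integral_measurable_subprob_algebra2[where N = "borel \<Otimes>\<^sub>M borel"]) (auto simp: case_prod_unfold)

lemma pair_op_indicator: "B \<in> sets (borel \<Otimes>\<^sub>M borel) \<Longrightarrow> pair_op P (indicator B) x = measure (P x) B"
  by (simp add: pair_op_def case_prod_unfold)

lemma pair_op_one: "pair_op P (\<lambda>_. 1) x = 1"
  using prob_space.prob_space[OF prob_space_P, of x] by (simp add: pair_op_def case_prod_unfold)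

text \<open>The conditional expectation is tested against a bounded weight known at time
  \<open>q\<close>. This integrated form can be read in both directions, which the next lemma
  exploits; the bound \<open>1\<close> covers indicators and constants.\<close>

lemma branching_expectation:
  assumes Z: "Z \<in> borel_measurable (Filt q)" and Zb: "\<And>\<omega>. \<bar>Z \<omega>\<bar> \<le> b"
    and h: "\<And>n. h n \<in> borel_measurable (borel \<Otimes>\<^sub>M borel)" and hb: "\<And>n z. \<bar>h n z\<bar> \<le> (1::real)"
  shows "(\<integral>\<omega>. Z \<omega> * (\<Prod>n\<in>generation q. h n (daughters n \<omega>)) \<partial>M)
       = (\<integral>\<omega>. Z \<omega> * (\<Prod>n\<in>generation q. pair_op P (h n) (X n \<omega>)) \<partial>M)"
proof -
  interpret finite_measure_subalgebra M "Filt q" by unfold_locales (rule subalgebra)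
  have [measurable]: "Z \<in> borel_measurable M" using Z by (rule measurable_from_Filt)
  have m: "(\<lambda>\<omega>. \<Prod>n\<in>generation q. h n (daughters n \<omega>)) \<in> borel_measurable M"
    using generation_pos by (intro borel_measurable_prod measurable_compose[OF daughters_measurable h]) auto
  have "\<bar>\<Prod>n\<in>generation q. h n (daughters n \<omega>)\<bar> \<le> 1" for \<omega>
    unfolding abs_prod by (rule prod_le_1) (auto simp: hb)
  hence int: "integrable M (\<lambda>\<omega>. Z \<omega> * (\<Prod>n\<in>generation q. h n (daughters n \<omega>)))"
    using m mult_mono[OF Zb, of "\<bar>\<Prod>n\<in>generation q. h n (daughters n \<omega>)\<bar>" 1 for \<omega>]
      order_trans[OF abs_ge_zero Zb]
    by (intro integrable_const_bound[where B="b * 1"]) (auto simp: abs_mult)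
  have ae: "AE \<omega> in M. real_cond_exp M (Filt q) (\<lambda>\<omega>. \<Prod>n\<in>generation q. h n (daughters n \<omega>)) \<omega>
        = (\<Prod>n\<in>generation q. pair_op P (h n) (X n \<omega>))"
    unfolding daughters_def
    by (rule branching) (use h hb in \<open>auto simp: bounded_iff intro!: exI[of _ 1]\<close>)
  have "(\<integral>\<omega>. Z \<omega> * (\<Prod>n\<in>generation q. h n (daughters n \<omega>)) \<partial>M)
      = (\<integral>\<omega>. Z \<omega> * real_cond_exp M (Filt q) (\<lambda>\<omega>. \<Prod>n\<in>generation q. h n (daughters n \<omega>)) \<omega> \<partial>M)"
    by (rule real_cond_exp_intg(2)[symmetric, OF int Z m])
  also have "\<dots> = (\<integral>\<omega>. Z \<omega> * (\<Prod>n\<in>generation q. pair_op P (h n) (X n \<omega>)) \<partial>M)"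
  proof (rule integral_cong_AE)
    show "(\<lambda>\<omega>. Z \<omega> * (\<Prod>n\<in>generation q. pair_op P (h n) (X n \<omega>))) \<in> borel_measurable M"
      using generation_pos
      by (intro borel_measurable_times borel_measurable_prod measurable_compose[OF X_measurable pair_op_measurable[OF h]]) auto
  qed (use ae in auto)
  finally show ?thesis .
qed

text \<open>The branching identity is used twice. Read forwards, it replaces every pair by its
  kernel, so that the pair of \<open>n\<close> contributes \<open>P (X n \<omega>) D\<close>. This
  number is known at time \<open>q\<close> and can join the weight; the identity read backwards then
  restores the events of the other pairs.\<close>

lemma emeasure_cylinder_daughters:
  assumes n: "n \<in> generation q" "n \<notin> I" and I: "I \<subseteq> generation q"
    and A: "A \<in> sets (Filt q)" and B: "\<And>i. B i \<in> sets (borel \<Otimes>\<^sub>M borel)" and D: "D \<in> sets (borel \<Otimes>\<^sub>M borel)"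
  defines "C \<equiv> A \<inter> (\<Inter>i\<in>I. daughters i -` B i)"
  shows "emeasure M (C \<inter> daughters n -` D) = (\<integral>\<^sup>+\<omega>. indicator C \<omega> * emeasure (P (X n \<omega>)) D \<partial>M)"
proof -
  interpret PX: prob_space "P x" for x by (rule prob_space_P)
  define h :: "nat \<Rightarrow> 's \<times> 's \<Rightarrow> real" where "h i = (if i \<in> I then indicator (B i) else (\<lambda>_. 1))" for i
  define k :: "nat \<Rightarrow> 's \<times> 's \<Rightarrow> real" where "k = h(n := indicator D)"
  have h: "h i \<in> borel_measurable (borel \<Otimes>\<^sub>M borel)" and hb: "\<bar>h i z\<bar> \<le> 1" for i z
    using B by (auto simp: h_def indicator_def)
  have k: "k i \<in> borel_measurable (borel \<Otimes>\<^sub>M borel)" and kb: "\<bar>k i z\<bar> \<le> 1" for i z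
    using D h hb by (auto simp: k_def indicator_def)
  have Zm: "(\<lambda>\<omega>. indicator A \<omega> * measure (P (X n \<omega>)) D :: real) \<in> borel_measurable (Filt q)"
    using A by (intro borel_measurable_times borel_measurable_indicator
        measurable_compose[OF X_measurable_Filt[OF n(1)]]
        measurable_compose[OF P_measurable_subprob measurable_measure_subprob_algebra] D) auto
  have split: "(\<Prod>i\<in>generation q. w i) = w n * (\<Prod>i\<in>generation q - {n}. w i)" for w :: "nat \<Rightarrow> real"
    using n by (simp add: prod.remove)
  have rest: "(\<Prod>i\<in>generation q - {n}. h i (w i)) = (\<Prod>i\<in>I. indicator (B i) (w i))" for w
    using I n by (subst prod.mono_neutral_right[of _ I]) (auto simp: h_def intro: prod.cong)
  have ind: "indicator A \<omega> * (\<Prod>i\<in>I. indicator (B i) (daughters i \<omega>)) = (indicator C \<omega> :: real)" for \<omega>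
    using finite_subset[OF I] by (auto simp: C_def indicator_def prod_zero_iff intro!: prod.neutral)
  have nI: "h n = (\<lambda>_. 1)" using n by (simp add: h_def)
  have ksame: "(\<Prod>i\<in>generation q - {n}. k i (w i)) = (\<Prod>i\<in>generation q - {n}. h i (w i))"
    and kPsame: "(\<Prod>i\<in>generation q - {n}. pair_op P (k i) (v i)) = (\<Prod>i\<in>generation q - {n}. pair_op P (h i) (v i))" for w v
    by (auto simp: k_def intro!: prod.cong)
  have "(\<integral>\<omega>. indicator (C \<inter> daughters n -` D) \<omega> \<partial>M) = (\<integral>\<omega>. indicator A \<omega> * (\<Prod>i\<in>generation q. k i (daughters i \<omega>)) \<partial>M)"
    unfolding split ksame rest
    by (intro Bochner_Integration.integral_cong refl)
       (simp add: k_def indicator_inter_arith ind[symmetric] mult_ac, simp add: indicator_def)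
  also have "\<dots> = (\<integral>\<omega>. indicator A \<omega> * (\<Prod>i\<in>generation q. pair_op P (k i) (X i \<omega>)) \<partial>M)"
    using A by (intro branching_expectation[where b=1] k kb) (auto simp: indicator_def)
  also have "\<dots> = (\<integral>\<omega>. (indicator A \<omega> * measure (P (X n \<omega>)) D) * (\<Prod>i\<in>generation q. pair_op P (h i) (X i \<omega>)) \<partial>M)"
    unfolding split kPsame nI pair_op_one by (simp add: k_def pair_op_indicator D mult_ac)
  \<comment> \<open>Here branching runs backwards: slot \<open>n\<close> now holds the constant
    \<open>1\<close>, and the probability of \<open>D\<close> has become part of the weight.\<close>
  also have "\<dots> = (\<integral>\<omega>. (indicator A \<omega> * measure (P (X n \<omega>)) D) * (\<Prod>i\<in>generation q. h i (daughters i \<omega>)) \<partial>M)"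
    by (intro branching_expectation[symmetric, where b=1] h hb Zm) (auto simp: indicator_def)
  also have "\<dots> = (\<integral>\<omega>. indicator C \<omega> * measure (P (X n \<omega>)) D \<partial>M)"
    unfolding split nI rest ind[symmetric] by (simp add: mult_ac)
  finally have eq: "(\<integral>\<omega>. indicator (C \<inter> daughters n -` D) \<omega> \<partial>M) = (\<integral>\<omega>. indicator C \<omega> * measure (P (X n \<omega>)) D \<partial>M)" .
  have CM: "C \<in> sets M" unfolding C_def by (rule cylinder_sets[OF A B I])
  have Dn: "daughters n -` D \<inter> space M \<in> sets M"
    using n generation_pos by (intro measurable_sets[OF daughters_measurable D]) auto
  have CD: "C \<inter> daughters n -` D \<in> sets M"
    using sets.Int[OF CM Dn] sets.sets_into_space[OF CM] by (metis inf.absorb_iff1 inf_assoc inf_commute)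
  have mP: "(\<lambda>\<omega>. measure (P (X n \<omega>)) D) \<in> borel_measurable M"
    using n generation_pos by (intro measurable_compose[OF X_measurable]
        measurable_compose[OF P_measurable_subprob measurable_measure_subprob_algebra] D) auto
  have "emeasure M (C \<inter> daughters n -` D) = ennreal (\<integral>\<omega>. indicator (C \<inter> daughters n -` D) \<omega> \<partial>M)"
    using CD by (simp add: emeasure_eq_measure sets.Int_space_eq2)
  also have "\<dots> = (\<integral>\<^sup>+\<omega>. ennreal (indicator C \<omega> * measure (P (X n \<omega>)) D) \<partial>M)"
    unfolding eq using CM mP
    by (intro nn_integral_eq_integral[symmetric] integrable_const_bound[where B=1]) (auto simp: indicator_def)
  also have "\<dots> = (\<integral>\<^sup>+\<omega>. indicator C \<omega> * emeasure (P (X n \<omega>)) D \<partial>M)"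
    by (intro nn_integral_cong) (auto simp: indicator_def PX.emeasure_eq_measure)
  finally show ?thesis .
qed

lemma kernel_at_measurable:
  "n \<in> generation q \<Longrightarrow> (\<lambda>\<omega>. P (X n \<omega>)) \<in> Filt_daughters q I \<rightarrow>\<^sub>M prob_algebra (borel \<Otimes>\<^sub>M borel)"
  by (intro Filt_le_Filt_daughters measurable_compose[OF X_measurable_Filt P_measurable])

text \<open>This is the conditional independence within a generation: knowing the pairs below the
  vertices of \<open>I\<close> in addition to the past does not change the law
  \<open>P (X n)\<close> of the pair below \<open>n\<close>. The cylinders form the generator
  required by the abstract disintegration.\<close>

lemma nn_integral_daughters:
  fixes F :: "'a \<times> ('s \<times> 's) \<Rightarrow> ennreal"
  assumes n: "n \<in> generation q" "n \<notin> I" and I: "I \<subseteq> generation q"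
    and F: "F \<in> borel_measurable (Filt_daughters q I \<Otimes>\<^sub>M (borel \<Otimes>\<^sub>M borel))"
  shows "(\<integral>\<^sup>+\<omega>. F (\<omega>, daughters n \<omega>) \<partial>M) = (\<integral>\<^sup>+\<omega>. \<integral>\<^sup>+t. F (\<omega>, t) \<partial>P (X n \<omega>) \<partial>M)"
proof (rule nn_integral_disintegration[OF _ subalgebra_Filt_daughters[OF I] _ kernel_at_measurable[OF n(1)] _ _ _ sets_Filt_daughters _ F])
  let ?G = "{A \<inter> (\<Inter>i\<in>I. daughters i -` B i) |A B. A \<in> sets (Filt q) \<and> (\<forall>i. B i \<in> sets (borel \<Otimes>\<^sub>M borel))}"
  show "prob_space M" by (rule prob_space_axioms)
  show "daughters n \<in> M \<rightarrow>\<^sub>M borel \<Otimes>\<^sub>M borel" using n generation_pos by (intro daughters_measurable) auto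
  show "Int_stable ?G"
  proof (rule Int_stableI)
    fix a b assume "a \<in> ?G" "b \<in> ?G"
    then obtain A B A' B' where "a = A \<inter> (\<Inter>i\<in>I. daughters i -` B i)" "b = A' \<inter> (\<Inter>i\<in>I. daughters i -` B' i)"
      "A \<in> sets (Filt q)" "A' \<in> sets (Filt q)" "\<And>i. B i \<in> sets (borel \<Otimes>\<^sub>M borel)" "\<And>i. B' i \<in> sets (borel \<Otimes>\<^sub>M borel)"
      by blast
    thus "a \<inter> b \<in> ?G"
      by (intro CollectI exI[of _ "A \<inter> A'"] exI[of _ "\<lambda>i. B i \<inter> B' i"]) auto
  qed
  show "?G \<subseteq> Pow (space M)" using sets.sets_into_space[of _ "Filt q"] by fastforce
  have "UNIV \<in> sets (borel \<Otimes>\<^sub>M (borel :: 's measure))"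
    using sets.top[of "borel \<Otimes>\<^sub>M (borel :: 's measure)"] by (simp add: space_pair_measure)
  moreover have "space M \<in> sets (Filt q)" using sets.top[of "Filt q"] by simp
  ultimately show "space M \<in> ?G"
    by (intro CollectI exI[of _ "space M"] exI[of _ "\<lambda>_. UNIV"]) auto
  fix C and D :: "('s \<times> 's) set" assume "C \<in> ?G" and D: "D \<in> sets (borel \<Otimes>\<^sub>M borel)"
  thus "emeasure M (C \<inter> daughters n -` D) = (\<integral>\<^sup>+\<omega>. indicator C \<omega> * emeasure (P (X n \<omega>)) D \<partial>M)"
    using emeasure_cylinder_daughters[OF n I _ _ D] by blast
qed

lemma integral_daughters:
  fixes F :: "'a \<times> ('s \<times> 's) \<Rightarrow> real"
  assumes n: "n \<in> generation q" "n \<notin> I" and I: "I \<subseteq> generation q"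
    and F: "F \<in> borel_measurable (Filt_daughters q I \<Otimes>\<^sub>M (borel \<Otimes>\<^sub>M borel))"
    and int: "integrable M (\<lambda>\<omega>. F (\<omega>, daughters n \<omega>))"
  shows "(\<integral>\<omega>. F (\<omega>, daughters n \<omega>) \<partial>M) = (\<integral>\<omega>. \<integral>t. F (\<omega>, t) \<partial>P (X n \<omega>) \<partial>M)"
  by (rule integral_disintegration[OF nn_integral_daughters[OF n I] subalgebra_Filt_daughters[OF I]
        kernel_at_measurable[OF n(1)] F int])

lemma complex_integral_daughters:
  fixes F :: "'a \<times> ('s \<times> 's) \<Rightarrow> complex"
  assumes n: "n \<in> generation q" "n \<notin> I" and I: "I \<subseteq> generation q"
    and F: "F \<in> borel_measurable (Filt_daughters q I \<Otimes>\<^sub>M (borel \<Otimes>\<^sub>M borel))"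
    and b: "\<And>z. norm (F z) \<le> B"
  shows "(\<integral>\<omega>. F (\<omega>, daughters n \<omega>) \<partial>M) = (\<integral>\<omega>. \<integral>t. F (\<omega>, t) \<partial>P (X n \<omega>) \<partial>M)"
  using n generation_pos
  by (intro complex_integral_disintegration[OF prob_space_axioms nn_integral_daughters[OF n I] subalgebra_Filt_daughters[OF I]
        kernel_at_measurable[OF n(1)] daughters_measurable F b]) auto

end

section \<open>Characteristic functions along generations\<close>

lemma exp_minus_diff_le:
  fixes a b :: real
  assumes "a \<ge> 0" "b \<ge> 0"
  shows "\<bar>exp (- a) - exp (- b)\<bar> \<le> \<bar>a - b\<bar>"
proof -
  have *: "exp (- x) - exp (- y) \<le> y - x" if "0 \<le> x" "x \<le> y" for x y :: real
  proof -
    have "exp (- x) - exp (- y) = exp (- x) * (1 - exp (x - y))"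
      by (simp add: algebra_simps flip: exp_add)
    also have "\<dots> \<le> 1 * (1 - exp (x - y))"
      using that by (intro mult_right_mono) auto
    also have "\<dots> \<le> y - x" using exp_ge_add_one_self[of "x - y"] by (simp only: mult_1_left)
    finally show ?thesis .
  qed
  show ?thesis
    using *[of a b] *[of b a] assms by (cases "a \<le> b") (auto simp: abs_if)
qed

lemma exp_minus_taylor:
  fixes a :: real
  assumes "a \<ge> 0"
  shows "\<bar>exp (- a) - (1 - a)\<bar> \<le> a\<^sup>2"
proof -
  have "exp (- a) = 1 / exp a" by (simp add: exp_minus inverse_eq_divide)
  also have "\<dots> \<le> 1 / (1 + a)" using assms by (intro divide_left_mono) auto
  also have "\<dots> \<le> 1 - a + a\<^sup>2"
  proof -
    have "1 \<le> 1 + a ^ 3" using assms by simp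
    also have "\<dots> = (1 - a + a\<^sup>2) * (1 + a)" by algebra
    finally show ?thesis using assms by (simp add: divide_le_eq)
  qed
  finally show ?thesis using exp_ge_add_one_self[of "- a"] by simp
qed

lemma (in prob_space) integrable_lower_power:
  fixes Y :: "'a \<Rightarrow> real"
  assumes [measurable]: "Y \<in> borel_measurable M" and 4: "integrable M (\<lambda>x. Y x ^ 4)"
  shows "integrable M Y" "integrable M (\<lambda>x. (Y x)\<^sup>2)" "integrable M (\<lambda>x. \<bar>Y x\<bar> ^ 3)"
proof -
  have p: "\<bar>y\<bar> ^ k \<le> 1 + y ^ 4" if "k \<le> 4" for k and y :: real
  proof (cases "\<bar>y\<bar> \<le> 1")
    case True
    thus ?thesis using power_le_one[of "\<bar>y\<bar>" k] by (simp add: add_increasing2)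
  next
    case False
    hence "\<bar>y\<bar> ^ k \<le> \<bar>y\<bar> ^ 4" using that by (intro power_increasing) auto
    thus ?thesis by (simp add: power_even_abs)
  qed
  have i: "integrable M (\<lambda>x. 1 + Y x ^ 4)" using 4 by simp
  show "integrable M Y"
    by (rule Bochner_Integration.integrable_bound[OF i]) (use p[of 1] in \<open>auto simp: abs_of_nonneg add_nonneg_nonneg\<close>)
  show "integrable M (\<lambda>x. (Y x)\<^sup>2)"
    by (rule Bochner_Integration.integrable_bound[OF i]) (use p[of 2] in \<open>auto simp: abs_of_nonneg add_nonneg_nonneg\<close>)
  show "integrable M (\<lambda>x. \<bar>Y x\<bar> ^ 3)"
    by (rule Bochner_Integration.integrable_bound[OF i]) (use p[of 3] in \<open>auto simp: abs_of_nonneg add_nonneg_nonneg\<close>)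
qed

lemma (in prob_space) square_expectation_le:
  fixes Y :: "'a \<Rightarrow> real"
  assumes "Y \<in> borel_measurable M" "integrable M Y" "integrable M (\<lambda>x. (Y x)\<^sup>2)"
  shows "(expectation Y)\<^sup>2 \<le> expectation (\<lambda>x. (Y x)\<^sup>2)"
  using variance_positive[of Y] variance_eq[of Y] assms by simp

text \<open>The third-order Taylor remainder costs \<open>\<bar>u\<bar>^3\<close> times the third
  absolute moment, and replacing \<open>1 - u^2 V / 2\<close> by the exponential costs
  \<open>u^4 V^2 / 4\<close>, where \<open>V^2 \<le> W\<close> by Jensen. Both are expressed through
  \<open>V\<close> and \<open>W\<close> alone, since the second and fourth conditional moments are
  the ones that members of \<open>F\<close> dominate.\<close>

lemma (in prob_space) iexp_expectation_bound:
  fixes Y :: "'a \<Rightarrow> real"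
  assumes Y [measurable]: "Y \<in> borel_measurable M" and 4: "integrable M (\<lambda>x. Y x ^ 4)"
    and mean: "expectation Y = 0"
  defines "V \<equiv> expectation (\<lambda>x. (Y x)\<^sup>2)" and "W \<equiv> expectation (\<lambda>x. Y x ^ 4)"
  shows "norm (expectation (\<lambda>x. iexp (u * Y x)) - of_real (exp (- (u\<^sup>2 * V / 2)))) \<le> (\<bar>u\<bar> ^ 3 + u ^ 4) * (V + W)"
proof -
  note int = integrable_lower_power[OF Y 4]
  have V0: "V \<ge> 0" and W0: "W \<ge> 0" unfolding V_def W_def by (auto intro: integral_nonneg_AE)
  have VW: "V\<^sup>2 \<le> W"
    using square_expectation_le[of "\<lambda>x. (Y x)\<^sup>2"] int 4 by (simp add: V_def W_def flip: power_mult)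
  have V2: "variance Y = V" using variance_eq[OF int(1,2)] mean by (simp add: V_def)
  have ch: "char (distr M borel Y) u = expectation (\<lambda>x. iexp (u * Y x))"
    unfolding char_def by (subst integral_distr) auto
  have "norm (expectation (\<lambda>x. iexp (u * Y x)) - (1 - u\<^sup>2 * V / 2))
      \<le> (u\<^sup>2 / 6) * expectation (\<lambda>x. min (6 * (Y x)\<^sup>2) (\<bar>u\<bar> * \<bar>Y x\<bar> ^ 3))"
    using char_approx3'[OF Y int(1,2) mean V2 refl, of u] by (simp add: ch)
  also have "expectation (\<lambda>x. min (6 * (Y x)\<^sup>2) (\<bar>u\<bar> * \<bar>Y x\<bar> ^ 3)) \<le> expectation (\<lambda>x. \<bar>u\<bar> * ((Y x)\<^sup>2 + Y x ^ 4))"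
  proof (rule integral_mono)
    show "integrable M (\<lambda>x. min (6 * (Y x)\<^sup>2) (\<bar>u\<bar> * \<bar>Y x\<bar> ^ 3))" using int by auto
    show "integrable M (\<lambda>x. \<bar>u\<bar> * ((Y x)\<^sup>2 + Y x ^ 4))" using int 4 by auto
    fix x
    \<comment> \<open>Expanded, the right side is
      \<open>y^4 - \<bar>y\<bar>^3 + y^2\<close>.\<close>
    have "0 \<le> (Y x)\<^sup>2 * ((\<bar>Y x\<bar> - 1)\<^sup>2 + \<bar>Y x\<bar>)" by simp
    hence "\<bar>Y x\<bar> ^ 3 \<le> (Y x)\<^sup>2 + Y x ^ 4"
      by (cases "Y x \<ge> 0") (auto simp: algebra_simps power2_eq_square power3_eq_cube power4_eq_xxxx)
    thus "min (6 * (Y x)\<^sup>2) (\<bar>u\<bar> * \<bar>Y x\<bar> ^ 3) \<le> \<bar>u\<bar> * ((Y x)\<^sup>2 + Y x ^ 4)"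
      by (intro min.coboundedI2 mult_left_mono) auto
  qed
  also have "expectation (\<lambda>x. \<bar>u\<bar> * ((Y x)\<^sup>2 + Y x ^ 4)) = \<bar>u\<bar> * (V + W)"
    using int 4 by (simp add: V_def W_def)
  finally have 1: "norm (expectation (\<lambda>x. iexp (u * Y x)) - (1 - u\<^sup>2 * V / 2)) \<le> (u\<^sup>2 / 6) * (\<bar>u\<bar> * (V + W))"
    by (simp add: mult_left_mono)
  have "\<bar>exp (- (u\<^sup>2 * V / 2)) - (1 - u\<^sup>2 * V / 2)\<bar> \<le> (u\<^sup>2 * V / 2)\<^sup>2"
    by (rule exp_minus_taylor) (use V0 in auto)
  also have "\<dots> = u ^ 4 * V\<^sup>2 / 4" by (simp add: power2_eq_square power4_eq_xxxx)
  also have "\<dots> \<le> u ^ 4 * (V + W)"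
  proof -
    have "u ^ 4 * V\<^sup>2 \<le> u ^ 4 * (V + W)" using VW V0 by (intro mult_left_mono) auto
    moreover have "0 \<le> u ^ 4 * (V + W)" using V0 W0 by auto
    ultimately show ?thesis by linarith
  qed
  finally have 2: "norm ((1 - u\<^sup>2 * V / 2) - exp (- (u\<^sup>2 * V / 2))) \<le> u ^ 4 * (V + W)"
    by (simp add: abs_minus_commute)
  have 2: "norm (of_real (1 - u\<^sup>2 * V / 2) - of_real (exp (- (u\<^sup>2 * V / 2))) :: complex) \<le> u ^ 4 * (V + W)"
    using 2 unfolding of_real_diff[symmetric] norm_of_real by simp
  have "(u\<^sup>2 / 6) * (\<bar>u\<bar> * (V + W)) \<le> \<bar>u\<bar> ^ 3 * (V + W)"
  proof -
    have "u\<^sup>2 * (\<bar>u\<bar> * (V + W)) = \<bar>u\<bar> ^ 3 * (V + W)"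
      by (simp add: power2_eq_square power3_eq_cube abs_if)
    moreover have "0 \<le> \<bar>u\<bar> ^ 3 * (V + W)" using V0 W0 by (intro mult_nonneg_nonneg) auto
    ultimately show ?thesis by linarith
  qed
  with 1 have 1: "norm (expectation (\<lambda>x. iexp (u * Y x)) - of_real (1 - u\<^sup>2 * V / 2)) \<le> \<bar>u\<bar> ^ 3 * (V + W)"
    by simp
  show ?thesis
    using norm_triangle_mono[OF 1 2] by (simp add: algebra_simps)
qed

lemma norm_prod_le_one:
  fixes w :: "'i \<Rightarrow> complex"
  shows "(\<And>i. i \<in> I \<Longrightarrow> norm (w i) \<le> 1) \<Longrightarrow> norm (prod w I) \<le> 1"
  unfolding prod_norm[symmetric] by (rule prod_le_1) auto

context bifurcating_markov_chain
begin

text \<open>The conditional characteristic function of \<open>g (\<Delta>\<^sub>i)\<close> given \<open>X\<^sub>i = x\<close>.\<close>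

definition cf :: "('s \<times> 's \<times> 's \<Rightarrow> real) \<Rightarrow> real \<Rightarrow> 's \<Rightarrow> complex" where
  "cf g u x = (\<integral>t. iexp (u * g (x, t)) \<partial>P x)"

lemma cf_measurable:
  assumes [measurable]: "g \<in> borel_measurable (borel \<Otimes>\<^sub>M borel \<Otimes>\<^sub>M borel)"
  shows "cf g u \<in> borel_measurable borel"
  unfolding cf_def
  by (rule integral_measurable_subprob_algebra2[OF _ P_measurable_subprob]) (simp add: case_prod_unfold)

lemma norm_cf_le: "norm (cf g u x) \<le> 1"
proof -
  interpret PX: prob_space "P x" by (rule prob_space_P)
  have "norm (cf g u x) \<le> (\<integral>t. norm (iexp (u * g (x, t))) \<partial>P x)"
    unfolding cf_def by (rule integral_norm_bound)
  also have "\<dots> \<le> 1" using PX.prob_space by simp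
  finally show ?thesis .
qed

lemma triangle_eq: "triangle X i \<omega> = (X i \<omega>, daughters i \<omega>)"
  by (simp add: triangle_def daughters_def)

lemma triangle_measurable_Filt:
  "i \<in> generation q \<Longrightarrow> triangle X i \<in> Filt (Suc q) \<rightarrow>\<^sub>M borel \<Otimes>\<^sub>M borel \<Otimes>\<^sub>M borel"
  unfolding triangle_eq[abs_def]
  by (intro measurable_Pair daughters_measurable_Filt Filt_mono[OF _ X_measurable_Filt, of q]) auto

lemma triangle_measurable:
  "i \<ge> 1 \<Longrightarrow> triangle X i \<in> M \<rightarrow>\<^sub>M borel \<Otimes>\<^sub>M borel \<Otimes>\<^sub>M borel"
  unfolding triangle_eq[abs_def] by (intro measurable_Pair daughters_measurable X_measurable) auto

text \<open>The vertices of \<open>I\<close> are integrated out one by one. Conditionally on the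
  past and the remaining pairs, vertex \<open>n\<close> contributes \<open>cf g u (X n)\<close>,
  which is known at time \<open>q\<close> and is absorbed into the weight. The induction therefore
  has to range over all weights \<open>Z\<close>.\<close>

lemma expectation_iexp_generation:
  fixes Z :: "'a \<Rightarrow> complex"
  assumes g [measurable]: "g \<in> borel_measurable (borel \<Otimes>\<^sub>M borel \<Otimes>\<^sub>M borel)"
    and I: "I \<subseteq> generation q"
    and Z: "Z \<in> borel_measurable (Filt q)" and Zb: "\<And>\<omega>. norm (Z \<omega>) \<le> 1"
  shows "(\<integral>\<omega>. Z \<omega> * (\<Prod>i\<in>I. iexp (u * g (triangle X i \<omega>))) \<partial>M) = (\<integral>\<omega>. Z \<omega> * (\<Prod>i\<in>I. cf g u (X i \<omega>)) \<partial>M)"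
proof -
  have "finite I" using I by (rule finite_subset) simp
  thus ?thesis using I Z Zb
  proof (induction I arbitrary: Z rule: finite_induct)
    case empty
    thus ?case by simp
  next
    case (insert n I)
    have n: "n \<in> generation q" "n \<notin> I" and I: "I \<subseteq> generation q" using insert by auto
    define Z' where "Z' \<omega> = Z \<omega> * (\<Prod>i\<in>I. iexp (u * g (triangle X i \<omega>)))" for \<omega>
    have tri [measurable]: "triangle X i \<in> Filt_daughters q I \<rightarrow>\<^sub>M borel \<Otimes>\<^sub>M borel \<Otimes>\<^sub>M borel" if "i \<in> I" for i
      unfolding triangle_eq[abs_def] using that I
      by (intro measurable_Pair daughters_measurable_Filt_daughters Filt_le_Filt_daughters X_measurable_Filt) auto
    have [measurable]: "X n \<in> Filt_daughters q I \<rightarrow>\<^sub>M borel"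
      by (intro Filt_le_Filt_daughters X_measurable_Filt n)
    have [measurable]: "Z \<in> borel_measurable (Filt_daughters q I)"
      by (intro Filt_le_Filt_daughters insert.prems)
    have Z' [measurable]: "Z' \<in> borel_measurable (Filt_daughters q I)"
      unfolding Z'_def by measurable
    have Z'b: "norm (Z' \<omega>) \<le> 1" for \<omega>
      unfolding Z'_def norm_mult prod_norm[symmetric] using insert.prems by simp
    have "(\<integral>\<omega>. Z \<omega> * (\<Prod>i\<in>insert n I. iexp (u * g (triangle X i \<omega>))) \<partial>M)
        = (\<integral>\<omega>. Z' \<omega> * iexp (u * g (X n \<omega>, daughters n \<omega>)) \<partial>M)"
      using insert.hyps by (simp add: Z'_def triangle_eq mult_ac)
    also have "\<dots> = (\<integral>\<omega>. \<integral>t. Z' \<omega> * iexp (u * g (X n \<omega>, t)) \<partial>P (X n \<omega>) \<partial>M)"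
      using Z'b complex_integral_daughters[OF n I, where B = 1 and F = "\<lambda>(\<omega>, t). Z' \<omega> * iexp (u * g (X n \<omega>, t))"]
      by (simp add: case_prod_unfold norm_mult)
    also have "\<dots> = (\<integral>\<omega>. (Z \<omega> * cf g u (X n \<omega>)) * (\<Prod>i\<in>I. iexp (u * g (triangle X i \<omega>))) \<partial>M)"
      by (simp add: cf_def Z'_def mult_ac)
    also have "\<dots> = (\<integral>\<omega>. (Z \<omega> * cf g u (X n \<omega>)) * (\<Prod>i\<in>I. cf g u (X i \<omega>)) \<partial>M)"
    proof (rule insert.IH[OF I])
      show "(\<lambda>\<omega>. Z \<omega> * cf g u (X n \<omega>)) \<in> borel_measurable (Filt q)"
        by (intro borel_measurable_times insert.prems measurable_compose[OF X_measurable_Filt[OF n(1)]] cf_measurable g)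
      show "norm (Z \<omega> * cf g u (X n \<omega>)) \<le> 1" for \<omega>
        unfolding norm_mult using insert.prems norm_cf_le by (intro mult_le_one) auto
    qed
    also have "\<dots> = (\<integral>\<omega>. Z \<omega> * (\<Prod>i\<in>insert n I. cf g u (X i \<omega>)) \<partial>M)"
      using insert.hyps by (simp add: mult_ac)
    finally show ?case .
  qed
qed

text \<open>
  Since the numbers \<open>c q\<close> are deterministic, the generations can be peeled off one at a time from the
  last one, which replaces a martingale central limit theorem.
\<close>

lemma expectation_iexp_tree:
  fixes c :: "nat \<Rightarrow> complex"
  assumes g [measurable]: "g \<in> borel_measurable (borel \<Otimes>\<^sub>M borel \<Otimes>\<^sub>M borel)"
    and A: "\<And>q. A q \<subseteq> generation q" and c: "\<And>q. norm (c q) \<le> 1"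
  shows "norm ((\<integral>\<omega>. (\<Prod>q<r. \<Prod>i\<in>A q. iexp (u * g (triangle X i \<omega>))) \<partial>M) - (\<Prod>q<r. c q))
     \<le> (\<Sum>q<r. \<integral>\<omega>. norm ((\<Prod>i\<in>A q. cf g u (X i \<omega>)) - c q) \<partial>M)"
proof (induction r)
  case 0
  show ?case using prob_space by simp
next
  case (Suc r)
  define Z where "Z \<omega> = (\<Prod>q<r. \<Prod>i\<in>A q. iexp (u * g (triangle X i \<omega>)))" for \<omega>
  define W where "W \<omega> = (\<Prod>i\<in>A r. cf g u (X i \<omega>))" for \<omega>
  \<comment> \<open>A triangle rooted in generation \<open>q\<close> reaches generation
    \<open>q + 1\<close>, which is at most \<open>r\<close> for \<open>q < r\<close>: the earlier
    triangles are exactly covered by \<open>Filt r\<close>.\<close>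
  have Z: "Z \<in> borel_measurable (Filt r)"
  proof -
    have "triangle X i \<in> Filt r \<rightarrow>\<^sub>M borel \<Otimes>\<^sub>M borel \<Otimes>\<^sub>M borel" if "q < r" "i \<in> A q" for q i
      using that A by (intro Filt_mono[OF _ triangle_measurable_Filt[of i q]]) auto
    thus ?thesis unfolding Z_def
      by (intro borel_measurable_prod) (auto intro!: borel_measurable_exp borel_measurable_times measurable_compose[OF _ g]
          measurable_compose[OF _ borel_measurable_of_real])
  qed
  have Zb: "norm (Z \<omega>) \<le> 1" for \<omega>
    unfolding Z_def by (intro norm_prod_le_one) auto
  have [measurable]: "Z \<in> borel_measurable M" using Z by (rule measurable_from_Filt)
  have [measurable]: "W \<in> borel_measurable M"
    unfolding W_def using A generation_pos
    by (intro borel_measurable_prod measurable_compose[OF X_measurable cf_measurable]) (auto simp: subset_iff)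
  have Wb: "norm (W \<omega>) \<le> 1" for \<omega> unfolding W_def by (intro norm_prod_le_one norm_cf_le)
  have iZ: "integrable M Z" by (rule integrable_const_bound[where B=1]) (auto simp: Zb)
  have iZW: "integrable M (\<lambda>\<omega>. Z \<omega> * W \<omega>)"
    by (rule integrable_const_bound[where B=1]) (auto simp: norm_mult intro!: mult_le_one Zb Wb)
  have iN: "integrable M (\<lambda>\<omega>. norm (W \<omega> - c r))"
  proof (rule integrable_const_bound[where B=2])
    have "norm (W \<omega> - c r) \<le> 2" for \<omega>
      using norm_triangle_ineq4[of "W \<omega>" "c r"] Wb[of \<omega>] c[of r] by linarith
    thus "AE \<omega> in M. norm (norm (W \<omega> - c r)) \<le> 2" by auto
  qed measurable
  have "(\<integral>\<omega>. (\<Prod>q<Suc r. \<Prod>i\<in>A q. iexp (u * g (triangle X i \<omega>))) \<partial>M) = (\<integral>\<omega>. Z \<omega> * W \<omega> \<partial>M)"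
    using expectation_iexp_generation[OF g A Z Zb] by (simp add: Z_def W_def)
  also have "\<dots> - (\<Prod>q<Suc r. c q)
      = (\<integral>\<omega>. Z \<omega> * (W \<omega> - c r) \<partial>M) + ((\<integral>\<omega>. Z \<omega> \<partial>M) - (\<Prod>q<r. c q)) * c r"
    using iZ iZW by (simp add: algebra_simps)
  also have "norm \<dots> \<le> norm (\<integral>\<omega>. Z \<omega> * (W \<omega> - c r) \<partial>M) + norm ((\<integral>\<omega>. Z \<omega> \<partial>M) - (\<Prod>q<r. c q)) * norm (c r)"
    unfolding norm_mult[symmetric] by (rule norm_triangle_ineq)
  also have "norm (\<integral>\<omega>. Z \<omega> * (W \<omega> - c r) \<partial>M) \<le> (\<integral>\<omega>. norm (Z \<omega> * (W \<omega> - c r)) \<partial>M)"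
    by (rule integral_norm_bound)
  also have "\<dots> \<le> (\<integral>\<omega>. norm (W \<omega> - c r) \<partial>M)"
  proof (rule integral_mono[OF _ iN])
    show "integrable M (\<lambda>\<omega>. norm (Z \<omega> * (W \<omega> - c r)))"
      using iZ iZW by (intro integrable_norm) (simp add: algebra_simps)
    show "norm (Z \<omega> * (W \<omega> - c r)) \<le> norm (W \<omega> - c r)" for \<omega>
      unfolding norm_mult using Zb by (intro mult_left_le_one_le) auto
  qed
  also have "norm ((\<integral>\<omega>. Z \<omega> \<partial>M) - (\<Prod>q<r. c q)) * norm (c r) \<le> norm ((\<integral>\<omega>. Z \<omega> \<partial>M) - (\<Prod>q<r. c q))"
    using c by (intro mult_right_le_one_le) auto
  also have "\<dots> \<le> (\<Sum>q<r. \<integral>\<omega>. norm ((\<Prod>i\<in>A q. cf g u (X i \<omega>)) - c q) \<partial>M)"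
    using Suc.IH by (simp add: Z_def)
  finally show ?case by (simp add: W_def add_ac)
qed

text \<open>Products of numbers of modulus at most one differ by at most the sum of the differences,
  which gives the first term. The second comes from \<open>exp (- a)\<close> being 1-Lipschitz on
  nonnegative \<open>a\<close>, applied to the summed exponent. Summing before taking the absolute
  value keeps the cancellation that the law of large numbers provides.\<close>

lemma norm_prod_cf_diff_le:
  fixes s2 :: real
  assumes [measurable]: "g \<in> borel_measurable (borel \<Otimes>\<^sub>M borel \<Otimes>\<^sub>M borel)"
    and mean: "\<And>x. (\<integral>t. g (x, t) \<partial>P x) = 0"
    and 4: "\<And>x. integrable (P x) (\<lambda>t. g (x, t) ^ 4)" and s2: "s2 \<ge> 0"
  defines "V \<equiv> \<lambda>x. \<integral>t. (g (x, t))\<^sup>2 \<partial>P x" and "W \<equiv> \<lambda>x. \<integral>t. g (x, t) ^ 4 \<partial>P x"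
  shows "norm ((\<Prod>i\<in>A. cf g u (x i)) - of_real (exp (- (u\<^sup>2 * (s2 * card A) / 2))))
     \<le> (\<bar>u\<bar> ^ 3 + u ^ 4) * (\<Sum>i\<in>A. V (x i) + W (x i)) + u\<^sup>2 / 2 * \<bar>\<Sum>i\<in>A. V (x i) - s2\<bar>"
proof (cases "finite A")
  case True
  have V0: "V x \<ge> 0" for x unfolding V_def by (auto intro: integral_nonneg_AE)
  let ?e = "\<lambda>i. exp (- (u\<^sup>2 * V (x i) / 2))"
  have "norm ((\<Prod>i\<in>A. cf g u (x i)) - (\<Prod>i\<in>A. of_real (?e i))) \<le> (\<Sum>i\<in>A. norm (cf g u (x i) - of_real (?e i)))"
    by (rule norm_prod_diff) (auto simp: norm_cf_le V0)
  also have "\<dots> \<le> (\<Sum>i\<in>A. (\<bar>u\<bar> ^ 3 + u ^ 4) * (V (x i) + W (x i)))"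
  proof (rule sum_mono)
    fix i assume "i \<in> A"
    interpret P: prob_space "P (x i)" by (rule prob_space_P)
    have "(\<lambda>t. g (x i, t)) \<in> borel_measurable (P (x i))"
      by (subst measurable_cong_sets[OF sets_P refl]) measurable
    from P.iexp_expectation_bound[OF this 4 mean, of u]
    show "norm (cf g u (x i) - of_real (?e i)) \<le> (\<bar>u\<bar> ^ 3 + u ^ 4) * (V (x i) + W (x i))"
      by (simp add: cf_def V_def W_def)
  qed
  finally have 1: "norm ((\<Prod>i\<in>A. cf g u (x i)) - (\<Prod>i\<in>A. of_real (?e i))) \<le> (\<bar>u\<bar> ^ 3 + u ^ 4) * (\<Sum>i\<in>A. V (x i) + W (x i))"
    by (simp add: sum_distrib_left)
  have "(\<Prod>i\<in>A. ?e i) = exp (- (u\<^sup>2 / 2 * (\<Sum>i\<in>A. V (x i))))"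
    using True by (simp add: exp_sum[symmetric] sum_negf sum_distrib_left)
  hence "\<bar>(\<Prod>i\<in>A. ?e i) - exp (- (u\<^sup>2 * (s2 * card A) / 2))\<bar> \<le> \<bar>u\<^sup>2 / 2 * (\<Sum>i\<in>A. V (x i)) - u\<^sup>2 * (s2 * card A) / 2\<bar>"
    using V0 s2 by (simp only:) (intro exp_minus_diff_le, auto intro!: mult_nonneg_nonneg sum_nonneg)
  also have "u\<^sup>2 / 2 * (\<Sum>i\<in>A. V (x i)) - u\<^sup>2 * (s2 * card A) / 2 = u\<^sup>2 / 2 * (\<Sum>i\<in>A. V (x i) - s2)"
    by (simp add: sum_subtractf algebra_simps)
  finally have "\<bar>(\<Prod>i\<in>A. ?e i) - exp (- (u\<^sup>2 * (s2 * card A) / 2))\<bar> \<le> u\<^sup>2 / 2 * \<bar>\<Sum>i\<in>A. V (x i) - s2\<bar>"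
    by (simp add: abs_mult)
  hence 2: "norm ((\<Prod>i\<in>A. of_real (?e i)) - of_real (exp (- (u\<^sup>2 * (s2 * card A) / 2))) :: complex) \<le> u\<^sup>2 / 2 * \<bar>\<Sum>i\<in>A. V (x i) - s2\<bar>"
    unfolding of_real_prod[symmetric] of_real_diff[symmetric] norm_of_real .
  show ?thesis using norm_triangle_mono[OF 1 2] by simp
\<comment> \<open>For infinite \<open>A\<close> the product is \<open>1\<close>, the cardinality is
  \<open>0\<close> and the sums vanish, so both sides are \<open>0\<close>.\<close>
qed simp

end

section \<open>Law of large numbers\<close>

lemma nn_integral_mean_kernel:
  assumes P: "tree_kernel P" and f: "f \<in> borel_measurable borel"
  shows "(\<integral>\<^sup>+y. f y \<partial>mean_kernel P x) = ((\<integral>\<^sup>+t. f (fst t) \<partial>P x) + (\<integral>\<^sup>+t. f (snd t) \<partial>P x)) / 2"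
proof -
  have sP [measurable_cong]: "sets (P x) = sets (borel \<Otimes>\<^sub>M borel)"
    using measurable_space[OF P[unfolded tree_kernel_def], of x] by (simp add: space_prob_algebra)
  show ?thesis
    using f
  proof induction
    case (cong f g)
    thus ?case by simp
  next
    case (set A)
    have "A \<times> UNIV \<in> sets (P x)" "UNIV \<times> A \<in> sets (P x)" using set by (auto simp: sP)
    moreover have "(indicator A (fst t) :: ennreal) = indicator (A \<times> UNIV) t" "(indicator A (snd t) :: ennreal) = indicator (UNIV \<times> A) t"
      for t by (cases t, auto simp: indicator_def)+
    ultimately show ?case using set by (simp add: emeasure_mean_kernel[OF P])
  next
    case (mult u c)
    note [measurable] = mult(1)
    show ?case using mult
      by (simp add: nn_integral_cmult ennreal_times_divide distrib_left)
  next
    case (add u v)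
    note [measurable] = add(1,4)
    show ?case using add
      by (simp add: nn_integral_add add_divide_distrib_ennreal add_ac)
  next
    case (seq U)
    note [measurable] = seq(1)
    have i: "incseq U" by fact
    have i1: "incseq (\<lambda>i t. U i (fst t))" and i2: "incseq (\<lambda>i t. U i (snd t))"
      using i by (auto simp: incseq_def le_fun_def)
    have m1: "incseq (\<lambda>i. \<integral>\<^sup>+t. U i (fst t) \<partial>P x)" and m2: "incseq (\<lambda>i. \<integral>\<^sup>+t. U i (snd t) \<partial>P x)"
      using i by (auto simp: incseq_def le_fun_def intro!: nn_integral_mono)
    have "(\<integral>\<^sup>+y. (SUP i. U i) y \<partial>mean_kernel P x) = (SUP i. \<integral>\<^sup>+y. U i y \<partial>mean_kernel P x)"
      unfolding SUP_apply by (rule nn_integral_monotone_convergence_SUP[OF i]) simp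
    also have "\<dots> = (SUP i. (\<integral>\<^sup>+t. U i (fst t) \<partial>P x) + (\<integral>\<^sup>+t. U i (snd t) \<partial>P x)) / 2"
      using seq by (simp add: divide_ennreal_def SUP_mult_right_ennreal)
    also have "(SUP i. (\<integral>\<^sup>+t. U i (fst t) \<partial>P x) + (\<integral>\<^sup>+t. U i (snd t) \<partial>P x))
        = (SUP i. \<integral>\<^sup>+t. U i (fst t) \<partial>P x) + (SUP i. \<integral>\<^sup>+t. U i (snd t) \<partial>P x)"
      by (rule ennreal_SUP_add[OF m1 m2])
    also have "(SUP i. \<integral>\<^sup>+t. U i (fst t) \<partial>P x) = (\<integral>\<^sup>+t. (SUP i. U i) (fst t) \<partial>P x)"
      unfolding SUP_apply by (rule nn_integral_monotone_convergence_SUP[OF i1, symmetric]) measurable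
    also have "(SUP i. \<integral>\<^sup>+t. U i (snd t) \<partial>P x) = (\<integral>\<^sup>+t. (SUP i. U i) (snd t) \<partial>P x)"
      unfolding SUP_apply by (rule nn_integral_monotone_convergence_SUP[OF i2, symmetric]) measurable
    finally show ?case .
  qed
qed

lemma abs_mult_le_squares: "\<bar>a * b\<bar> \<le> a\<^sup>2 + b\<^sup>2" for a b :: real
proof -
  have "2 * (\<bar>a\<bar> * \<bar>b\<bar>) \<le> a\<^sup>2 + b\<^sup>2"
    using sum_squares_bound[of "\<bar>a\<bar>" "\<bar>b\<bar>"] by simp
  moreover have "0 \<le> \<bar>a\<bar> * \<bar>b\<bar>" by simp
  ultimately show ?thesis unfolding abs_mult by linarith
qed

lemma integrable_product_squares:
  fixes Z W :: "'a \<Rightarrow> real"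
  assumes "Z \<in> borel_measurable M" "W \<in> borel_measurable M"
    "integrable M (\<lambda>\<omega>. (Z \<omega>)\<^sup>2)" "integrable M (\<lambda>\<omega>. (W \<omega>)\<^sup>2)"
  shows "integrable M (\<lambda>\<omega>. Z \<omega> * W \<omega>)"
proof (rule Bochner_Integration.integrable_bound)
  show "integrable M (\<lambda>\<omega>. (Z \<omega>)\<^sup>2 + (W \<omega>)\<^sup>2)" using assms by auto
  show "(\<lambda>\<omega>. Z \<omega> * W \<omega>) \<in> borel_measurable M" using assms by auto
  show "AE \<omega> in M. norm (Z \<omega> * W \<omega>) \<le> norm ((Z \<omega>)\<^sup>2 + (W \<omega>)\<^sup>2)"
    by (simp add: abs_mult_le_squares)
qed

section \<open>The averaged operator on the admissible space\<close>

locale admissible_chain =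
  bifurcating_markov_chain M Filt X \<nu> P + admissible_space P \<nu> F \<mu>
  for M :: "'a measure" and Filt and X :: "nat \<Rightarrow> 'a \<Rightarrow> 's::metric_space" and \<nu> P F \<mu>
begin

lemma F_borel: "f \<in> F \<Longrightarrow> f \<in> borel_measurable borel"
  using F_measurable by auto

lemma F_diff: "f \<in> F \<Longrightarrow> g \<in> F \<Longrightarrow> (\<lambda>x. f x - g x) \<in> F"
  using add[of f "\<lambda>x. (-1) * g x"] scale[of g "-1"] by simp

definition Q :: "('s \<Rightarrow> real) \<Rightarrow> 's \<Rightarrow> real" where
  "Q f x = (\<integral>y. f y \<partial>mean_kernel P x)"

lemma F_marginals:
  assumes f: "f \<in> F"
  shows "integrable (P x) (\<lambda>t. f (fst t))" "integrable (P x) (\<lambda>t. f (snd t))"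
    and "(\<lambda>x. \<integral>t. f (fst t) \<partial>P x) \<in> F" "(\<lambda>x. \<integral>t. f (snd t) \<partial>P x) \<in> F"
  using tensor_integrable[OF f const[of 1], of x] tensor_integrable[OF const[of 1] f, of x]
    tensor[OF f const[of 1]] tensor[OF const[of 1] f]
  by (simp_all add: case_prod_unfold pair_op_def[abs_def])

lemma Q_marginals:
  assumes f: "f \<in> F"
  shows "integrable (mean_kernel P x) f"
    and "Q f x = ((\<integral>t. f (fst t) \<partial>P x) + (\<integral>t. f (snd t) \<partial>P x)) / 2"
proof -
  note [measurable] = F_borel[OF f]
  have nn: "(\<integral>\<^sup>+y. ennreal (u y) \<partial>mean_kernel P x) = ennreal (((\<integral>t. u (fst t) \<partial>P x) + (\<integral>t. u (snd t) \<partial>P x)) / 2)"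
    if "u \<in> borel_measurable borel" "integrable (P x) (\<lambda>t. u (fst t))" "integrable (P x) (\<lambda>t. u (snd t))" "\<And>y. u y \<ge> 0"
    for u :: "'s \<Rightarrow> real"
  proof -
    have "(\<integral>\<^sup>+y. ennreal (u y) \<partial>mean_kernel P x)
        = (ennreal (\<integral>t. u (fst t) \<partial>P x) + ennreal (\<integral>t. u (snd t) \<partial>P x)) / 2"
      using that by (subst nn_integral_mean_kernel[OF tree_kernel]) (auto simp: nn_integral_eq_integral)
    thus ?thesis using that
      by (simp add: ennreal_plus[symmetric] divide_ennreal[symmetric] del: ennreal_plus)
  qed
  have int: "integrable (mean_kernel P x) u"
    and eq: "(\<integral>y. u y \<partial>mean_kernel P x) = ((\<integral>t. u (fst t) \<partial>P x) + (\<integral>t. u (snd t) \<partial>P x)) / 2"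
    if "u \<in> borel_measurable borel" "integrable (P x) (\<lambda>t. u (fst t))" "integrable (P x) (\<lambda>t. u (snd t))" "\<And>y. u y \<ge> 0"
    for u :: "'s \<Rightarrow> real"
  proof -
    show "integrable (mean_kernel P x) u"
      using that nn[OF that] by (intro integrableI_nonneg) auto
    show "(\<integral>y. u y \<partial>mean_kernel P x) = ((\<integral>t. u (fst t) \<partial>P x) + (\<integral>t. u (snd t) \<partial>P x)) / 2"
      using that nn[OF that] by (intro integral_eq_nn_integral[THEN trans]) (auto intro!: integral_nonneg_AE)
  qed
  have p: "(\<lambda>y. max (f y) 0) \<in> borel_measurable borel" "(\<lambda>y. max (- f y) 0) \<in> borel_measurable borel" by measurable
  have i: "integrable (P x) (\<lambda>t. max (f (fst t)) 0)" "integrable (P x) (\<lambda>t. max (f (snd t)) 0)"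
    "integrable (P x) (\<lambda>t. max (- f (fst t)) 0)" "integrable (P x) (\<lambda>t. max (- f (snd t)) 0)"
    using F_marginals(1,2)[OF f, of x] by auto
  \<comment> \<open>Positive and negative parts may leave \<open>F\<close>, but at this point only
    their integrability under both marginals of \<open>P x\<close> is used, and that they
    inherit.\<close>
  have d: "f y = max (f y) 0 - max (- f y) 0" for y by (auto simp: max_def)
  have I: "integrable (mean_kernel P x) (\<lambda>y. max (f y) 0)" "integrable (mean_kernel P x) (\<lambda>y. max (- f y) 0)"
    using int[OF p(1)] int[OF p(2)] i by auto
  have "integrable (mean_kernel P x) (\<lambda>y. max (f y) 0 - max (- f y) 0)" using I by (rule Bochner_Integration.integrable_diff)
  thus "integrable (mean_kernel P x) f" by (simp flip: d)
  have "Q f x = (\<integral>y. max (f y) 0 - max (- f y) 0 \<partial>mean_kernel P x)" unfolding Q_def by (simp flip: d)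
  also have "\<dots> = ((\<integral>t. max (f (fst t)) 0 \<partial>P x) + (\<integral>t. max (f (snd t)) 0 \<partial>P x)) / 2
      - ((\<integral>t. max (- f (fst t)) 0 \<partial>P x) + (\<integral>t. max (- f (snd t)) 0 \<partial>P x)) / 2"
    by (simp add: I eq[OF p(1) i(1,2)] eq[OF p(2) i(3,4)])
  also have "\<dots> = ((\<integral>t. max (f (fst t)) 0 - max (- f (fst t)) 0 \<partial>P x) + (\<integral>t. max (f (snd t)) 0 - max (- f (snd t)) 0 \<partial>P x)) / 2"
    using i by (simp add: diff_divide_distrib add_divide_distrib)
  finally show "Q f x = ((\<integral>t. f (fst t) \<partial>P x) + (\<integral>t. f (snd t) \<partial>P x)) / 2" by (simp flip: d)
qed

lemma Q_F: "f \<in> F \<Longrightarrow> Q f \<in> F"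
proof -
  assume f: "f \<in> F"
  have "Q f = (\<lambda>x. (1/2) * ((\<integral>t. f (fst t) \<partial>P x) + (\<integral>t. f (snd t) \<partial>P x)))"
    by (auto simp: Q_marginals(2)[OF f])
  also have "\<dots> \<in> F" by (intro scale add F_marginals f)
  finally show ?thesis .
qed

lemma Qpow_F: "f \<in> F \<Longrightarrow> (Q ^^ r) f \<in> F"
  by (induction r) (auto intro: Q_F)

lemma Q_nonneg: "(\<And>y. f y \<ge> 0) \<Longrightarrow> Q f x \<ge> 0"
  unfolding Q_def by (auto intro: integral_nonneg_AE)

lemma Qpow_nonneg: "(\<And>y. f y \<ge> 0) \<Longrightarrow> (Q ^^ r) f x \<ge> 0"
  by (induction r arbitrary: x) (auto intro: Q_nonneg)

lemma Qpow_linear: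
  assumes f: "f \<in> F" and g: "g \<in> F"
  shows "(Q ^^ r) (\<lambda>x. a * f x + b * g x) = (\<lambda>x. a * (Q ^^ r) f x + b * (Q ^^ r) g x)"
proof (induction r)
  case (Suc r)
  have "Q (\<lambda>x. a * (Q ^^ r) f x + b * (Q ^^ r) g x) x = a * Q ((Q ^^ r) f) x + b * Q ((Q ^^ r) g) x" for x
    using Q_marginals(1)[OF Qpow_F[OF f]] Q_marginals(1)[OF Qpow_F[OF g]]
    by (simp add: Q_def[of "\<lambda>x. a * (Q ^^ r) f x + b * (Q ^^ r) g x"] Q_def[of "(Q ^^ r) f"] Q_def[of "(Q ^^ r) g"])
  thus ?case using Suc by auto
qed simp

lemma kernel_pow_measurable: "kernel_pow (mean_kernel P) r \<in> borel \<rightarrow>\<^sub>M prob_algebra borel"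
proof (induction r)
  case 0
  thus ?case by (simp add: kernel_pow.simps(1)[abs_def] measurable_return_prob_space)
next
  case (Suc r)
  thus ?case
    using measurable_bind_prob_space[OF measurable_mean_kernel[OF tree_kernel] Suc]
    by (simp add: kernel_pow.simps(2)[abs_def])
qed

text \<open>For a nonnegative function the integral passes through \<open>bind\<close> without prior
  integrability. The result is finite because each \<open>(Q ^^ r) u\<close> stays in
  \<open>F\<close> and is therefore integrable under the mean kernel.\<close>

lemma mean_pow_op_nonneg:
  assumes u: "u \<in> F" and u0: "\<And>y. u y \<ge> 0"
  shows "(\<integral>\<^sup>+y. ennreal (u y) \<partial>kernel_pow (mean_kernel P) r x) = ennreal ((Q ^^ r) u x)"
proof (induction r arbitrary: x)
  case 0
  show ?case using F_borel[OF u] by (simp add: nn_integral_return)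
next
  case (Suc r)
  have "(\<integral>\<^sup>+y. ennreal (u y) \<partial>kernel_pow (mean_kernel P) (Suc r) x)
      = (\<integral>\<^sup>+z. \<integral>\<^sup>+y. ennreal (u y) \<partial>kernel_pow (mean_kernel P) r z \<partial>mean_kernel P x)"
    unfolding kernel_pow.simps
    by (rule nn_integral_bind[where B = borel])
       (use F_borel[OF u] measurable_prob_algebraD[OF kernel_pow_measurable]
         in \<open>auto simp: measurable_cong_sets[OF sets_mean_kernel refl]\<close>)
  also have "\<dots> = (\<integral>\<^sup>+z. ennreal ((Q ^^ r) u z) \<partial>mean_kernel P x)" by (simp add: Suc)
  also have "\<dots> = ennreal (Q ((Q ^^ r) u) x)"
    unfolding Q_def[of "(Q ^^ r) u"]
    by (intro nn_integral_eq_integral Q_marginals Qpow_F u) (auto intro: Qpow_nonneg u0)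
  finally show ?case by simp
qed

lemma mean_pow_op_eq:
  assumes f: "f \<in> F"
  shows "mean_pow_op P r f x = (Q ^^ r) f x"
proof -
  let ?K = "kernel_pow (mean_kernel P) r x"
  have sK: "sets ?K = sets borel"
    using measurable_space[OF kernel_pow_measurable, of x r] by (simp add: space_prob_algebra)
  have *: "integrable ?K u" "(\<integral>y. u y \<partial>?K) = (Q ^^ r) u x" if "u \<in> F" "\<And>y. u y \<ge> 0" for u
  proof -
    have [measurable]: "u \<in> borel_measurable ?K"
      using F_borel[OF that(1)] by (simp add: measurable_cong_sets[OF sK refl])
    show "integrable ?K u" using that mean_pow_op_nonneg[OF that] by (intro integrableI_nonneg) auto
    show "(\<integral>y. u y \<partial>?K) = (Q ^^ r) u x"
      using that mean_pow_op_nonneg[OF that] by (subst integral_eq_nn_integral) (auto simp: Qpow_nonneg)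
  qed
  \<comment> \<open>\<open>f\<close> is a combination of nonnegative elements of \<open>F\<close>, whereas its positive part may lie outside \<open>F\<close>\<close>
  define u where "u = (\<lambda>y. (f y + 1)\<^sup>2)"
  define v where "v = (\<lambda>y. (f y)\<^sup>2 + 1)"
  have u: "u \<in> F" "\<And>y. u y \<ge> 0" and v: "v \<in> F" "\<And>y. v y \<ge> 0"
    unfolding u_def v_def by (auto intro!: square add f const)
  have d: "f = (\<lambda>y. (1/2) * u y + (-1/2) * v y)"
    by (auto simp: u_def v_def power2_eq_square algebra_simps)
  have "mean_pow_op P r f x = (1/2) * (\<integral>y. u y \<partial>?K) + (-1/2) * (\<integral>y. v y \<partial>?K)"
    unfolding mean_pow_op_def by (subst d) (use *(1)[OF u] *(1)[OF v] in simp)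
  also have "\<dots> = (Q ^^ r) (\<lambda>y. (1/2) * u y + (-1/2) * v y) x"
    unfolding Qpow_linear[OF u(1) v(1)] by (simp add: *(2)[OF u] *(2)[OF v])
  finally show ?thesis unfolding d[symmetric] .
qed

lemma Qpow_tendsto: "f \<in> F \<Longrightarrow> (\<lambda>r. (Q ^^ r) f x) \<longlonglongrightarrow> (\<integral>y. f y \<partial>\<mu>)"
  using ergodic[of f x] by (simp add: mean_pow_op_eq)

lemma Qpow_dominated:
  assumes "f \<in> F"
  obtains g where "g \<in> F" "\<And>r x. \<bar>(Q ^^ r) f x\<bar> \<le> g x"
  using dominated[OF assms] by (auto simp: mean_pow_op_eq[OF assms])

section \<open>Moments of sums over a generation\<close>

definition gsum :: "nat \<Rightarrow> ('s \<Rightarrow> real) \<Rightarrow> 'a \<Rightarrow> real" where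
  "gsum q f \<omega> = (\<Sum>i\<in>generation q. f (X i \<omega>))"

lemma F_X_measurable: "f \<in> F \<Longrightarrow> i \<ge> 1 \<Longrightarrow> (\<lambda>\<omega>. f (X i \<omega>)) \<in> borel_measurable M"
  by (intro measurable_compose[OF X_measurable F_borel])

lemma F_X_measurable_gen: "f \<in> F \<Longrightarrow> i \<in> generation q \<Longrightarrow> (\<lambda>\<omega>. f (X i \<omega>)) \<in> borel_measurable M"
  using generation_pos by (intro F_X_measurable) auto

lemma nn_integral_children:
  fixes u :: "'s \<Rightarrow> real"
  assumes u: "u \<in> F" "\<And>y. u y \<ge> 0" and i: "i \<in> generation q"
  shows "(\<integral>\<^sup>+\<omega>. ennreal (u (X (2 * i) \<omega>) + u (X (2 * i + 1) \<omega>)) \<partial>M) = (\<integral>\<^sup>+\<omega>. ennreal (2 * Q u (X i \<omega>)) \<partial>M)"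
proof -
  note [measurable] = F_borel[OF u(1)]
  have "(\<integral>\<^sup>+\<omega>. ennreal (u (X (2 * i) \<omega>) + u (X (2 * i + 1) \<omega>)) \<partial>M)
      = (\<integral>\<^sup>+\<omega>. \<integral>\<^sup>+t. ennreal (u (fst t) + u (snd t)) \<partial>P (X i \<omega>) \<partial>M)"
    using nn_integral_daughters[OF i, of "{}" "\<lambda>z. ennreal (u (fst (snd z)) + u (snd (snd z)))"]
    by (simp add: daughters_def)
  also have "\<dots> = (\<integral>\<^sup>+\<omega>. ennreal (2 * Q u (X i \<omega>)) \<partial>M)"
    using F_marginals[OF u(1)] u(2)
    by (intro nn_integral_cong, subst nn_integral_eq_integral) (auto simp: Q_marginals(2)[OF u(1)] simp del: ennreal_plus)
  finally show ?thesis .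
qed

text \<open>This is the many-to-one formula: a uniformly chosen line of descent is a Markov chain
  with kernel \<open>Q\<close> started from \<open>\<nu>\<close>. It is proved first for nonnegative
  functions, because integrability along the tree is deduced from it.\<close>

lemma nn_integral_gsum:
  assumes "u \<in> F" "\<And>y. u y \<ge> 0"
  shows "(\<integral>\<^sup>+\<omega>. ennreal (gsum q u \<omega>) \<partial>M) = ennreal (2 ^ q * (\<integral>y. (Q ^^ q) u y \<partial>\<nu>))"
  using assms
proof (induction q arbitrary: u)
  case 0
  have g0: "generation 0 = {1}" by (auto simp: generation_def)
  have "(\<integral>\<^sup>+\<omega>. ennreal (u (X 1 \<omega>)) \<partial>M) = (\<integral>\<^sup>+y. ennreal (u y) \<partial>\<nu>)"
    unfolding initial_law[symmetric] using F_borel[OF 0(1)] by (subst nn_integral_distr) (auto intro: X_measurable)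
  also have "\<dots> = ennreal (\<integral>y. u y \<partial>\<nu>)"
    using initial_integrable[OF 0(1)] 0(2) by (intro nn_integral_eq_integral) auto
  finally show ?case by (simp add: gsum_def g0)
next
  case (Suc q)
  have "(\<integral>\<^sup>+\<omega>. ennreal (gsum (Suc q) u \<omega>) \<partial>M)
      = (\<Sum>i\<in>generation q. \<integral>\<^sup>+\<omega>. ennreal (u (X (2 * i) \<omega>) + u (X (2 * i + 1) \<omega>)) \<partial>M)"
    unfolding gsum_def sum_generation_Suc using Suc.prems generation_pos
    by (subst nn_integral_sum[symmetric])
       (auto simp: sum_ennreal simp del: ennreal_plus intro!: measurable_compose[OF _ measurable_ennreal] borel_measurable_add F_X_measurable)
  also have "\<dots> = (\<Sum>i\<in>generation q. \<integral>\<^sup>+\<omega>. ennreal (2 * Q u (X i \<omega>)) \<partial>M)"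
    by (intro sum.cong refl nn_integral_children Suc.prems)
  also have "\<dots> = (\<integral>\<^sup>+\<omega>. ennreal (gsum q (\<lambda>x. 2 * Q u x) \<omega>) \<partial>M)"
    unfolding gsum_def using Suc.prems generation_pos
    by (subst nn_integral_sum[symmetric])
       (auto simp: sum_ennreal Q_nonneg intro!: measurable_compose[OF _ measurable_ennreal] F_X_measurable scale Q_F)
  also have "\<dots> = ennreal (2 ^ q * (\<integral>y. (Q ^^ q) (\<lambda>x. 2 * Q u x) y \<partial>\<nu>))"
    using Suc.prems by (intro Suc.IH scale Q_F) (auto intro: Q_nonneg)
  also have "(Q ^^ q) (\<lambda>x. 2 * Q u x) = (\<lambda>x. 2 * (Q ^^ Suc q) u x)"
    using Qpow_linear[OF Q_F Q_F, OF Suc.prems(1) Suc.prems(1), of q 2 0] by (simp add: funpow_swap1)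
  finally show ?case by (simp add: mult_ac)
qed

lemma gsum_nonneg: "(\<And>y. u y \<ge> 0) \<Longrightarrow> gsum q u \<omega> \<ge> 0"
  unfolding gsum_def by (intro sum_nonneg) auto

lemma gsum_measurable: "f \<in> F \<Longrightarrow> gsum q f \<in> borel_measurable M"
  unfolding gsum_def by (intro borel_measurable_sum F_X_measurable_gen)

text \<open>The formula for generation sums needs a nonnegative member of \<open>F\<close>;
  \<open>1 + f^2\<close> is one, and it dominates \<open>\<bar>f\<bar>\<close>. A single vertex is
  then dominated by its whole generation.\<close>

lemma integrable_F_X:
  assumes f: "f \<in> F" and i: "i \<ge> 1"
  shows "integrable M (\<lambda>\<omega>. f (X i \<omega>))"
proof -
  define q where "q = floor_log i"
  have ig: "i \<in> generation q" using i by (simp add: mem_generation_iff q_def)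
  let ?u = "\<lambda>x. 1 + (f x)\<^sup>2"
  have u: "?u \<in> F" by (intro add const square f)
  have "integrable M (gsum q ?u)"
    using nn_integral_gsum[OF u, of q] gsum_nonneg[of ?u] gsum_measurable[OF u]
    by (intro integrableI_nonneg) auto
  thus ?thesis
  proof (rule Bochner_Integration.integrable_bound)
    show "(\<lambda>\<omega>. f (X i \<omega>)) \<in> borel_measurable M" by (intro F_X_measurable f i)
    have "\<bar>f (X i \<omega>)\<bar> \<le> gsum q ?u \<omega>" for \<omega>
    proof -
      have "0 \<le> (\<bar>f (X i \<omega>)\<bar> - 1)\<^sup>2 + \<bar>f (X i \<omega>)\<bar>" by simp
      hence "\<bar>f (X i \<omega>)\<bar> \<le> ?u (X i \<omega>)" by (simp add: power2_eq_square algebra_simps)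
      also have "\<dots> \<le> gsum q ?u \<omega>"
        unfolding gsum_def using ig by (intro member_le_sum) auto
      finally show ?thesis .
    qed
    thus "AE \<omega> in M. norm (f (X i \<omega>)) \<le> norm (gsum q ?u \<omega>)"
      by (auto intro!: AE_I2 order_trans[OF _ abs_ge_self])
  qed
qed

lemma integrable_F_X_gen: "f \<in> F \<Longrightarrow> i \<in> generation q \<Longrightarrow> integrable M (\<lambda>\<omega>. f (X i \<omega>))"
  using generation_pos by (intro integrable_F_X) auto

lemma integrable_gsum: "f \<in> F \<Longrightarrow> integrable M (gsum q f)"
  unfolding gsum_def by (intro Bochner_Integration.integrable_sum integrable_F_X_gen)

lemma integrable_gsum_square:
  assumes f: "f \<in> F"
  shows "integrable M (\<lambda>\<omega>. (gsum q f \<omega>)\<^sup>2)"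
proof -
  have "integrable M (\<lambda>\<omega>. \<Sum>i\<in>generation q. \<Sum>j\<in>generation q. f (X i \<omega>) * f (X j \<omega>))"
  proof (intro Bochner_Integration.integrable_sum)
    fix i j assume ij: "i \<in> generation q" "j \<in> generation q"
    show "integrable M (\<lambda>\<omega>. f (X i \<omega>) * f (X j \<omega>))"
      using ij F_X_measurable_gen[OF f] integrable_F_X_gen[OF square[OF f]]
      by (intro integrable_product_squares) auto
  qed
  thus ?thesis by (simp add: gsum_def power2_eq_square sum_product)
qed

text \<open>A dominating function in \<open>F\<close> controls all iterates of \<open>Q\<close> at
  once, and its \<open>\<nu>\<close>-integral serves as \<open>K\<close>. Thus the mean grows no
  faster than the number of vertices.\<close>

lemma expectation_gsum_bound:
  assumes u: "u \<in> F" "\<And>y. u y \<ge> 0"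
  obtains K where "\<And>q. expectation (gsum q u) \<le> K * 2 ^ q" "K \<ge> 0"
proof -
  obtain g where g: "g \<in> F" "\<And>r x. \<bar>(Q ^^ r) u x\<bar> \<le> g x" using Qpow_dominated[OF u(1)] by blast
  have "expectation (gsum q u) \<le> (\<integral>y. g y \<partial>\<nu>) * 2 ^ q" for q
  proof -
    have "0 \<le> (\<integral>y. (Q ^^ q) u y \<partial>\<nu>)" by (auto intro!: integral_nonneg_AE Qpow_nonneg u)
    hence "expectation (gsum q u) = 2 ^ q * (\<integral>y. (Q ^^ q) u y \<partial>\<nu>)"
      using nn_integral_gsum[OF u, of q] gsum_nonneg[OF u(2)] gsum_measurable[OF u(1)]
      by (subst integral_eq_nn_integral) auto
    also have "(\<integral>y. (Q ^^ q) u y \<partial>\<nu>) \<le> (\<integral>y. g y \<partial>\<nu>)"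
      using g abs_le_D1[OF g(2)] by (intro integral_mono initial_integrable Qpow_F u) auto
    finally show ?thesis by (simp add: mult_ac)
  qed
  moreover have "(\<integral>y. g y \<partial>\<nu>) \<ge> 0"
    using order_trans[OF abs_ge_zero g(2)] by (auto intro!: integral_nonneg_AE)
  ultimately show ?thesis using that by blast
qed

text \<open>The values at the two daughters minus their conditional mean, since
  \<open>2 * Q h x\<close> is the sum of the two marginal integrals of \<open>h\<close>.\<close>

definition increment :: "('s \<Rightarrow> real) \<Rightarrow> nat \<Rightarrow> 'a \<Rightarrow> real" where
  "increment h i \<omega> = h (X (2 * i) \<omega>) + h (X (2 * i + 1) \<omega>) - 2 * Q h (X i \<omega>)"

lemma increment_integrable:
  assumes h: "h \<in> F" and i: "i \<in> generation q"
  shows "increment h i \<in> borel_measurable M" "integrable M (\<lambda>\<omega>. (increment h i \<omega>)\<^sup>2)"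
proof -
  have i1: "i \<ge> 1" using i generation_pos by auto
  have [measurable]: "(\<lambda>\<omega>. h (X (2 * i) \<omega>)) \<in> borel_measurable M" "(\<lambda>\<omega>. h (X (2 * i + 1) \<omega>)) \<in> borel_measurable M"
    "(\<lambda>\<omega>. Q h (X i \<omega>)) \<in> borel_measurable M"
    using i1 by (auto intro!: F_X_measurable Q_F h)
  show m: "increment h i \<in> borel_measurable M"
    unfolding increment_def by measurable
  show "integrable M (\<lambda>\<omega>. (increment h i \<omega>)\<^sup>2)"
  proof (rule Bochner_Integration.integrable_bound)
    show "integrable M (\<lambda>\<omega>. 3 * ((h (X (2 * i) \<omega>))\<^sup>2 + (h (X (2 * i + 1) \<omega>))\<^sup>2 + 4 * (Q h (X i \<omega>))\<^sup>2))"
      using i1 by (intro integrable_mult_right Bochner_Integration.integrable_add integrable_F_X[OF square] Q_F h) auto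
    have "(a + b - 2 * c)\<^sup>2 \<le> 3 * (a\<^sup>2 + b\<^sup>2 + 4 * c\<^sup>2)" for a b c :: real
    proof -
      have "3 * (a\<^sup>2 + b\<^sup>2 + 4 * c\<^sup>2) - (a + b - 2 * c)\<^sup>2 = (a - b)\<^sup>2 + (a + 2 * c)\<^sup>2 + (b + 2 * c)\<^sup>2" by algebra
      also have "\<dots> \<ge> 0" by simp
      finally show ?thesis by simp
    qed
    thus "AE \<omega> in M. norm ((increment h i \<omega>)\<^sup>2)
        \<le> norm (3 * ((h (X (2 * i) \<omega>))\<^sup>2 + (h (X (2 * i + 1) \<omega>))\<^sup>2 + 4 * (Q h (X i \<omega>))\<^sup>2))"
      by (simp add: increment_def)
    show "(\<lambda>\<omega>. (increment h i \<omega>)\<^sup>2) \<in> borel_measurable M" using m by measurable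
  qed
qed

text \<open>The increment at \<open>i\<close> has conditional mean zero given the past and the other
  pairs. With \<open>Z\<close> another increment of the same generation this gives orthogonality
  between vertices, and with \<open>I\<close> empty it gives orthogonality to the past.\<close>

lemma increment_orthogonal:
  assumes h: "h \<in> F" and i: "i \<in> generation q" "i \<notin> I" "I \<subseteq> generation q"
    and Z: "Z \<in> borel_measurable (Filt_daughters q I)" "integrable M (\<lambda>\<omega>. (Z \<omega>)\<^sup>2)"
  shows "integrable M (\<lambda>\<omega>. Z \<omega> * increment h i \<omega>)" "expectation (\<lambda>\<omega>. Z \<omega> * increment h i \<omega>) = 0"
proof -
  note [measurable] = F_borel[OF h] F_borel[OF Q_F[OF h]] Z(1)
  have [measurable]: "X i \<in> Filt_daughters q I \<rightarrow>\<^sub>M borel"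
    by (intro Filt_le_Filt_daughters X_measurable_Filt i)
  have ZM: "Z \<in> borel_measurable M"
    using Z(1) subalgebra_Filt_daughters[OF i(3)] by (rule measurable_from_subalg[rotated])
  show int: "integrable M (\<lambda>\<omega>. Z \<omega> * increment h i \<omega>)"
    using increment_integrable[OF h i(1)] ZM Z(2) by (intro integrable_product_squares)
  have "expectation (\<lambda>\<omega>. Z \<omega> * increment h i \<omega>)
      = (\<integral>\<omega>. \<integral>t. Z \<omega> * (h (fst t) + h (snd t) - 2 * Q h (X i \<omega>)) \<partial>P (X i \<omega>) \<partial>M)"
    using integral_daughters[OF i, of "\<lambda>(\<omega>, t). Z \<omega> * (h (fst t) + h (snd t) - 2 * Q h (X i \<omega>))"] int
    by (simp add: case_prod_unfold daughters_def increment_def)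
  also have "\<dots> = 0"
  proof -
    have "(\<integral>t. h (fst t) + h (snd t) - 2 * Q h x \<partial>P x) = 0" for x
    proof -
      interpret PX: prob_space "P x" by (rule prob_space_P)
      show ?thesis using F_marginals(1,2)[OF h, of x] PX.prob_space by (simp add: Q_marginals(2)[OF h])
    qed
    thus ?thesis by simp
  qed
  finally show "expectation (\<lambda>\<omega>. Z \<omega> * increment h i \<omega>) = 0" .
qed

lemma increment_measurable_Filt_daughters:
  assumes h: "h \<in> F" and i: "i \<in> generation q" "i \<in> I"
  shows "increment h i \<in> borel_measurable (Filt_daughters q I)"
proof -
  note [measurable] = F_borel[OF h] F_borel[OF Q_F[OF h]]
  have [measurable]: "X i \<in> Filt_daughters q I \<rightarrow>\<^sub>M borel"
    by (intro Filt_le_Filt_daughters X_measurable_Filt i)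
  have [measurable]: "daughters i \<in> Filt_daughters q I \<rightarrow>\<^sub>M borel \<Otimes>\<^sub>M borel"
    by (intro daughters_measurable_Filt_daughters i)
  have "increment h i = (\<lambda>\<omega>. h (fst (daughters i \<omega>)) + h (snd (daughters i \<omega>)) - 2 * Q h (X i \<omega>))"
    by (auto simp: increment_def daughters_def)
  also have "\<dots> \<in> borel_measurable (Filt_daughters q I)" by measurable
  finally show ?thesis .
qed

text \<open>The sum over the next generation is the sum of the increments plus
  \<open>2 * gsum q (Q h)\<close>. All mixed terms have mean zero, so only the diagonal squares and
  \<open>4\<close> times the square of the predictable part survive.\<close>

lemma gsum_square_Suc:
  assumes h: "h \<in> F"
  shows "expectation (\<lambda>\<omega>. (gsum (Suc q) h \<omega>)\<^sup>2)
    \<le> 4 * expectation (\<lambda>\<omega>. (gsum q (Q h) \<omega>)\<^sup>2) + 2 * expectation (gsum (Suc q) (\<lambda>x. (h x)\<^sup>2))"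
proof -
  let ?D = "increment h"
  let ?B = "gsum q (Q h)"
  note D = increment_integrable[OF h]
  have BF: "?B \<in> borel_measurable (Filt_daughters q {})"
    unfolding gsum_def by (intro borel_measurable_sum Filt_le_Filt_daughters measurable_compose[OF X_measurable_Filt F_borel] Q_F h)
  have BB: "integrable M (\<lambda>\<omega>. (?B \<omega>)\<^sup>2)" by (intro integrable_gsum_square Q_F h)
  have DD: "integrable M (\<lambda>\<omega>. ?D i \<omega> * ?D j \<omega>)" if "i \<in> generation q" "j \<in> generation q" for i j
    using D that by (intro integrable_product_squares) auto
  have DD0: "expectation (\<lambda>\<omega>. ?D j \<omega> * ?D i \<omega>) = 0" if "i \<in> generation q" "j \<in> generation q" "i \<noteq> j" for i j
    using that D by (intro increment_orthogonal(2)[OF h, where I = "{j}" and q = q] increment_measurable_Filt_daughters h) auto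
  have BD: "integrable M (\<lambda>\<omega>. ?B \<omega> * ?D i \<omega>)" "expectation (\<lambda>\<omega>. ?B \<omega> * ?D i \<omega>) = 0" if "i \<in> generation q" for i
    using increment_orthogonal[OF h that _ _ BF BB] by auto
  have Di: "expectation (\<lambda>\<omega>. (?D i \<omega>)\<^sup>2) \<le> 2 * expectation (\<lambda>\<omega>. (h (X (2 * i) \<omega>))\<^sup>2 + (h (X (2 * i + 1) \<omega>))\<^sup>2)"
    if i: "i \<in> generation q" for i
  proof -
    have i1: "i \<ge> 1" using i generation_pos by auto
    let ?Z = "\<lambda>\<omega>. Q h (X i \<omega>)"
    have Z: "?Z \<in> borel_measurable (Filt_daughters q {})" "integrable M (\<lambda>\<omega>. (?Z \<omega>)\<^sup>2)"
      using i1 i by (auto intro!: Filt_le_Filt_daughters measurable_compose[OF X_measurable_Filt F_borel] Q_F h integrable_F_X[OF square])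
    note O = increment_orthogonal[OF h i _ _ Z]
    have intH: "integrable M (\<lambda>\<omega>. (h (X (2 * i) \<omega>))\<^sup>2)" "integrable M (\<lambda>\<omega>. (h (X (2 * i + 1) \<omega>))\<^sup>2)"
      using i1 by (auto intro!: integrable_F_X[OF square] h)
    \<comment> \<open>A conditional variance is at most the conditional second moment: completing
      the square adds a cross term of mean zero and a nonnegative term.\<close>
    have "expectation (\<lambda>\<omega>. (?D i \<omega>)\<^sup>2) \<le> expectation (\<lambda>\<omega>. (?D i \<omega>)\<^sup>2 + 4 * (?Z \<omega> * ?D i \<omega>) + 4 * (?Z \<omega>)\<^sup>2)"
      using D[OF i] O Z integral_nonneg_AE[where M = M and f = "\<lambda>\<omega>. (?Z \<omega>)\<^sup>2"] by simp
    also have "\<dots> = expectation (\<lambda>\<omega>. (?D i \<omega> + 2 * ?Z \<omega>)\<^sup>2)"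
      by (intro Bochner_Integration.integral_cong refl) (simp add: power2_eq_square algebra_simps)
    also have "\<dots> \<le> expectation (\<lambda>\<omega>. 2 * ((h (X (2 * i) \<omega>))\<^sup>2 + (h (X (2 * i + 1) \<omega>))\<^sup>2))"
    proof (rule integral_mono')
      show "integrable M (\<lambda>\<omega>. 2 * ((h (X (2 * i) \<omega>))\<^sup>2 + (h (X (2 * i + 1) \<omega>))\<^sup>2))" using intH by auto
      have "(a + b)\<^sup>2 \<le> 2 * (a\<^sup>2 + b\<^sup>2)" for a b :: real
        using zero_le_power2[of "a - b"] by (simp add: power2_eq_square algebra_simps)
      thus "(?D i \<omega> + 2 * ?Z \<omega>)\<^sup>2 \<le> 2 * ((h (X (2 * i) \<omega>))\<^sup>2 + (h (X (2 * i + 1) \<omega>))\<^sup>2)" for \<omega>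
        by (simp add: increment_def)
    qed simp
    finally show ?thesis using intH by simp
  qed
  have dec: "gsum (Suc q) h \<omega> = (\<Sum>i\<in>generation q. ?D i \<omega>) + 2 * ?B \<omega>" for \<omega>
    by (simp add: gsum_def sum_generation_Suc increment_def sum.distrib sum_subtractf sum_distrib_left)
  have "(gsum (Suc q) h \<omega>)\<^sup>2 = (\<Sum>i\<in>generation q. \<Sum>j\<in>generation q. ?D j \<omega> * ?D i \<omega>) + (\<Sum>i\<in>generation q. 4 * (?B \<omega> * ?D i \<omega>)) + 4 * (?B \<omega>)\<^sup>2" for \<omega>
  proof -
    have "(\<Sum>i\<in>generation q. \<Sum>j\<in>generation q. ?D j \<omega> * ?D i \<omega>) = (\<Sum>i\<in>generation q. ?D i \<omega>)\<^sup>2"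
      by (simp add: power2_eq_square sum_product mult.commute)
    moreover have "(\<Sum>i\<in>generation q. 4 * (?B \<omega> * ?D i \<omega>)) = 4 * ?B \<omega> * (\<Sum>i\<in>generation q. ?D i \<omega>)"
      by (simp add: sum_distrib_left mult_ac)
    ultimately show ?thesis unfolding dec by (simp add: power2_eq_square algebra_simps)
  qed
  hence "expectation (\<lambda>\<omega>. (gsum (Suc q) h \<omega>)\<^sup>2)
      = expectation (\<lambda>\<omega>. (\<Sum>i\<in>generation q. \<Sum>j\<in>generation q. ?D j \<omega> * ?D i \<omega>) + (\<Sum>i\<in>generation q. 4 * (?B \<omega> * ?D i \<omega>)) + 4 * (?B \<omega>)\<^sup>2)"
    by simp
  also have "\<dots> = (\<Sum>i\<in>generation q. \<Sum>j\<in>generation q. expectation (\<lambda>\<omega>. ?D j \<omega> * ?D i \<omega>)) + 4 * expectation (\<lambda>\<omega>. (?B \<omega>)\<^sup>2)"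
    using DD BD BB by (simp add: Bochner_Integration.integral_sum Bochner_Integration.integrable_sum)
  also have "(\<Sum>i\<in>generation q. \<Sum>j\<in>generation q. expectation (\<lambda>\<omega>. ?D j \<omega> * ?D i \<omega>))
      = (\<Sum>i\<in>generation q. expectation (\<lambda>\<omega>. (?D i \<omega>)\<^sup>2))"
  proof (intro sum.cong refl)
    fix i assume i: "i \<in> generation q"
    have "(\<Sum>j\<in>generation q. expectation (\<lambda>\<omega>. ?D j \<omega> * ?D i \<omega>)) = (\<Sum>j\<in>{i}. expectation (\<lambda>\<omega>. ?D j \<omega> * ?D i \<omega>))"
      using i DD0 by (intro sum.mono_neutral_right) auto
    thus "(\<Sum>j\<in>generation q. expectation (\<lambda>\<omega>. ?D j \<omega> * ?D i \<omega>)) = expectation (\<lambda>\<omega>. (?D i \<omega>)\<^sup>2)"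
      by (simp add: power2_eq_square)
  qed
  also have "\<dots> \<le> (\<Sum>i\<in>generation q. 2 * expectation (\<lambda>\<omega>. (h (X (2 * i) \<omega>))\<^sup>2 + (h (X (2 * i + 1) \<omega>))\<^sup>2))"
    by (intro sum_mono Di)
  also have "\<dots> = 2 * expectation (\<lambda>\<omega>. \<Sum>i\<in>generation q. (h (X (2 * i) \<omega>))\<^sup>2 + (h (X (2 * i + 1) \<omega>))\<^sup>2)"
    unfolding sum_distrib_left[symmetric] using generation_pos
    by (subst Bochner_Integration.integral_sum) (auto intro!: Bochner_Integration.integrable_add integrable_F_X[OF square] h)
  also have "(\<lambda>\<omega>. \<Sum>i\<in>generation q. (h (X (2 * i) \<omega>))\<^sup>2 + (h (X (2 * i + 1) \<omega>))\<^sup>2) = gsum (Suc q) (\<lambda>x. (h x)\<^sup>2)"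
    by (auto simp: gsum_def sum_generation_Suc)
  finally show ?thesis by simp
qed

text \<open>Stepping back one generation replaces \<open>h\<close> by \<open>Q h\<close>, and the
  normalisation by \<open>4 ^ q\<close> absorbs the factor \<open>4\<close>. The summand with index
  \<open>p\<close> bounds the noise created between generations \<open>p\<close> and
  \<open>p + 1\<close>, propagated to generation \<open>q\<close> by the remaining iterates of
  \<open>Q\<close>.\<close>

lemma gsum_square_bound:
  assumes h: "h \<in> F"
  shows "expectation (\<lambda>\<omega>. (gsum q h \<omega>)\<^sup>2) / 4 ^ q
    \<le> expectation (\<lambda>\<omega>. ((Q ^^ q) h (X 1 \<omega>))\<^sup>2)
      + (\<Sum>p<q. expectation (gsum (Suc p) (\<lambda>x. ((Q ^^ (q - Suc p)) h x)\<^sup>2)) / 4 ^ p)"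
  using h
proof (induction q arbitrary: h)
  case 0
  have g0: "generation 0 = {1}" by (auto simp: generation_def)
  show ?case by (simp add: gsum_def g0)
next
  case (Suc q)
  have "expectation (\<lambda>\<omega>. (gsum (Suc q) h \<omega>)\<^sup>2) / 4 ^ Suc q
      \<le> (4 * expectation (\<lambda>\<omega>. (gsum q (Q h) \<omega>)\<^sup>2) + 2 * expectation (gsum (Suc q) (\<lambda>x. (h x)\<^sup>2))) / 4 ^ Suc q"
    by (intro divide_right_mono gsum_square_Suc Suc.prems) auto
  \<comment> \<open>The exact coefficient of the noise term is \<open>1/2\<close> here; it is
    enlarged to \<open>1\<close> to keep the recursion simple.\<close>
  also have "\<dots> \<le> expectation (\<lambda>\<omega>. (gsum q (Q h) \<omega>)\<^sup>2) / 4 ^ q + expectation (gsum (Suc q) (\<lambda>x. (h x)\<^sup>2)) / 4 ^ q"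
  proof -
    have "0 \<le> expectation (gsum (Suc q) (\<lambda>x. (h x)\<^sup>2)) / 4 ^ q"
      by (intro divide_nonneg_pos integral_nonneg_AE) (auto simp: gsum_nonneg)
    thus ?thesis by (simp add: add_divide_distrib)
  qed
  also have "expectation (\<lambda>\<omega>. (gsum q (Q h) \<omega>)\<^sup>2) / 4 ^ q \<le> expectation (\<lambda>\<omega>. ((Q ^^ q) (Q h) (X 1 \<omega>))\<^sup>2)
      + (\<Sum>p<q. expectation (gsum (Suc p) (\<lambda>x. ((Q ^^ (q - Suc p)) (Q h) x)\<^sup>2)) / 4 ^ p)"
    by (intro Suc.IH Q_F Suc.prems)
  also have "(\<Sum>p<q. expectation (gsum (Suc p) (\<lambda>x. ((Q ^^ (q - Suc p)) (Q h) x)\<^sup>2)) / 4 ^ p)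
      = (\<Sum>p<q. expectation (gsum (Suc p) (\<lambda>x. ((Q ^^ (Suc q - Suc p)) h x)\<^sup>2)) / 4 ^ p)"
  proof (intro sum.cong refl)
    fix p assume "p \<in> {..<q}"
    hence "Suc q - Suc p = Suc (q - Suc p)" by simp
    thus "expectation (gsum (Suc p) (\<lambda>x. ((Q ^^ (q - Suc p)) (Q h) x)\<^sup>2)) / 4 ^ p
        = expectation (gsum (Suc p) (\<lambda>x. ((Q ^^ (Suc q - Suc p)) h x)\<^sup>2)) / 4 ^ p"
      by (simp add: funpow_swap1)
  qed
  finally show ?case by (simp add: funpow_swap1 add_ac)
qed

text \<open>Noise from an early generation \<open>p\<close> dies out as \<open>q\<close> grows,
  because the iterates of \<open>Q\<close> on \<open>h\<close> tend to zero pointwise under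
  domination. Noise from late generations is small by averaging: it is at most of order
  \<open>2 ^ p / 4 ^ p\<close>. Tannery's theorem combines the two.\<close>

lemma gsum_square_tendsto_0:
  assumes h: "h \<in> F" and h0: "(\<integral>y. h y \<partial>\<mu>) = 0"
  shows "(\<lambda>q. expectation (\<lambda>\<omega>. (gsum q h \<omega>)\<^sup>2) / 4 ^ q) \<longlonglongrightarrow> 0"
proof -
  obtain g where g: "g \<in> F" "\<And>r x. \<bar>(Q ^^ r) h x\<bar> \<le> g x" using Qpow_dominated[OF h] by blast
  have sq: "((Q ^^ r) h x)\<^sup>2 \<le> (g x)\<^sup>2" for r x
    using power_mono[OF g(2), of r x 2] by simp
  have lim: "(\<lambda>r. ((Q ^^ r) h x)\<^sup>2) \<longlonglongrightarrow> 0" for x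
    using tendsto_power[OF Qpow_tendsto[OF h], of x 2] h0 by simp
  have gen: "(\<lambda>r. expectation (gsum p (\<lambda>x. ((Q ^^ r) h x)\<^sup>2))) \<longlonglongrightarrow> 0" for p
  proof -
    have "(\<lambda>r. expectation (gsum p (\<lambda>x. ((Q ^^ r) h x)\<^sup>2))) \<longlonglongrightarrow> expectation (\<lambda>_. 0)"
    proof (rule integral_dominated_convergence[where w = "gsum p (\<lambda>x. (g x)\<^sup>2)"])
      show "integrable M (gsum p (\<lambda>x. (g x)\<^sup>2))" by (intro integrable_gsum square g)
      show "gsum p (\<lambda>x. ((Q ^^ r) h x)\<^sup>2) \<in> borel_measurable M" for r by (intro gsum_measurable square Qpow_F h)
      have "(\<lambda>r. gsum p (\<lambda>x. ((Q ^^ r) h x)\<^sup>2) \<omega>) \<longlonglongrightarrow> 0" for \<omega>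
        unfolding gsum_def by (intro tendsto_null_sum lim)
      thus "AE \<omega> in M. (\<lambda>r. gsum p (\<lambda>x. ((Q ^^ r) h x)\<^sup>2) \<omega>) \<longlonglongrightarrow> 0" by simp
      have "gsum p (\<lambda>x. ((Q ^^ r) h x)\<^sup>2) \<omega> \<le> gsum p (\<lambda>x. (g x)\<^sup>2) \<omega>" for r \<omega>
        unfolding gsum_def by (intro sum_mono sq)
      thus "AE \<omega> in M. norm (gsum p (\<lambda>x. ((Q ^^ r) h x)\<^sup>2) \<omega>) \<le> gsum p (\<lambda>x. (g x)\<^sup>2) \<omega>" for r
        by (simp add: gsum_nonneg)
    qed simp
    thus ?thesis by simp
  qed
  obtain K where K: "\<And>q. expectation (gsum q (\<lambda>x. (g x)\<^sup>2)) \<le> K * 2 ^ q" "K \<ge> 0"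
    using expectation_gsum_bound[OF square[OF g(1)]] by auto
  \<comment> \<open>Extension by zero turns sums of growing length into series over one fixed index
    set.\<close>
  define a where "a p q = (if p < q then expectation (gsum (Suc p) (\<lambda>x. ((Q ^^ (q - Suc p)) h x)\<^sup>2)) / 4 ^ p else 0)" for p q
  have a_bound: "norm (a p q) \<le> 2 * K * (1/2) ^ p" for p q
  proof (cases "p < q")
    case True
    have "expectation (gsum (Suc p) (\<lambda>x. ((Q ^^ (q - Suc p)) h x)\<^sup>2)) \<le> expectation (gsum (Suc p) (\<lambda>x. (g x)\<^sup>2))"
      by (intro integral_mono integrable_gsum square Qpow_F h g) (auto simp: gsum_def intro!: sum_mono sq)
    also have "\<dots> \<le> K * 2 ^ Suc p" by (rule K)
    finally have "a p q \<le> (K * 2 ^ Suc p) / 4 ^ p" using True by (simp add: a_def divide_right_mono)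
    also have "\<dots> = 2 * K * (1/2) ^ p"
      by (simp add: power_divide field_simps flip: power_mult_distrib)
    finally have "a p q \<le> 2 * K * (1/2) ^ p" .
    moreover have "a p q \<ge> 0" unfolding a_def by (auto intro!: divide_nonneg_pos integral_nonneg_AE gsum_nonneg)
    ultimately show ?thesis by simp
  qed (use K in \<open>simp add: a_def\<close>)
  have a_lim: "(\<lambda>q. a p q) \<longlonglongrightarrow> 0" for p
  proof -
    have "(\<lambda>r. expectation (gsum (Suc p) (\<lambda>x. ((Q ^^ r) h x)\<^sup>2)) / 4 ^ p) \<longlonglongrightarrow> 0"
      by (rule tendsto_divide_zero[OF gen])
    hence "(\<lambda>r. a p (r + Suc p)) \<longlonglongrightarrow> 0" by (simp add: a_def)
    thus ?thesis by (rule LIMSEQ_offset)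
  qed
  have "(\<lambda>q. \<Sum>p. a p q) \<longlonglongrightarrow> (\<Sum>p. 0)"
    by (rule tannerys_theorem[where M = "\<lambda>p. 2 * K * (1/2) ^ p", THEN conjunct2, THEN conjunct2, OF a_lim])
       (auto simp: a_bound[unfolded real_norm_def] summable_geometric intro!: always_eventually summable_mult)
  moreover have "(\<Sum>p. a p q) = (\<Sum>p<q. expectation (gsum (Suc p) (\<lambda>x. ((Q ^^ (q - Suc p)) h x)\<^sup>2)) / 4 ^ p)" for q
    by (subst suminf_finite[of "{..<q}"]) (auto simp: a_def)
  ultimately have 1: "(\<lambda>q. \<Sum>p<q. expectation (gsum (Suc p) (\<lambda>x. ((Q ^^ (q - Suc p)) h x)\<^sup>2)) / 4 ^ p) \<longlonglongrightarrow> 0"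
    by simp
  have "generation 0 = {1}" by (auto simp: generation_def)
  hence 2: "(\<lambda>q. expectation (\<lambda>\<omega>. ((Q ^^ q) h (X 1 \<omega>))\<^sup>2)) \<longlonglongrightarrow> 0"
    using gen[of 0] by (simp add: gsum_def[abs_def])
  show ?thesis
  proof (rule tendsto_sandwich[OF _ _ tendsto_const])
    show "(\<lambda>q. expectation (\<lambda>\<omega>. ((Q ^^ q) h (X 1 \<omega>))\<^sup>2)
      + (\<Sum>p<q. expectation (gsum (Suc p) (\<lambda>x. ((Q ^^ (q - Suc p)) h x)\<^sup>2)) / 4 ^ p)) \<longlonglongrightarrow> 0"
      using tendsto_add[OF 2 1] by simp
    show "\<forall>\<^sub>F q in sequentially. expectation (\<lambda>\<omega>. (gsum q h \<omega>)\<^sup>2) / 4 ^ q \<le> expectation (\<lambda>\<omega>. ((Q ^^ q) h (X 1 \<omega>))\<^sup>2)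
      + (\<Sum>p<q. expectation (gsum (Suc p) (\<lambda>x. ((Q ^^ (q - Suc p)) h x)\<^sup>2)) / 4 ^ p)"
      by (intro always_eventually allI gsum_square_bound h)
  qed (auto intro!: always_eventually divide_nonneg_pos integral_nonneg_AE)
qed

end

text \<open>
  The correlations \<open>c i j\<close> depend only on whether \<open>i = j\<close>, so both sides are determined by two numbers,
  which are computed from the case \<open>J = G\<close>.
\<close>

lemma sum_permutes_sampling_le:
  fixes a :: "'i \<Rightarrow> real"
  assumes G: "finite G" and J: "J \<subseteq> G"
  shows "(\<Sum>\<sigma> | \<sigma> permutes G. (\<Sum>i\<in>J. a (\<sigma> i))\<^sup>2) \<le> fact (card G) * ((\<Sum>i\<in>G. (a i)\<^sup>2) + (\<Sum>i\<in>G. a i)\<^sup>2)"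
proof -
  define c where "c i j = (\<Sum>\<sigma> | \<sigma> permutes G. a (\<sigma> i) * a (\<sigma> j))" for i j
  have inv: "c (\<tau> i) (\<tau> j) = c i j" if "\<tau> permutes G" for \<tau> i j
    unfolding c_def using sum_permutations_compose_right[OF that, of "\<lambda>\<sigma>. a (\<sigma> i) * a (\<sigma> j)"] by simp
  have sym: "c i j = c j i" for i j by (simp add: c_def mult.commute)
  have diag: "c i i = c k k" if "i \<in> G" "k \<in> G" for i k
    using inv[of "Transposition.transpose i k" i i] that by (simp add: permutes_swap_id)
  have move: "c i j = c k j" if "i \<in> G" "k \<in> G" "i \<noteq> j" "k \<noteq> j" for i j k
    using inv[of "Transposition.transpose i k" i j] that by (simp add: permutes_swap_id)
  \<comment> \<open>Indices are moved one at a time by transpositions, and they must never coincide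
    on the way. If \<open>i = l\<close>, moving \<open>j\<close> to \<open>k\<close> and using
    symmetry is enough; otherwise \<open>j\<close> goes to \<open>l\<close> first and then
    \<open>i\<close> to \<open>k\<close>.\<close>
  have off: "c i j = c k l" if "i \<in> G" "j \<in> G" "k \<in> G" "l \<in> G" "i \<noteq> j" "k \<noteq> l" for i j k l
  proof (cases "i = l")
    case False
    have "c i j = c j i" by (rule sym)
    also have "\<dots> = c l i" using that False by (intro move) auto
    also have "\<dots> = c i l" by (rule sym)
    also have "\<dots> = c k l" using that False by (intro move) auto
    finally show ?thesis .
  next
    case True
    have "c i j = c j i" by (rule sym)
    also have "\<dots> = c k i" using that True by (intro move) auto
    finally show ?thesis using True by simp
  qed
  define d where "d = c (SOME k. k \<in> G) (SOME k. k \<in> G)"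
  have d: "c i i = d" if "i \<in> G" for i
    unfolding d_def using that someI[of "\<lambda>k. k \<in> G" i] by (intro diag) auto
  \<comment> \<open>When \<open>G\<close> has fewer than two elements there is no such pair and
    \<open>e\<close> is arbitrary; its coefficient in \<open>count\<close> is then zero.\<close>
  define kl where "kl = (SOME p. fst p \<in> G \<and> snd p \<in> G \<and> fst p \<noteq> snd p)"
  define e where "e = c (fst kl) (snd kl)"
  have e: "c i j = e" if "i \<in> G" "j \<in> G" "i \<noteq> j" for i j
    unfolding e_def kl_def
    using that someI[of "\<lambda>p. fst p \<in> G \<and> snd p \<in> G \<and> fst p \<noteq> snd p" "(i, j)"]
    by (intro off) auto
  have count: "(\<Sum>\<sigma> | \<sigma> permutes G. (\<Sum>i\<in>I. a (\<sigma> i))\<^sup>2) = card I * d + card I * (real (card I) - 1) * e"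
    if I: "I \<subseteq> G" for I
  proof -
    have fI: "finite I" using I G by (rule finite_subset)
    have "(\<Sum>\<sigma> | \<sigma> permutes G. (\<Sum>i\<in>I. a (\<sigma> i))\<^sup>2) = (\<Sum>i\<in>I. \<Sum>j\<in>I. c i j)"
      unfolding c_def power2_eq_square sum_product
      by (subst sum.swap, intro sum.cong refl, subst sum.swap, rule refl)
    also have "\<dots> = (\<Sum>i\<in>I. d + (real (card I) - 1) * e)"
    proof (intro sum.cong refl)
      fix i assume i: "i \<in> I"
      have "(\<Sum>j\<in>I. c i j) = c i i + (\<Sum>j\<in>I - {i}. c i j)" using fI i by (rule sum.remove)
      also have "(\<Sum>j\<in>I - {i}. c i j) = (\<Sum>j\<in>I - {i}. e)" using i I by (intro sum.cong refl e) auto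
      also have "\<dots> = (real (card I) - 1) * e"
      proof -
        have "card I \<ge> 1" using i fI by (metis One_nat_def Suc_leI card_gt_0_iff empty_iff)
        thus ?thesis using i fI by (simp add: card_Diff_singleton of_nat_diff)
      qed
      finally show "(\<Sum>j\<in>I. c i j) = d + (real (card I) - 1) * e" using d i I by auto
    qed
    also have "\<dots> = card I * d + card I * (real (card I) - 1) * e" by (simp add: algebra_simps)
    finally show ?thesis .
  qed
  have nperm: "card {\<sigma>. \<sigma> permutes G} = fact (card G)" by (rule card_permutations[OF refl G])
  have Nd: "card G * d = fact (card G) * (\<Sum>i\<in>G. (a i)\<^sup>2)"
  proof -
    have "card G * d = (\<Sum>i\<in>G. c i i)" using d by simp
    also have "\<dots> = (\<Sum>\<sigma> | \<sigma> permutes G. \<Sum>i\<in>G. (a (\<sigma> i))\<^sup>2)"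
      unfolding c_def power2_eq_square by (rule sum.swap)
    also have "\<dots> = (\<Sum>\<sigma> | \<sigma> permutes G. \<Sum>i\<in>G. (a i)\<^sup>2)"
    proof (rule sum.cong[OF refl])
      fix \<sigma> assume "\<sigma> \<in> {\<sigma>. \<sigma> permutes G}"
      hence s: "\<sigma> permutes G" by simp
      show "(\<Sum>i\<in>G. (a (\<sigma> i))\<^sup>2) = (\<Sum>i\<in>G. (a i)\<^sup>2)"
        using sum.permute[OF s, of "\<lambda>i. (a i)\<^sup>2"] by (simp add: o_def)
    qed
    finally show ?thesis by (simp add: nperm)
  qed
  have full: "card G * d + card G * (real (card G) - 1) * e = fact (card G) * (\<Sum>i\<in>G. a i)\<^sup>2"
  proof -
    have "(\<Sum>\<sigma> | \<sigma> permutes G. (\<Sum>i\<in>G. a (\<sigma> i))\<^sup>2) = (\<Sum>\<sigma> | \<sigma> permutes G. (\<Sum>i\<in>G. a i)\<^sup>2)"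
    proof (intro sum.cong refl)
      fix \<sigma> assume "\<sigma> \<in> {\<sigma>. \<sigma> permutes G}"
      hence s: "\<sigma> permutes G" by simp
      show "(\<Sum>i\<in>G. a (\<sigma> i))\<^sup>2 = (\<Sum>i\<in>G. a i)\<^sup>2"
        using sum.permute[OF s, of a] by (simp add: o_def)
    qed
    thus ?thesis using count[OF subset_refl] by (simp add: nperm)
  qed
  have m: "card J \<le> card G" using J G by (rule card_mono[rotated])
  have mm: "0 \<le> real (card J) * (real (card J) - 1)" by (cases "card J") auto
  have mm2: "real (card J) * (real (card J) - 1) \<le> real (card G) * (real (card G) - 1)"
  proof (cases "card J = 0")
    case True
    thus ?thesis by (cases "card G") auto
  next
    case False
    thus ?thesis using m by (intro mult_mono) auto
  qed
  show ?thesis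
  proof (cases "G = {}")
    case True
    thus ?thesis using J by simp
  next
    case False
    hence N: "card G > 0" using G by (simp add: card_gt_0_iff)
    have d0: "d \<ge> 0"
    proof -
      have "0 \<le> card G * d" unfolding Nd by (intro mult_nonneg_nonneg sum_nonneg) auto
      thus ?thesis using N by (simp add: zero_le_mult_iff)
    qed
    have 1: "card J * d \<le> card G * d" using m d0 by (intro mult_right_mono) auto
    have p1: "0 \<le> fact (card G) * (\<Sum>i\<in>G. (a i)\<^sup>2)" "0 \<le> fact (card G) * (\<Sum>i\<in>G. a i)\<^sup>2"
      by (auto intro!: mult_nonneg_nonneg sum_nonneg)
    show ?thesis
    proof (cases "e \<ge> 0")
      case True
      hence "card J * (real (card J) - 1) * e \<le> card G * (real (card G) - 1) * e"
        using mm2 by (intro mult_right_mono) auto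
      thus ?thesis using 1 full p1 unfolding count[OF J] distrib_left by linarith
    next
      case False
      hence "card J * (real (card J) - 1) * e \<le> 0" using mm by (intro mult_nonneg_nonpos) auto
      thus ?thesis using 1 Nd p1 unfolding count[OF J] distrib_left by linarith
    qed
  qed
qed

text \<open>Reversing the order of summation gives weights \<open>(1/2) ^ p\<close> on
  \<open>\<beta> (r - p)\<close>, so only the last few generations count. With
  \<open>2 ^ q * \<beta> q\<close> as error of generation \<open>q\<close>, the total error is of
  smaller order than the tree.\<close>

lemma geometric_average_tendsto_0:
  fixes \<beta> :: "nat \<Rightarrow> real"
  assumes "\<beta> \<longlonglongrightarrow> 0"
  shows "(\<lambda>r. (\<Sum>q<Suc r. 2 ^ q * \<beta> q) / 2 ^ r) \<longlonglongrightarrow> 0"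
proof -
  obtain B where B: "\<And>n. norm (\<beta> n) \<le> B"
    using convergent_imp_Bseq[OF convergentI[OF assms]] by (auto simp: Bseq_def)
  define a where "a p r = (if p \<le> r then (1/2) ^ p * \<beta> (r - p) else 0)" for p r
  have bound: "norm (a p r) \<le> B * (1/2) ^ p" for p r
    using B[of "r - p"] order_trans[OF norm_ge_zero B[of 0]]
    by (auto simp: a_def abs_mult mult.commute intro!: divide_right_mono)
  have lim: "(\<lambda>r. a p r) \<longlonglongrightarrow> 0" for p
  proof -
    have "(\<lambda>r. (1/2) ^ p * \<beta> r) \<longlonglongrightarrow> (1/2) ^ p * 0" by (intro tendsto_intros assms)
    hence "(\<lambda>r. a p (r + p)) \<longlonglongrightarrow> 0" by (simp add: a_def)
    thus ?thesis by (rule LIMSEQ_offset)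
  qed
  have "(\<lambda>r. \<Sum>p. a p r) \<longlonglongrightarrow> (\<Sum>p. 0)"
    by (rule tannerys_theorem[where M = "\<lambda>p. B * (1/2) ^ p", THEN conjunct2, THEN conjunct2, OF lim])
       (auto simp: bound[unfolded real_norm_def] summable_geometric intro!: always_eventually summable_mult)
  moreover have "(\<Sum>p. a p r) = (\<Sum>q<Suc r. 2 ^ q * \<beta> q) / 2 ^ r" for r
  proof -
    have "(\<Sum>p. a p r) = (\<Sum>p<Suc r. a p r)" by (subst suminf_finite[of "{..<Suc r}"]) (auto simp: a_def)
    also have "\<dots> = (\<Sum>p<Suc r. (1/2) ^ p * \<beta> (r - p))" by (intro sum.cong) (auto simp: a_def)
    also have "\<dots> = (\<Sum>q<Suc r. (1/2) ^ (r - q) * \<beta> q)"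
      by (subst sum.nat_diff_reindex[symmetric]) (auto intro!: sum.cong)
    also have "\<dots> = (\<Sum>q<Suc r. 2 ^ q * \<beta> q / 2 ^ r)"
      by (intro sum.cong refl) (auto simp: power_diff power_divide)
    finally show ?thesis by (simp only: sum_divide_distrib)
  qed
  ultimately show ?thesis by simp
qed

text \<open>Both branches of the definition are images of the standard normal law under
  multiplication by \<open>sqrt v\<close>, so the degenerate case obeys the same formula.\<close>

lemma char_normal_law:
  assumes "v \<ge> 0"
  shows "char (normal_law 0 v) t = of_real (exp (- (t\<^sup>2 * v / 2)))"
    and "real_distribution (normal_law 0 v)"
proof -
  interpret std: real_distribution std_normal_distribution by (rule real_dist_normal_dist)
  have eq: "normal_law 0 v = distr std_normal_distribution borel (\<lambda>x. sqrt v * x)"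
  proof (cases "v = 0")
    case True
    have "distr std_normal_distribution borel (\<lambda>x. 0) = return borel (0::real)"
      by (rule std.distr_const)  simp
    thus ?thesis using True by (simp add: normal_law_def)
  next
    case False
    hence s: "sqrt v > 0" using assms by simp
    have "distributed std_normal_distribution lborel (\<lambda>x. x) (normal_density 0 1)"
      by (auto simp: distributed_def distr_id2 intro!: distr_cong)
    from std.normal_density_affine[OF this, of "sqrt v" 0] s
    have "distributed std_normal_distribution lborel (\<lambda>x. sqrt v * x) (normal_density 0 (sqrt v))" by simp
    hence "distr std_normal_distribution lborel (\<lambda>x. sqrt v * x) = density lborel (normal_density 0 (sqrt v))"
      by (simp add: distributed_def)
    moreover have "distr std_normal_distribution lborel (\<lambda>x. sqrt v * x) = distr std_normal_distribution borel (\<lambda>x. sqrt v * x)"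
      by (rule distr_cong) auto
    ultimately show ?thesis using False by (simp add: normal_law_def)
  qed
  show "real_distribution (normal_law 0 v)"
    unfolding eq by (rule std.real_distribution_distr) simp
  have "char (normal_law 0 v) t = (\<integral>x. iexp (t * (sqrt v * x)) \<partial>std_normal_distribution)"
    unfolding eq char_def by (subst integral_distr) auto
  also have "\<dots> = char std_normal_distribution (t * sqrt v)" by (simp add: char_def mult_ac)
  also have "\<dots> = of_real (exp (- (t\<^sup>2 * v / 2)))"
    using assms by (simp add: char_std_normal_distribution power_mult_distrib)
  finally show "char (normal_law 0 v) t = of_real (exp (- (t\<^sup>2 * v / 2)))" .
qed

lemma sum_generations:
  fixes w :: "nat \<Rightarrow> 'b::comm_monoid_add"
  shows "sum w {1..<2 ^ r} = (\<Sum>q<r. sum w (generation q))"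
proof (induction r)
  case (Suc r)
  have "{1..<2 ^ Suc r} = {1..<2 ^ r} \<union> generation r" "{1..<2 ^ r} \<inter> generation r = {}"
    by (auto simp: generation_def intro: order_trans[OF one_le_power])
  thus ?case using Suc by (simp add: sum.union_disjoint)
qed simp

section \<open>Comparison with the Gaussian characteristic function\<close>

locale admissible_functional = admissible_chain M Filt X \<nu> P F \<mu>
  for M :: "'a measure" and Filt and X :: "nat \<Rightarrow> 'a \<Rightarrow> 's::metric_space" and \<nu> P F \<mu> +
  fixes f :: "'s \<times> 's \<times> 's \<Rightarrow> real"
  assumes f_measurable: "f \<in> borel_measurable (borel \<Otimes>\<^sub>M borel \<Otimes>\<^sub>M borel)"
    and f_exists: "triple_op_exists P f" "triple_op P f \<in> F"
    and f2_exists: "triple_op_exists P (\<lambda>w. (f w)\<^sup>2)" "triple_op P (\<lambda>w. (f w)\<^sup>2) \<in> F"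
    and f4_exists: "triple_op_exists P (\<lambda>w. (f w) ^ 4)" "triple_op P (\<lambda>w. (f w) ^ 4) \<in> F"
begin

definition g :: "'s \<times> 's \<times> 's \<Rightarrow> real" where
  "g w = f w - triple_op P f (fst w)"

text \<open>This form shows membership in \<open>F\<close> directly; that it is the conditional
  second moment of \<open>g\<close> is derived in \<open>g_variance\<close>.\<close>

definition V :: "'s \<Rightarrow> real" where
  "V x = triple_op P (\<lambda>w. (f w)\<^sup>2) x - (triple_op P f x)\<^sup>2"

text \<open>Dominates the conditional fourth moment of \<open>g\<close>, which itself need not belong to \<open>F\<close>.\<close>

definition H :: "'s \<Rightarrow> real" where
  "H x = 8 * (triple_op P (\<lambda>w. f w ^ 4) x + (triple_op P f x) ^ 4)"

definition s2 :: real where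
  "s2 = (\<integral>x. V x \<partial>\<mu>)"

lemma V_F: "V \<in> F"
  unfolding V_def by (intro F_diff square f_exists f2_exists)

lemma H_F: "H \<in> F"
proof -
  have "(\<lambda>x. ((triple_op P f x)\<^sup>2)\<^sup>2) \<in> F" by (intro square f_exists)
  hence "(\<lambda>x. (triple_op P f x) ^ 4) \<in> F" by (simp flip: power_mult)
  thus ?thesis unfolding H_def by (intro scale add f4_exists)
qed

lemma g_measurable [measurable]: "g \<in> borel_measurable (borel \<Otimes>\<^sub>M borel \<Otimes>\<^sub>M borel)"
proof -
  note [measurable] = f_measurable F_borel[OF f_exists(2)]
  show ?thesis unfolding g_def by measurable
qed

lemma
  shows g_mean: "(\<integral>t. g (x, t) \<partial>P x) = 0"
    and g_variance: "(\<integral>t. (g (x, t))\<^sup>2 \<partial>P x) = V x"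
    and g4_integrable: "integrable (P x) (\<lambda>t. g (x, t) ^ 4)"
    and g4_le: "(\<integral>t. g (x, t) ^ 4 \<partial>P x) \<le> H x"
    and H_nonneg: "H x \<ge> 0" and V_nonneg: "V x \<ge> 0"
proof -
  interpret PX: prob_space "P x" by (rule prob_space_P)
  let ?m = "triple_op P f x"
  have op: "triple_op P k x = (\<integral>t. k (x, t) \<partial>P x)" for k :: "'s \<times> 's \<times> 's \<Rightarrow> real"
    by (simp add: triple_op_def case_prod_unfold)
  have i: "integrable (P x) (\<lambda>t. f (x, t))" "integrable (P x) (\<lambda>t. (f (x, t))\<^sup>2)" "integrable (P x) (\<lambda>t. f (x, t) ^ 4)"
    using f_exists(1) f2_exists(1) f4_exists(1) by (auto simp: triple_op_exists_def case_prod_unfold)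
  have gx: "g (x, t) = f (x, t) - ?m" for t by (simp add: g_def)
  have gm: "(\<lambda>t. g (x, t)) \<in> borel_measurable (P x)"
    by (subst measurable_cong_sets[OF sets_P refl]) measurable
  have p1: "(\<integral>t. c \<partial>P x) = c" for c :: real using PX.prob_space by simp
  show "(\<integral>t. g (x, t) \<partial>P x) = 0" unfolding gx using i p1 by (simp add: op)
  have "(\<integral>t. (g (x, t))\<^sup>2 \<partial>P x) = (\<integral>t. (f (x, t))\<^sup>2 - 2 * ?m * f (x, t) + ?m\<^sup>2 \<partial>P x)"
    by (intro Bochner_Integration.integral_cong refl) (simp add: gx power2_eq_square algebra_simps)
  also have "\<dots> = (\<integral>t. (f (x, t))\<^sup>2 \<partial>P x) - 2 * ?m * (\<integral>t. f (x, t) \<partial>P x) + ?m\<^sup>2"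
    using i p1 by simp
  also have "\<dots> = V x" by (simp add: V_def op power2_eq_square)
  finally show gV: "(\<integral>t. (g (x, t))\<^sup>2 \<partial>P x) = V x" .
  have iH: "integrable (P x) (\<lambda>t. 8 * (f (x, t) ^ 4 + ?m ^ 4))" using i by auto
  \<comment> \<open>The factor \<open>8 = 2^2 * 2\<close> arises from applying
    \<open>(a + b)^2 \<le> 2 (a^2 + b^2)\<close> first to the difference and then to the squares. It
    is the constant in \<open>H\<close>.\<close>
  have le: "g (x, t) ^ 4 \<le> 8 * (f (x, t) ^ 4 + ?m ^ 4)" for t
  proof -
    have *: "(a + b)\<^sup>2 \<le> 2 * (a\<^sup>2 + b\<^sup>2)" for a b :: real
      using zero_le_power2[of "a - b"] by (simp add: power2_eq_square algebra_simps)
    have "g (x, t) ^ 4 = ((f (x, t) + (- ?m))\<^sup>2)\<^sup>2" by (simp add: gx flip: power_mult)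
    also have "\<dots> \<le> (2 * ((f (x, t))\<^sup>2 + (- ?m)\<^sup>2))\<^sup>2" by (intro power_mono *) auto
    also have "\<dots> = 4 * ((f (x, t))\<^sup>2 + (- ?m)\<^sup>2)\<^sup>2" by (simp only: power_mult_distrib) simp
    also have "\<dots> \<le> 4 * (2 * (((f (x, t))\<^sup>2)\<^sup>2 + ((- ?m)\<^sup>2)\<^sup>2))" by (intro mult_left_mono *) auto
    also have "\<dots> = 8 * (f (x, t) ^ 4 + ?m ^ 4)" by (simp flip: power_mult)
    finally show ?thesis .
  qed
  show g4: "integrable (P x) (\<lambda>t. g (x, t) ^ 4)"
    using le gm by (intro Bochner_Integration.integrable_bound[OF iH]) (auto intro!: AE_I2 order_trans[OF _ abs_ge_self])
  have "(\<integral>t. g (x, t) ^ 4 \<partial>P x) \<le> (\<integral>t. 8 * (f (x, t) ^ 4 + ?m ^ 4) \<partial>P x)"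
    by (intro integral_mono g4 iH le)
  also have "\<dots> = H x" using i p1 by (simp add: H_def op)
  finally show le': "(\<integral>t. g (x, t) ^ 4 \<partial>P x) \<le> H x" .
  have "0 \<le> (\<integral>t. g (x, t) ^ 4 \<partial>P x)" by (auto intro!: integral_nonneg_AE)
  thus "H x \<ge> 0" using le' by (rule order_trans)
  show "V x \<ge> 0" unfolding gV[symmetric] by (auto intro!: integral_nonneg_AE)
qed

lemma s2_nonneg: "s2 \<ge> 0"
  unfolding s2_def by (auto intro!: integral_nonneg_AE V_nonneg)

lemma s2_eq: "s2 = (\<integral>x. triple_op P (\<lambda>w. (f w)\<^sup>2) x \<partial>\<mu>) - (\<integral>x. (triple_op P f x)\<^sup>2 \<partial>\<mu>)"
  unfolding s2_def V_def by (intro Bochner_Integration.integral_diff limit_integrable square f_exists f2_exists)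

definition h :: "'s \<Rightarrow> real" where
  "h x = V x - s2"

lemma h_F: "h \<in> F"
  unfolding h_def by (intro F_diff V_F const)

lemma h_mean: "(\<integral>x. h x \<partial>\<mu>) = 0"
proof -
  interpret mu: prob_space \<mu> by (rule limit_prob)
  show ?thesis using limit_integrable[OF V_F] mu.prob_space by (simp add: h_def s2_def)
qed

text \<open>The Taylor error has a nonnegative bound and may be enlarged from \<open>A q\<close> to
  the whole generation. The sum of \<open>h\<close> is signed and must stay over \<open>A q\<close>:
  enlarging the set would not bound it.\<close>

lemma char_tree_bound:
  assumes A: "\<And>q. A q \<subseteq> generation q"
  shows "norm ((\<integral>\<omega>. iexp (u * (\<Sum>q<r. \<Sum>i\<in>A q. g (triangle X i \<omega>))) \<partial>M)
           - of_real (exp (- (u\<^sup>2 * (s2 * (\<Sum>q<r. card (A q))) / 2))))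
     \<le> (\<Sum>q<r. (\<bar>u\<bar> ^ 3 + u ^ 4) * expectation (gsum q (\<lambda>x. V x + H x))
            + u\<^sup>2 / 2 * expectation (\<lambda>\<omega>. \<bar>\<Sum>i\<in>A q. h (X i \<omega>)\<bar>))"
proof -
  define c :: "nat \<Rightarrow> complex" where "c q = of_real (exp (- (u\<^sup>2 * (s2 * card (A q)) / 2)))" for q
  have c: "norm (c q) \<le> 1" for q using s2_nonneg by (simp add: c_def)
  have "iexp (u * (\<Sum>q<r. \<Sum>i\<in>A q. g (triangle X i \<omega>))) = (\<Prod>q<r. \<Prod>i\<in>A q. iexp (u * g (triangle X i \<omega>)))" for \<omega>
    using finite_subset[OF A] by (simp add: exp_sum[symmetric] sum_distrib_left)
  moreover have "of_real (exp (- (u\<^sup>2 * (s2 * (\<Sum>q<r. card (A q))) / 2))) = (\<Prod>q<r. c q)"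
  proof -
    have "- (u\<^sup>2 * (s2 * (\<Sum>q<r. card (A q))) / 2) = (\<Sum>q<r. - (u\<^sup>2 * (s2 * card (A q)) / 2))"
      by (simp add: sum_negf sum_distrib_left sum_divide_distrib)
    thus ?thesis unfolding c_def of_real_prod[symmetric] by (simp add: exp_sum[symmetric])
  qed
  moreover have "(\<integral>\<omega>. norm ((\<Prod>i\<in>A q. cf g u (X i \<omega>)) - c q) \<partial>M)
      \<le> (\<bar>u\<bar> ^ 3 + u ^ 4) * expectation (gsum q (\<lambda>x. V x + H x)) + u\<^sup>2 / 2 * expectation (\<lambda>\<omega>. \<bar>\<Sum>i\<in>A q. h (X i \<omega>)\<bar>)" for q
  proof -
    have int: "integrable M (gsum q (\<lambda>x. V x + H x))" by (intro integrable_gsum add V_F H_F)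
    have int2: "integrable M (\<lambda>\<omega>. \<bar>\<Sum>i\<in>A q. h (X i \<omega>)\<bar>)"
      using A by (intro integrable_abs Bochner_Integration.integrable_sum integrable_F_X_gen[OF h_F]) auto
    have "norm ((\<Prod>i\<in>A q. cf g u (X i \<omega>)) - c q)
        \<le> (\<bar>u\<bar> ^ 3 + u ^ 4) * gsum q (\<lambda>x. V x + H x) \<omega> + u\<^sup>2 / 2 * \<bar>\<Sum>i\<in>A q. h (X i \<omega>)\<bar>" for \<omega>
    proof -
      have "norm ((\<Prod>i\<in>A q. cf g u (X i \<omega>)) - c q)
         \<le> (\<bar>u\<bar> ^ 3 + u ^ 4) * (\<Sum>i\<in>A q. V (X i \<omega>) + (\<integral>t. g (X i \<omega>, t) ^ 4 \<partial>P (X i \<omega>))) + u\<^sup>2 / 2 * \<bar>\<Sum>i\<in>A q. V (X i \<omega>) - s2\<bar>"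
        using norm_prod_cf_diff_le[OF g_measurable g_mean g4_integrable s2_nonneg, where A = "A q" and x = "\<lambda>i. X i \<omega>" and u = u]
        by (simp add: c_def g_variance)
      also have "(\<Sum>i\<in>A q. V (X i \<omega>) + (\<integral>t. g (X i \<omega>, t) ^ 4 \<partial>P (X i \<omega>))) \<le> (\<Sum>i\<in>A q. V (X i \<omega>) + H (X i \<omega>))"
        by (intro sum_mono add_left_mono g4_le)
      also have "\<dots> \<le> gsum q (\<lambda>x. V x + H x) \<omega>"
        unfolding gsum_def by (intro sum_mono2 A add_nonneg_nonneg V_nonneg H_nonneg) auto
      finally show ?thesis by (simp add: h_def mult_left_mono)
    qed
    hence "(\<integral>\<omega>. norm ((\<Prod>i\<in>A q. cf g u (X i \<omega>)) - c q) \<partial>M)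
      \<le> (\<integral>\<omega>. (\<bar>u\<bar> ^ 3 + u ^ 4) * gsum q (\<lambda>x. V x + H x) \<omega> + u\<^sup>2 / 2 * \<bar>\<Sum>i\<in>A q. h (X i \<omega>)\<bar> \<partial>M)"
      using int int2 by (intro integral_mono' order_trans[OF norm_ge_zero]) auto
    also have "\<dots> = (\<bar>u\<bar> ^ 3 + u ^ 4) * expectation (gsum q (\<lambda>x. V x + H x)) + u\<^sup>2 / 2 * expectation (\<lambda>\<omega>. \<bar>\<Sum>i\<in>A q. h (X i \<omega>)\<bar>)"
      using int int2 by simp
    finally show ?thesis .
  qed
  ultimately show ?thesis
    using order_trans[OF expectation_iexp_tree[OF g_measurable A c, where r = r and u = u] sum_mono] by (simp only:)
qed

text \<open>Under the root stands the mean of the right side of the sampling inequality, without its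
  factorial, normalised by the squared size of the generation. Hence
  \<open>2 ^ q * \<beta> q\<close> bounds the error of a full generation and the mean error of a
  sampled one alike.\<close>

definition \<beta> :: "nat \<Rightarrow> real" where
  "\<beta> q = sqrt ((expectation (gsum q (\<lambda>x. (h x)\<^sup>2)) + expectation (\<lambda>\<omega>. (gsum q h \<omega>)\<^sup>2)) / 4 ^ q)"

lemma \<beta>_tendsto_0: "\<beta> \<longlonglongrightarrow> 0"
proof -
  obtain K where K: "\<And>q. expectation (gsum q (\<lambda>x. (h x)\<^sup>2)) \<le> K * 2 ^ q" "K \<ge> 0"
    using expectation_gsum_bound[OF square[OF h_F]] by auto
  have "(\<lambda>q. expectation (gsum q (\<lambda>x. (h x)\<^sup>2)) / 4 ^ q) \<longlonglongrightarrow> 0"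
  proof (rule tendsto_sandwich[OF _ _ tendsto_const])
    show "(\<lambda>q. K * (1/2) ^ q) \<longlonglongrightarrow> 0" by (intro tendsto_mult_right_zero LIMSEQ_power_zero) auto
    have "expectation (gsum q (\<lambda>x. (h x)\<^sup>2)) / 4 ^ q \<le> K * (1/2) ^ q" for q
    proof -
      have "expectation (gsum q (\<lambda>x. (h x)\<^sup>2)) / 4 ^ q \<le> (K * 2 ^ q) / 4 ^ q" by (intro divide_right_mono K) auto
      also have "(K * 2 ^ q) / 4 ^ q = K * (1/2) ^ q"
      proof -
        have "(4::real) ^ q = 2 ^ q * 2 ^ q" by (simp flip: power_mult_distrib)
        thus ?thesis by (simp add: power_divide)
      qed
      finally show ?thesis .
    qed
    thus "\<forall>\<^sub>F q in sequentially. expectation (gsum q (\<lambda>x. (h x)\<^sup>2)) / 4 ^ q \<le> K * (1/2) ^ q" by simp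
    show "\<forall>\<^sub>F q in sequentially. 0 \<le> expectation (gsum q (\<lambda>x. (h x)\<^sup>2)) / 4 ^ q"
      by (auto intro!: always_eventually divide_nonneg_pos integral_nonneg_AE gsum_nonneg)
  qed
  from tendsto_real_sqrt[OF tendsto_add[OF this gsum_square_tendsto_0[OF h_F h_mean]]]
  show ?thesis by (simp add: \<beta>_def[abs_def] add_divide_distrib)
qed

lemma \<beta>_scaled: "2 ^ q * \<beta> q = sqrt (expectation (gsum q (\<lambda>x. (h x)\<^sup>2)) + expectation (\<lambda>\<omega>. (gsum q h \<omega>)\<^sup>2))"
proof -
  have "(4::real) ^ q = (2 ^ q)\<^sup>2" by (simp add: power2_eq_square flip: power_mult_distrib)
  thus ?thesis unfolding \<beta>_def by (simp add: real_sqrt_divide)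
qed

text \<open>Cauchy-Schwarz is applied twice, to the expectation for each \<open>\<sigma>\<close> and
  to the mean over all \<open>\<sigma>\<close>. The sampling inequality can then be used for each
  \<open>\<omega>\<close> under the expectation, with the values \<open>h (X i \<omega>)\<close> as
  a fixed population.\<close>

lemma generation_average_le:
  assumes J: "J \<subseteq> generation q"
  shows "(\<Sum>\<sigma> | \<sigma> permutes generation q. expectation (\<lambda>\<omega>. \<bar>\<Sum>i\<in>\<sigma> ` J. h (X i \<omega>)\<bar>)) / fact (2 ^ q) \<le> 2 ^ q * \<beta> q"
proof -
  let ?Pi = "{\<sigma>. \<sigma> permutes generation q}"
  let ?N = "fact (2 ^ q) :: real"
  have card: "real (card ?Pi) = ?N" using card_permutations[OF card_generation finite_generation] by simp
  define Y where "Y \<sigma> \<omega> = (\<Sum>i\<in>J. h (X (\<sigma> i) \<omega>))" for \<sigma> \<omega>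
  have fin: "finite J" using J by (rule finite_subset) simp
  have Yeq: "(\<Sum>i\<in>\<sigma> ` J. h (X i \<omega>)) = Y \<sigma> \<omega>" if "\<sigma> permutes generation q" for \<sigma> \<omega>
    unfolding Y_def using permutes_inj[OF that] by (subst sum.reindex) (auto simp: inj_on_def)
  have in_gen: "\<sigma> i \<in> generation q" if "\<sigma> permutes generation q" "i \<in> J" for \<sigma> i
    using that J by (auto simp: permutes_in_image)
  have hX: "(\<lambda>\<omega>. h (X i \<omega>)) \<in> borel_measurable M" "integrable M (\<lambda>\<omega>. h (X i \<omega>))" "integrable M (\<lambda>\<omega>. (h (X i \<omega>))\<^sup>2)"
    if "i \<in> generation q" for i
    using F_X_measurable_gen[OF h_F that] integrable_F_X_gen[OF h_F that] integrable_F_X_gen[OF square[OF h_F] that] by auto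
  have Ym: "Y \<sigma> \<in> borel_measurable M" "integrable M (Y \<sigma>)" "integrable M (\<lambda>\<omega>. (Y \<sigma> \<omega>)\<^sup>2)"
    if s: "\<sigma> permutes generation q" for \<sigma>
  proof -
    show "Y \<sigma> \<in> borel_measurable M" "integrable M (Y \<sigma>)"
      unfolding Y_def using in_gen[OF s] hX by (auto intro!: borel_measurable_sum)
    have "integrable M (\<lambda>\<omega>. \<Sum>i\<in>J. \<Sum>j\<in>J. h (X (\<sigma> i) \<omega>) * h (X (\<sigma> j) \<omega>))"
      using in_gen[OF s] hX by (intro Bochner_Integration.integrable_sum integrable_product_squares) auto
    thus "integrable M (\<lambda>\<omega>. (Y \<sigma> \<omega>)\<^sup>2)" by (simp add: Y_def power2_eq_square sum_product)
  qed
  define E where "E \<sigma> = expectation (\<lambda>\<omega>. \<bar>Y \<sigma> \<omega>\<bar>)" for \<sigma>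
  have E2: "(E \<sigma>)\<^sup>2 \<le> expectation (\<lambda>\<omega>. (Y \<sigma> \<omega>)\<^sup>2)" if "\<sigma> permutes generation q" for \<sigma>
    using square_expectation_le[of "\<lambda>\<omega>. \<bar>Y \<sigma> \<omega>\<bar>"] Ym[OF that] by (simp add: E_def)
  have "(\<Sum>\<sigma>\<in>?Pi. E \<sigma>)\<^sup>2 \<le> (\<Sum>\<sigma>\<in>?Pi. (E \<sigma>)\<^sup>2) * ?N"
    using sum_squared_le_sum_of_squares[of E ?Pi] by (simp only: card)
  also have "(\<Sum>\<sigma>\<in>?Pi. (E \<sigma>)\<^sup>2) \<le> (\<Sum>\<sigma>\<in>?Pi. expectation (\<lambda>\<omega>. (Y \<sigma> \<omega>)\<^sup>2))"
    by (intro sum_mono E2) auto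
  also have "\<dots> = expectation (\<lambda>\<omega>. \<Sum>\<sigma>\<in>?Pi. (Y \<sigma> \<omega>)\<^sup>2)"
    using Ym by (intro Bochner_Integration.integral_sum[symmetric]) auto
  also have "\<dots> \<le> expectation (\<lambda>\<omega>. ?N * (gsum q (\<lambda>x. (h x)\<^sup>2) \<omega> + (gsum q h \<omega>)\<^sup>2))"
  proof (rule integral_mono)
    show "integrable M (\<lambda>\<omega>. \<Sum>\<sigma>\<in>?Pi. (Y \<sigma> \<omega>)\<^sup>2)" using Ym by auto
    show "integrable M (\<lambda>\<omega>. ?N * (gsum q (\<lambda>x. (h x)\<^sup>2) \<omega> + (gsum q h \<omega>)\<^sup>2))"
      using integrable_gsum[OF square[OF h_F]] integrable_gsum_square[OF h_F] by auto
    show "(\<Sum>\<sigma>\<in>?Pi. (Y \<sigma> \<omega>)\<^sup>2) \<le> ?N * (gsum q (\<lambda>x. (h x)\<^sup>2) \<omega> + (gsum q h \<omega>)\<^sup>2)" for \<omega>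
      using sum_permutes_sampling_le[OF finite_generation J, of "\<lambda>i. h (X i \<omega>)"] by (simp add: Y_def gsum_def)
  qed
  also have "\<dots> = ?N * (2 ^ q * \<beta> q)\<^sup>2"
  proof -
    have "0 \<le> expectation (gsum q (\<lambda>x. (h x)\<^sup>2)) + expectation (\<lambda>\<omega>. (gsum q h \<omega>)\<^sup>2)"
      by (intro add_nonneg_nonneg integral_nonneg_AE) (auto simp: gsum_nonneg)
    thus ?thesis unfolding \<beta>_scaled
      using integrable_gsum[OF square[OF h_F], of q] integrable_gsum_square[OF h_F, of q] by simp
  qed
  finally have "(\<Sum>\<sigma>\<in>?Pi. E \<sigma>)\<^sup>2 \<le> (?N * (2 ^ q * \<beta> q))\<^sup>2"
    by (simp add: power2_eq_square mult_ac)
  moreover have "0 \<le> ?N * (2 ^ q * \<beta> q)" unfolding \<beta>_scaled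
    by (intro mult_nonneg_nonneg real_sqrt_ge_zero add_nonneg_nonneg integral_nonneg_AE) (auto simp: gsum_nonneg)
  ultimately have "(\<Sum>\<sigma>\<in>?Pi. E \<sigma>) \<le> ?N * (2 ^ q * \<beta> q)" by (rule power2_le_imp_le)
  moreover have "(\<Sum>\<sigma>\<in>?Pi. expectation (\<lambda>\<omega>. \<bar>\<Sum>i\<in>\<sigma> ` J. h (X i \<omega>)\<bar>)) = (\<Sum>\<sigma>\<in>?Pi. E \<sigma>)"
    by (intro sum.cong refl) (auto simp: E_def Yeq)
  ultimately show ?thesis by (simp add: divide_le_eq mult_ac)
qed

lemma generation_full_le: "expectation (\<lambda>\<omega>. \<bar>gsum q h \<omega>\<bar>) \<le> 2 ^ q * \<beta> q"
proof -
  have "(expectation (\<lambda>\<omega>. \<bar>gsum q h \<omega>\<bar>))\<^sup>2 \<le> expectation (\<lambda>\<omega>. (gsum q h \<omega>)\<^sup>2)"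
    using square_expectation_le[of "\<lambda>\<omega>. \<bar>gsum q h \<omega>\<bar>"] gsum_measurable[OF h_F] integrable_gsum[OF h_F] integrable_gsum_square[OF h_F]
    by simp
  also have "\<dots> \<le> expectation (gsum q (\<lambda>x. (h x)\<^sup>2)) + expectation (\<lambda>\<omega>. (gsum q h \<omega>)\<^sup>2)"
    by (simp add: integral_nonneg_AE gsum_nonneg)
  finally show ?thesis unfolding \<beta>_scaled by (rule real_le_rsqrt)
qed

end

section \<open>Conditioning on the permutation\<close>

locale permuted_functional =
  admissible_functional M Filt X \<nu> P F \<mu> f + uniform_generation_permutation M \<pi>
  for M :: "'a measure" and Filt and X :: "nat \<Rightarrow> 'a \<Rightarrow> 's::metric_space" and \<nu> P F \<mu> f
    and \<pi> :: "'a \<Rightarrow> nat \<Rightarrow> nat" +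
  assumes indep: "permutation_indep_chain M \<pi> X"
begin

definition perm_alg :: "'a measure" where
  "perm_alg = vimage_algebra (space M) (\<lambda>\<omega>. \<lambda>n\<in>{1..}. \<pi> \<omega> n) (PiM {1..} (\<lambda>_. count_space UNIV))"

definition chain_alg :: "'a measure" where
  "chain_alg = vimage_algebra (space M) (\<lambda>\<omega>. \<lambda>n\<in>{1..}. X n \<omega>) (PiM {1..} (\<lambda>_. borel))"

lemma indep_algs: "indep_set (sets perm_alg) (sets chain_alg)"
  using indep by (simp add: permutation_indep_chain_def perm_alg_def chain_alg_def)

lemma space_algs [simp]: "space perm_alg = space M" "space chain_alg = space M"
  by (simp_all add: perm_alg_def chain_alg_def)

lemma sets_perm_alg: "E \<in> sets perm_alg \<Longrightarrow> E \<in> sets M"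
  using indep_setD_ev1[OF indep_algs] by auto

lemma perm_measurable:
  assumes "n \<ge> 1"
  shows "(\<lambda>\<omega>. \<pi> \<omega> n) \<in> perm_alg \<rightarrow>\<^sub>M count_space UNIV"
proof -
  have "(\<lambda>\<omega>. \<lambda>n\<in>{1..}. \<pi> \<omega> n) \<in> perm_alg \<rightarrow>\<^sub>M PiM {1..} (\<lambda>_. count_space UNIV)"
    unfolding perm_alg_def by (rule measurable_vimage_algebra1) (simp add: space_PiM)
  from measurable_compose[OF this measurable_component_singleton[of n]] show ?thesis
    using assms by simp
qed

lemma X_measurable_chain_alg:
  assumes "n \<ge> 1"
  shows "X n \<in> chain_alg \<rightarrow>\<^sub>M borel"
proof -
  have "(\<lambda>\<omega>. \<lambda>n\<in>{1..}. X n \<omega>) \<in> chain_alg \<rightarrow>\<^sub>M PiM {1..} (\<lambda>_. borel)"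
    unfolding chain_alg_def by (rule measurable_vimage_algebra1) (simp add: space_PiM)
  from measurable_compose[OF this measurable_component_singleton[of n]] show ?thesis
    using assms by simp
qed

lemma triangle_measurable_chain_alg:
  "i \<ge> 1 \<Longrightarrow> triangle X i \<in> chain_alg \<rightarrow>\<^sub>M borel \<Otimes>\<^sub>M borel \<Otimes>\<^sub>M borel"
  unfolding triangle_def by (intro measurable_Pair X_measurable_chain_alg) auto

text \<open>The indicator is taken complex valued so that both factors have the same type and the
  product rule for independent integrable variables applies. Independence is inherited from the two
  \<open>\<sigma>\<close>-fields by the smaller ones generated by the factors.\<close>

lemma expectation_perm_event:
  fixes Z :: "'a \<Rightarrow> complex"
  assumes E: "E \<in> sets perm_alg" and Z: "Z \<in> borel_measurable chain_alg" and int: "integrable M Z"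
  shows "(\<integral>\<omega>. indicator E \<omega> * Z \<omega> \<partial>M) = prob E * (\<integral>\<omega>. Z \<omega> \<partial>M)"
proof -
  have EM: "E \<in> sets M" using E by (rule sets_perm_alg)
  have I: "(indicator E :: 'a \<Rightarrow> complex) \<in> borel_measurable perm_alg" using E by simp
  have "indep_set (sigma_sets (space M) {(indicator E :: 'a \<Rightarrow> complex) -` A \<inter> space M | A. A \<in> sets borel})
      (sigma_sets (space M) {Z -` A \<inter> space M | A. A \<in> sets borel})"
    unfolding indep_set_def
  proof (rule indep_sets_mono_sets[OF indep_algs[unfolded indep_set_def]])
    fix b :: bool assume "b \<in> UNIV"
    show "(case b of True \<Rightarrow> sigma_sets (space M) {(indicator E :: 'a \<Rightarrow> complex) -` A \<inter> space M | A. A \<in> sets borel}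
          | False \<Rightarrow> sigma_sets (space M) {Z -` A \<inter> space M | A. A \<in> sets borel})
        \<subseteq> (case b of True \<Rightarrow> sets perm_alg | False \<Rightarrow> sets chain_alg)"
      using sets.sigma_sets_subset[of "{(indicator E :: 'a \<Rightarrow> complex) -` A \<inter> space M | A. A \<in> sets borel}" perm_alg]
        sets.sigma_sets_subset[of "{Z -` A \<inter> space M | A. A \<in> sets borel}" chain_alg]
        measurable_sets[OF I] measurable_sets[OF Z]
      by (auto split: bool.split)
  qed
  hence "indep_var borel (indicator E :: 'a \<Rightarrow> complex) borel Z"
    using int EM by (simp add: indep_var_eq borel_measurable_integrable)
  moreover have "integrable M (indicator E :: 'a \<Rightarrow> complex)"
    using EM by (intro integrable_const_bound[where B=1]) (auto simp: indicator_def)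
  moreover have "(\<integral>\<omega>. indicator E \<omega> \<partial>M) = complex_of_real (prob E)"
  proof -
    have "(\<integral>\<omega>. indicator E \<omega> \<partial>M) = (\<integral>\<omega>. complex_of_real (indicator E \<omega>) \<partial>M)"
      by (intro Bochner_Integration.integral_cong refl) (simp add: indicator_def)
    thus ?thesis using EM by (simp add: sets.Int_space_eq2)
  qed
  ultimately show ?thesis using indep_var_lebesgue_integral[of "indicator E" Z] int by simp
qed

definition perm_event :: "nat \<Rightarrow> (nat \<Rightarrow> nat) \<Rightarrow> 'a set" where
  "perm_event r \<sigma> = {\<omega> \<in> space M. \<forall>n\<in>generation r. \<pi> \<omega> n = \<sigma> n}"

lemma perm_event_sets: "perm_event r \<sigma> \<in> sets perm_alg"
proof -
  have "{\<omega> \<in> space perm_alg. \<forall>n\<in>generation r. \<pi> \<omega> n = \<sigma> n} \<in> sets perm_alg"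
  proof (rule sets.sets_Collect_finite_All)
    fix n assume "n \<in> generation r"
    hence "n \<ge> 1" by (rule generation_pos)
    from measurable_sets[OF perm_measurable[OF this], of "{\<sigma> n}"]
    show "{\<omega> \<in> space perm_alg. \<pi> \<omega> n = \<sigma> n} \<in> sets perm_alg"
      by (simp add: vimage_def Int_def conj_commute)
  qed simp
  thus ?thesis by (simp add: perm_event_def)
qed

lemma bij_betw_generation:
  assumes "\<omega> \<in> space M"
  shows "bij_betw (\<pi> \<omega>) (generation q) (generation q)"
proof (rule bij_betw_imageI)
  have "generation q \<subseteq> {1..}" by (meson atLeast_iff generation_pos subsetI)
  thus "inj_on (\<pi> \<omega>) (generation q)"
    using permutation[OF assms] by (auto simp: bij_betw_def intro: inj_on_subset)
qed (rule generation_invariant[OF assms])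

lemma perm_event_cover:
  assumes w: "\<omega> \<in> space M"
  obtains \<sigma> where "\<sigma> permutes generation r" "\<omega> \<in> perm_event r \<sigma>"
    "\<And>\<tau>. \<tau> permutes generation r \<Longrightarrow> \<omega> \<in> perm_event r \<tau> \<Longrightarrow> \<tau> = \<sigma>"
proof
  \<comment> \<open>A map that permutes a set is the identity elsewhere, so this extension of the
    restricted \<open>\<pi> \<omega>\<close> is the only one possible; uniqueness rests on
    it.\<close>
  let ?s = "\<lambda>n. if n \<in> generation r then \<pi> \<omega> n else n"
  have "bij_betw ?s (generation r) (generation r)"
    using bij_betw_generation[OF w, of r] by (subst bij_betw_cong[of _ _ "\<pi> \<omega>"]) auto
  thus "?s permutes generation r" by (rule bij_imp_permutes) auto
  show "\<omega> \<in> perm_event r ?s" using w by (simp add: perm_event_def)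
  show "\<tau> = ?s" if "\<tau> permutes generation r" "\<omega> \<in> perm_event r \<tau>" for \<tau>
    using that by (auto simp: perm_event_def permutes_def)
qed

lemma sum_perm_events:
  fixes \<phi> :: "(nat \<Rightarrow> nat) \<Rightarrow> 'b::comm_ring_1"
  assumes s: "\<sigma> permutes generation r" and w: "\<omega> \<in> perm_event r \<sigma>"
  shows "(\<Sum>\<tau> | \<tau> permutes generation r. indicator (perm_event r \<tau>) \<omega> * \<phi> \<tau>) = \<phi> \<sigma>"
proof -
  have "\<omega> \<in> space M" using w by (simp add: perm_event_def)
  then obtain \<sigma>' where "\<And>\<tau>. \<tau> permutes generation r \<Longrightarrow> \<omega> \<in> perm_event r \<tau> \<Longrightarrow> \<tau> = \<sigma>'"
    using perm_event_cover[of \<omega> r] by blast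
  hence uniq: "\<tau> = \<sigma>" if "\<tau> permutes generation r" "\<omega> \<in> perm_event r \<tau>" for \<tau> using that s w by metis
  have "(\<Sum>\<tau> | \<tau> permutes generation r. indicator (perm_event r \<tau>) \<omega> * \<phi> \<tau>)
      = (\<Sum>\<tau>\<in>{\<sigma>}. indicator (perm_event r \<tau>) \<omega> * \<phi> \<tau>)"
    using s uniq by (intro sum.mono_neutral_right finite_permutations) (auto simp: indicator_def)
  thus ?thesis using w by simp
qed

section \<open>The random sum and its versions with a fixed last generation\<close>

definition deviation :: "nat \<Rightarrow> 'a \<Rightarrow> real" where
  "deviation n \<omega> = triangle_sum \<pi> X n f \<omega> - vertex_sum \<pi> X n (triple_op P f) \<omega>"

text \<open>
  When \<open>\<pi>\<close> agrees with \<open>\<sigma>\<close> on the last generation reached by \<open>{1..n}\<close>, the visited vertices of generation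
  \<open>q\<close> are \<open>sampled n \<sigma> q\<close>; the earlier generations are visited completely, whatever \<open>\<pi>\<close> is there.
\<close>

definition sampled :: "nat \<Rightarrow> (nat \<Rightarrow> nat) \<Rightarrow> nat \<Rightarrow> nat set" where
  "sampled n \<sigma> q = (if q < floor_log n then generation q
     else if q = floor_log n then \<sigma> ` {2 ^ floor_log n..n} else {})"

definition deviation_at :: "nat \<Rightarrow> (nat \<Rightarrow> nat) \<Rightarrow> 'a \<Rightarrow> real" where
  "deviation_at n \<sigma> \<omega> = (\<Sum>q<Suc (floor_log n). \<Sum>i\<in>sampled n \<sigma> q. g (triangle X i \<omega>))"

lemma last_block:
  assumes "n \<ge> 1"
  shows "{2 ^ floor_log n..n} \<subseteq> generation (floor_log n)"
    and "{1..n} = {1..<2 ^ floor_log n} \<union> {2 ^ floor_log n..n}"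
    and "2 ^ floor_log n \<le> n"
proof -
  have 1: "2 ^ floor_log n \<le> n" using floor_log_exp2_le[of n] assms by simp
  have 2: "n < 2 ^ (floor_log n + 1)" using floor_log_exp2_gt[of n] by simp
  have 3: "1 \<le> (2::nat) ^ floor_log n" by simp
  show "{2 ^ floor_log n..n} \<subseteq> generation (floor_log n)" using 2 by (auto simp: generation_def)
  show "{1..n} = {1..<2 ^ floor_log n} \<union> {2 ^ floor_log n..n}" using 1 by (auto simp del: One_nat_def dest: order_trans[OF 3])
  show "2 ^ floor_log n \<le> n" by (rule 1)
qed

lemma sampled_subset:
  assumes "n \<ge> 1" "\<sigma> permutes generation (floor_log n)"
  shows "sampled n \<sigma> q \<subseteq> generation q"
proof -
  have "\<sigma> ` {2 ^ floor_log n..n} \<subseteq> generation (floor_log n)"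
    using image_mono[OF last_block(1)[OF assms(1)], of \<sigma>] permutes_image[OF assms(2)] by simp
  thus ?thesis by (auto simp: sampled_def)
qed

text \<open>The total does not depend on \<open>\<sigma>\<close>. Therefore the Gaussian factor is
  the same for all permutations and can be subtracted inside the average over them.\<close>

lemma card_sampled:
  assumes "n \<ge> 1" "\<sigma> permutes generation (floor_log n)"
  shows "(\<Sum>q<Suc (floor_log n). card (sampled n \<sigma> q)) = n"
proof -
  let ?r = "floor_log n"
  have "(\<Sum>q<Suc ?r. card (sampled n \<sigma> q)) = (\<Sum>q<?r. card (generation q)) + card (\<sigma> ` {2 ^ ?r..n})"
    by (simp add: sampled_def)
  also have "(\<Sum>q<?r. card (generation q)) = card {1..<2 ^ ?r :: nat}"
    using sum_generations[of "\<lambda>_. 1 :: nat" ?r] by simp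
  also have "card (\<sigma> ` {2 ^ ?r..n}) = card {2 ^ ?r..n}"
    using permutes_inj[OF assms(2)] by (intro card_image) (auto simp: inj_on_def)
  also have "card {1..<2 ^ ?r :: nat} + card {2 ^ ?r..n} = n" using last_block(3)[OF assms(1)] by simp
  finally show ?thesis .
qed

lemma deviation_eq_deviation_at:
  assumes n: "n \<ge> 1" and s: "\<sigma> permutes generation (floor_log n)" and w: "\<omega> \<in> perm_event (floor_log n) \<sigma>"
  shows "deviation n \<omega> = deviation_at n \<sigma> \<omega>"
proof -
  let ?r = "floor_log n" and ?J = "{2 ^ floor_log n..n}"
  let ?G = "\<lambda>i. g (triangle X i \<omega>)"
  have wM: "\<omega> \<in> space M" using w by (simp add: perm_event_def)
  have "deviation n \<omega> = (\<Sum>i=1..n. ?G (\<pi> \<omega> i))"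
    by (simp add: deviation_def triangle_sum_def vertex_sum_def g_def triangle_def sum_subtractf)
  also have "\<dots> = (\<Sum>i\<in>{1..<2 ^ ?r}. ?G (\<pi> \<omega> i)) + (\<Sum>i\<in>?J. ?G (\<pi> \<omega> i))"
    unfolding last_block(2)[OF n] by (rule sum.union_disjoint) auto
  also have "(\<Sum>i\<in>{1..<2 ^ ?r}. ?G (\<pi> \<omega> i)) = (\<Sum>q<?r. \<Sum>i\<in>generation q. ?G (\<pi> \<omega> i))"
    by (rule sum_generations)
  also have "\<dots> = (\<Sum>q<?r. \<Sum>i\<in>generation q. ?G i)"
    by (intro sum.cong[OF refl] sum.reindex_bij_betw[OF bij_betw_generation[OF wM]])
  also have "(\<Sum>i\<in>?J. ?G (\<pi> \<omega> i)) = (\<Sum>i\<in>?J. ?G (\<sigma> i))"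
    using w last_block(1)[OF n] by (intro sum.cong refl) (auto simp: perm_event_def)
  also have "\<dots> = (\<Sum>i\<in>\<sigma> ` ?J. ?G i)"
    using permutes_inj[OF s] by (subst sum.reindex) (auto simp: inj_on_def)
  finally show ?thesis by (simp add: deviation_at_def sampled_def)
qed

lemma deviation_at_measurable:
  assumes "n \<ge> 1" "\<sigma> permutes generation (floor_log n)"
  shows "deviation_at n \<sigma> \<in> borel_measurable chain_alg" "deviation_at n \<sigma> \<in> borel_measurable M"
proof -
  have pos: "i \<ge> 1" if "i \<in> sampled n \<sigma> q" for i q
    using that sampled_subset[OF assms, of q] generation_pos by auto
  show "deviation_at n \<sigma> \<in> borel_measurable chain_alg"
    unfolding deviation_at_def
    by (intro borel_measurable_sum measurable_compose[OF triangle_measurable_chain_alg g_measurable] pos)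
  show "deviation_at n \<sigma> \<in> borel_measurable M"
    unfolding deviation_at_def
    by (intro borel_measurable_sum measurable_compose[OF triangle_measurable g_measurable] pos)
qed

text \<open>The chain is evaluated at random indices. On each of the finitely many events fixing the
  permutation of the last generation the sum has deterministic index sets, so a finite gluing
  suffices.\<close>

lemma deviation_measurable: "deviation n \<in> borel_measurable M"
proof (cases "n \<ge> 1")
  case False
  hence "deviation n = (\<lambda>_. 0)" by (auto simp: deviation_def triangle_sum_def vertex_sum_def)
  thus ?thesis by simp
next
  case True
  let ?r = "floor_log n"
  have "(\<lambda>\<omega>. \<Sum>\<tau> | \<tau> permutes generation ?r. indicator (perm_event ?r \<tau>) \<omega> * deviation_at n \<tau> \<omega>) \<in> borel_measurable M"
    using deviation_at_measurable(2)[OF True] sets_perm_alg[OF perm_event_sets]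
    by (intro borel_measurable_sum borel_measurable_times borel_measurable_indicator) auto
  thus ?thesis
  proof (rule measurable_cong[THEN iffD1, rotated])
    fix \<omega> assume w: "\<omega> \<in> space M"
    obtain \<sigma> where "\<sigma> permutes generation ?r" "\<omega> \<in> perm_event ?r \<sigma>" using perm_event_cover[OF w, of ?r] by blast
    thus "(\<Sum>\<tau> | \<tau> permutes generation ?r. indicator (perm_event ?r \<tau>) \<omega> * deviation_at n \<tau> \<omega>) = deviation n \<omega>"
      using sum_perm_events[of \<sigma> ?r \<omega> "\<lambda>\<tau>. deviation_at n \<tau> \<omega>"] deviation_eq_deviation_at[OF True] by simp
  qed
qed

text \<open>On \<open>perm_event\<close> the sum equals \<open>deviation_at\<close>, a function of
  the chain alone, hence independent of the event. Each event has the same probability, so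
  conditioning on the permutation becomes a plain average.\<close>

lemma expectation_iexp_deviation:
  assumes n: "n \<ge> 1"
  shows "(\<integral>\<omega>. iexp (u * deviation n \<omega>) \<partial>M)
    = (\<Sum>\<sigma> | \<sigma> permutes generation (floor_log n). (\<integral>\<omega>. iexp (u * deviation_at n \<sigma> \<omega>) \<partial>M) / fact (2 ^ floor_log n))"
proof -
  let ?r = "floor_log n"
  have int: "integrable M (\<lambda>\<omega>. iexp (u * deviation_at n \<sigma> \<omega>))" if "\<sigma> permutes generation ?r" for \<sigma>
    using deviation_at_measurable(2)[OF n that] by (intro integrable_const_bound[where B=1]) auto
  have int2: "integrable M (\<lambda>\<omega>. indicator (perm_event ?r \<sigma>) \<omega> * iexp (u * deviation_at n \<sigma> \<omega>))"
    if "\<sigma> permutes generation ?r" for \<sigma>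
    using deviation_at_measurable(2)[OF n that] sets_perm_alg[OF perm_event_sets[of ?r \<sigma>]]
    by (intro integrable_const_bound[where B=1]) (auto simp: norm_mult indicator_def)
  have "(\<integral>\<omega>. iexp (u * deviation n \<omega>) \<partial>M)
      = (\<integral>\<omega>. (\<Sum>\<sigma> | \<sigma> permutes generation ?r. indicator (perm_event ?r \<sigma>) \<omega> * iexp (u * deviation_at n \<sigma> \<omega>)) \<partial>M)"
  proof (rule Bochner_Integration.integral_cong[OF refl])
    fix \<omega> assume w: "\<omega> \<in> space M"
    obtain \<sigma> where "\<sigma> permutes generation ?r" "\<omega> \<in> perm_event ?r \<sigma>" using perm_event_cover[OF w, of ?r] by blast
    thus "iexp (u * deviation n \<omega>) = (\<Sum>\<sigma> | \<sigma> permutes generation ?r. indicator (perm_event ?r \<sigma>) \<omega> * iexp (u * deviation_at n \<sigma> \<omega>))"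
      using sum_perm_events[of \<sigma> ?r \<omega> "\<lambda>\<tau>. iexp (u * deviation_at n \<tau> \<omega>)"] deviation_eq_deviation_at[OF n] by simp
  qed
  also have "\<dots> = (\<Sum>\<sigma> | \<sigma> permutes generation ?r. \<integral>\<omega>. indicator (perm_event ?r \<sigma>) \<omega> * iexp (u * deviation_at n \<sigma> \<omega>) \<partial>M)"
    using int2 by (intro Bochner_Integration.integral_sum) auto
  also have "\<dots> = (\<Sum>\<sigma> | \<sigma> permutes generation ?r. (\<integral>\<omega>. iexp (u * deviation_at n \<sigma> \<omega>) \<partial>M) / fact (2 ^ ?r))"
  proof (rule sum.cong[OF refl])
    fix \<sigma> assume "\<sigma> \<in> {\<sigma>. \<sigma> permutes generation ?r}"
    hence s: "\<sigma> permutes generation ?r" by simp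
    have "(\<lambda>\<omega>. iexp (u * deviation_at n \<sigma> \<omega>)) \<in> borel_measurable chain_alg"
      using deviation_at_measurable(1)[OF n s] by measurable
    from expectation_perm_event[OF perm_event_sets this int[OF s], of ?r \<sigma>]
    show "(\<integral>\<omega>. indicator (perm_event ?r \<sigma>) \<omega> * iexp (u * deviation_at n \<sigma> \<omega>) \<partial>M) = (\<integral>\<omega>. iexp (u * deviation_at n \<sigma> \<omega>) \<partial>M) / fact (2 ^ ?r)"
      using uniform[OF s] by (simp add: perm_event_def of_real_divide)
  qed
  finally show ?thesis .
qed

text \<open>In the bound for fixed \<open>\<sigma>\<close> only \<open>E \<sigma>\<close>, the error
  of the incomplete generation, depends on \<open>\<sigma>\<close>. It enters linearly, so averaging
  replaces it by \<open>2 ^ r * \<beta> r\<close>, the same expression that bounds a complete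
  generation.\<close>

lemma char_bound:
  assumes K: "\<And>q. expectation (gsum q (\<lambda>x. V x + H x)) \<le> K * 2 ^ q" "K \<ge> 0" and n: "n \<ge> 1"
  defines "r \<equiv> floor_log n"
  shows "norm ((\<integral>\<omega>. iexp (u * deviation n \<omega>) \<partial>M) - of_real (exp (- (u\<^sup>2 * (s2 * n) / 2))))
    \<le> (\<bar>u\<bar> ^ 3 + u ^ 4) * (2 * K * n) + u\<^sup>2 / 2 * (\<Sum>q<Suc r. 2 ^ q * \<beta> q)"
proof -
  let ?J = "{2 ^ r..n}" and ?Pi = "{\<sigma>. \<sigma> permutes generation r}"
  let ?N = "fact (2 ^ r) :: real" and ?e = "of_real (exp (- (u\<^sup>2 * (s2 * n) / 2))) :: complex"
  let ?c = "\<bar>u\<bar> ^ 3 + u ^ 4"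
  define E where "E \<sigma> = expectation (\<lambda>\<omega>. \<bar>\<Sum>i\<in>\<sigma> ` ?J. h (X i \<omega>)\<bar>)" for \<sigma>
  define R where "R = ?c * (2 * K * n) + u\<^sup>2 / 2 * (\<Sum>q<r. 2 ^ q * \<beta> q)"
  have card: "card ?Pi = fact (2 ^ r)" by (rule card_permutations[OF card_generation finite_generation])
  have each: "norm ((\<integral>\<omega>. iexp (u * deviation_at n \<sigma> \<omega>) \<partial>M) - ?e) \<le> R + u\<^sup>2 / 2 * E \<sigma>" if s: "\<sigma> permutes generation r" for \<sigma>
  proof -
    note s' = s[unfolded r_def]
    have "norm ((\<integral>\<omega>. iexp (u * deviation_at n \<sigma> \<omega>) \<partial>M) - ?e)
        \<le> (\<Sum>q<Suc r. ?c * expectation (gsum q (\<lambda>x. V x + H x)) + u\<^sup>2 / 2 * expectation (\<lambda>\<omega>. \<bar>\<Sum>i\<in>sampled n \<sigma> q. h (X i \<omega>)\<bar>))"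
      using char_tree_bound[OF sampled_subset[OF n s'], of u "Suc r"] card_sampled[OF n s']
      by (simp only: deviation_at_def r_def of_nat_sum[symmetric])
    also have "\<dots> = ?c * (\<Sum>q<Suc r. expectation (gsum q (\<lambda>x. V x + H x)))
        + u\<^sup>2 / 2 * (\<Sum>q<Suc r. expectation (\<lambda>\<omega>. \<bar>\<Sum>i\<in>sampled n \<sigma> q. h (X i \<omega>)\<bar>))"
      by (simp only: sum.distrib sum_distrib_left)
    also have "(\<Sum>q<Suc r. expectation (\<lambda>\<omega>. \<bar>\<Sum>i\<in>sampled n \<sigma> q. h (X i \<omega>)\<bar>))
        = (\<Sum>q<r. expectation (\<lambda>\<omega>. \<bar>gsum q h \<omega>\<bar>)) + E \<sigma>"
      by (simp add: sampled_def r_def gsum_def E_def)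
    also have "?c * (\<Sum>q<Suc r. expectation (gsum q (\<lambda>x. V x + H x))) \<le> ?c * (2 * K * n)"
    proof (rule mult_left_mono)
      have "(\<Sum>q<Suc r. expectation (gsum q (\<lambda>x. V x + H x))) \<le> (\<Sum>q<Suc r. K * 2 ^ q)" by (intro sum_mono K)
      also have "\<dots> = K * (\<Sum>q<Suc r. 2 ^ q)" by (simp only: sum_distrib_left)
      \<comment> \<open>The generations up to the last one reached have fewer than
        \<open>2 * 2 ^ r \<le> 2 * n\<close> vertices, even though the last is visited only in part.
        This is the factor \<open>2\<close> in front of \<open>K\<close>.\<close>
      also have "(\<Sum>q<Suc r. 2 ^ q) = (2::real) ^ Suc r - 1" by (subst geometric_sum) auto
      also have "K * (2 ^ Suc r - 1) \<le> K * (2 * real n)"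
      proof (rule mult_left_mono[OF _ K(2)])
        have "real (2 ^ r) \<le> real n" using last_block(3)[OF n] unfolding r_def of_nat_le_iff .
        thus "2 ^ Suc r - 1 \<le> 2 * real n" unfolding of_nat_power of_nat_numeral power_Suc by linarith
      qed
      finally show "(\<Sum>q<Suc r. expectation (gsum q (\<lambda>x. V x + H x))) \<le> 2 * K * n" by (simp add: mult_ac)
    qed auto
    also have "u\<^sup>2 / 2 * ((\<Sum>q<r. expectation (\<lambda>\<omega>. \<bar>gsum q h \<omega>\<bar>)) + E \<sigma>) \<le> u\<^sup>2 / 2 * ((\<Sum>q<r. 2 ^ q * \<beta> q) + E \<sigma>)"
      by (intro mult_left_mono add_right_mono sum_mono generation_full_le) auto
    finally show ?thesis by (simp add: R_def distrib_left)
  qed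
  have "(\<integral>\<omega>. iexp (u * deviation n \<omega>) \<partial>M) - ?e = (\<Sum>\<sigma>\<in>?Pi. (\<integral>\<omega>. iexp (u * deviation_at n \<sigma> \<omega>) \<partial>M) / fact (2 ^ r)) - (\<Sum>\<sigma>\<in>?Pi. ?e / fact (2 ^ r))"
    unfolding expectation_iexp_deviation[OF n] by (simp add: r_def[symmetric] card)
  also have "\<dots> = (\<Sum>\<sigma>\<in>?Pi. ((\<integral>\<omega>. iexp (u * deviation_at n \<sigma> \<omega>) \<partial>M) - ?e) / fact (2 ^ r))"
    by (simp only: sum_subtractf diff_divide_distrib)
  finally have "norm ((\<integral>\<omega>. iexp (u * deviation n \<omega>) \<partial>M) - ?e)
      = norm (\<Sum>\<sigma>\<in>?Pi. ((\<integral>\<omega>. iexp (u * deviation_at n \<sigma> \<omega>) \<partial>M) - ?e) / fact (2 ^ r))"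
    by (rule arg_cong)
  also have "\<dots> \<le> (\<Sum>\<sigma>\<in>?Pi. norm (((\<integral>\<omega>. iexp (u * deviation_at n \<sigma> \<omega>) \<partial>M) - ?e) / fact (2 ^ r)))"
    by (rule norm_sum)
  also have "\<dots> \<le> (\<Sum>\<sigma>\<in>?Pi. (R + u\<^sup>2 / 2 * E \<sigma>) / ?N)"
  proof (rule sum_mono)
    fix \<sigma> assume "\<sigma> \<in> ?Pi"
    hence "norm ((\<integral>\<omega>. iexp (u * deviation_at n \<sigma> \<omega>) \<partial>M) - ?e) / ?N \<le> (R + u\<^sup>2 / 2 * E \<sigma>) / ?N"
      by (intro divide_right_mono each) auto
    moreover have "norm (fact (2 ^ r) :: complex) = ?N" by (metis norm_of_nat of_nat_fact)
    ultimately show "norm (((\<integral>\<omega>. iexp (u * deviation_at n \<sigma> \<omega>) \<partial>M) - ?e) / fact (2 ^ r)) \<le> (R + u\<^sup>2 / 2 * E \<sigma>) / ?N"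
      by (simp only: norm_divide)
  qed
  also have "\<dots> = R + u\<^sup>2 / 2 * ((\<Sum>\<sigma>\<in>?Pi. E \<sigma>) / ?N)"
    by (simp add: add_divide_distrib sum.distrib card sum_distrib_left sum_divide_distrib)
  also have "\<dots> \<le> R + u\<^sup>2 / 2 * (2 ^ r * \<beta> r)"
    using generation_average_le[OF last_block(1)[OF n]]
    by (intro add_left_mono mult_left_mono) (auto simp: E_def r_def)
  also have "\<dots> = ?c * (2 * K * n) + u\<^sup>2 / 2 * (\<Sum>q<Suc r. 2 ^ q * \<beta> q)"
    by (simp add: R_def distrib_left)
  finally show ?thesis .
qed

lemma floor_log_tendsto: "filterlim floor_log at_top sequentially"
proof (subst filterlim_at_top, intro allI)
  fix Z
  have "Z \<le> floor_log n" if "n \<ge> 2 ^ Z" for n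
    using floor_log_le_iff[OF that] by simp
  thus "\<forall>\<^sub>F n in sequentially. Z \<le> floor_log n" unfolding eventually_sequentially by blast
qed

lemma char_tendsto:
  "(\<lambda>n. char (distr M borel (\<lambda>\<omega>. deviation n \<omega> / sqrt (real n))) t) \<longlonglongrightarrow> of_real (exp (- (t\<^sup>2 * s2 / 2)))"
proof -
  obtain K where K: "\<And>q. expectation (gsum q (\<lambda>x. V x + H x)) \<le> K * 2 ^ q" "K \<ge> 0"
    using expectation_gsum_bound[OF add[OF V_F H_F] add_nonneg_nonneg[OF V_nonneg H_nonneg]] by blast
  define u where "u n = t / sqrt (real n)" for n
  define B where "B r = (\<Sum>q<Suc r. 2 ^ q * \<beta> q) / 2 ^ r" for r
  have \<beta>0: "\<beta> q \<ge> 0" for q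
    unfolding \<beta>_def
    by (intro real_sqrt_ge_zero divide_nonneg_pos add_nonneg_nonneg integral_nonneg_AE) (auto simp: gsum_nonneg)
  have u0: "u \<longlonglongrightarrow> 0"
  proof -
    have "filterlim (\<lambda>n. sqrt (real n)) at_infinity sequentially"
      by (intro filterlim_at_top_imp_at_infinity filterlim_compose[OF sqrt_at_top filterlim_real_sequentially])
    thus ?thesis unfolding u_def by (rule tendsto_divide_0[OF tendsto_const])
  qed
  have B0: "(\<lambda>n. B (floor_log n)) \<longlonglongrightarrow> 0"
    unfolding B_def by (rule filterlim_compose[OF geometric_average_tendsto_0[OF \<beta>_tendsto_0] floor_log_tendsto])
  have bound: "norm (char (distr M borel (\<lambda>\<omega>. deviation n \<omega> / sqrt (real n))) t - of_real (exp (- (t\<^sup>2 * s2 / 2))))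
      \<le> 2 * K * t\<^sup>2 * (\<bar>u n\<bar> + (u n)\<^sup>2) + t\<^sup>2 / 2 * B (floor_log n)" if n: "n \<ge> 1" for n
  proof -
    let ?r = "floor_log n" and ?S = "\<Sum>q<Suc (floor_log n). 2 ^ q * \<beta> q"
    have un: "(u n)\<^sup>2 * n = t\<^sup>2" using n by (simp add: u_def power_divide)
    have "char (distr M borel (\<lambda>\<omega>. deviation n \<omega> / sqrt (real n))) t = (\<integral>\<omega>. iexp (t * (deviation n \<omega> / sqrt (real n))) \<partial>M)"
      unfolding char_def using deviation_measurable[of n] by (subst integral_distr) auto
    also have "\<dots> = (\<integral>\<omega>. iexp (u n * deviation n \<omega>) \<partial>M)" by (simp add: u_def)
    finally have ch: "char (distr M borel (\<lambda>\<omega>. deviation n \<omega> / sqrt (real n))) t = (\<integral>\<omega>. iexp (u n * deviation n \<omega>) \<partial>M)" .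
    have e: "(u n)\<^sup>2 * (s2 * n) / 2 = t\<^sup>2 * s2 / 2" unfolding un[symmetric] by (simp add: mult_ac)
    have "norm (char (distr M borel (\<lambda>\<omega>. deviation n \<omega> / sqrt (real n))) t - of_real (exp (- (t\<^sup>2 * s2 / 2))))
        \<le> (\<bar>u n\<bar> ^ 3 + (u n) ^ 4) * (2 * K * n) + (u n)\<^sup>2 / 2 * ?S"
      using char_bound[OF K n, of "u n"] unfolding ch e .
    \<comment> \<open>Two powers of \<open>u n\<close> cancel the factor \<open>n\<close>, since
      \<open>u n\<close> squared times \<open>n\<close> is \<open>t^2\<close>. What remains is of
      order \<open>\<bar>u n\<bar>\<close>.\<close>
    also have "(\<bar>u n\<bar> ^ 3 + (u n) ^ 4) * (2 * K * n) = 2 * K * ((u n)\<^sup>2 * n) * (\<bar>u n\<bar> + (u n)\<^sup>2)"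
      by (simp add: power2_eq_square power3_eq_cube power4_eq_xxxx abs_mult_self_eq algebra_simps)
    also have "\<dots> = 2 * K * t\<^sup>2 * (\<bar>u n\<bar> + (u n)\<^sup>2)" by (simp only: un)
    \<comment> \<open>The scaling divides by \<open>n\<close>, while the geometric average divides
      by \<open>2 ^ r\<close>. As \<open>2 ^ r \<le> n\<close> and the sum is nonnegative, the
      latter is larger.\<close>
    also have "(u n)\<^sup>2 / 2 * ?S \<le> t\<^sup>2 / 2 * B ?r"
    proof -
      have S0: "?S \<ge> 0" using \<beta>0 by (intro sum_nonneg) auto
      have "real (2 ^ ?r) \<le> real n" using last_block(3)[OF n] unfolding of_nat_le_iff .
      hence "?S / n \<le> ?S / 2 ^ ?r" using S0 n by (intro divide_left_mono) auto
      hence "t\<^sup>2 / 2 * (?S / n) \<le> t\<^sup>2 / 2 * B ?r" unfolding B_def by (intro mult_left_mono) auto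
      moreover have "(u n)\<^sup>2 / 2 * ?S = t\<^sup>2 / 2 * (?S / n)" unfolding un[symmetric] using n by simp
      ultimately show ?thesis by simp
    qed
    finally show ?thesis by simp
  qed
  have lim: "(\<lambda>n. 2 * K * t\<^sup>2 * (\<bar>u n\<bar> + (u n)\<^sup>2) + t\<^sup>2 / 2 * B (floor_log n)) \<longlonglongrightarrow> 2 * K * t\<^sup>2 * (\<bar>0\<bar> + 0\<^sup>2) + t\<^sup>2 / 2 * 0"
    by (intro tendsto_intros u0 B0)
  have "(\<lambda>n. char (distr M borel (\<lambda>\<omega>. deviation n \<omega> / sqrt (real n))) t - of_real (exp (- (t\<^sup>2 * s2 / 2)))) \<longlonglongrightarrow> 0"
  proof (rule Lim_null_comparison)
    show "\<forall>\<^sub>F n in sequentially. norm (char (distr M borel (\<lambda>\<omega>. deviation n \<omega> / sqrt (real n))) t - of_real (exp (- (t\<^sup>2 * s2 / 2))))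
        \<le> 2 * K * t\<^sup>2 * (\<bar>u n\<bar> + (u n)\<^sup>2) + t\<^sup>2 / 2 * B (floor_log n)"
      using eventually_ge_at_top[of 1] by eventually_elim (rule bound)
    show "(\<lambda>n. 2 * K * t\<^sup>2 * (\<bar>u n\<bar> + (u n)\<^sup>2) + t\<^sup>2 / 2 * B (floor_log n)) \<longlonglongrightarrow> 0" using lim by simp
  qed
  thus ?thesis by (rule LIM_zero_cancel)
qed

end

theorem corollary20:
  fixes M :: "'a measure" and Filt :: "nat \<Rightarrow> 'a measure"
    and X :: "nat \<Rightarrow> 'a \<Rightarrow> 's::metric_space"
    and \<nu> \<mu> :: "'s measure"
    and P :: "'s \<Rightarrow> ('s \<times> 's) measure"
    and \<pi> :: "'a \<Rightarrow> nat \<Rightarrow> nat"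
    and F :: "('s \<Rightarrow> real) set"
    and f :: "'s \<times> 's \<times> 's \<Rightarrow> real"
  assumes "bifurcating_markov_chain M Filt X \<nu> P"
    and "uniform_generation_permutation M \<pi>"
    and "permutation_indep_chain M \<pi> X"
    and "admissible_space P \<nu> F \<mu>"
    and "f \<in> borel_measurable (borel \<Otimes>\<^sub>M borel \<Otimes>\<^sub>M borel)"
    and "triple_op_exists P f" "triple_op P f \<in> F"
    and "triple_op_exists P (\<lambda>w. (f w)\<^sup>2)" "triple_op P (\<lambda>w. (f w)\<^sup>2) \<in> F"
    and "triple_op_exists P (\<lambda>w. (f w) ^ 4)" "triple_op P (\<lambda>w. (f w) ^ 4) \<in> F"
  defines "s2 \<equiv> (\<integral>x. triple_op P (\<lambda>w. (f w)\<^sup>2) x \<partial>\<mu>) - (\<integral>x. (triple_op P f x)\<^sup>2 \<partial>\<mu>)"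
  shows "weak_conv_m
    (\<lambda>n. distr M borel
      (\<lambda>\<omega>. (triangle_sum \<pi> X n f \<omega> - vertex_sum \<pi> X n (triple_op P f) \<omega>) / sqrt (real n)))
    (normal_law 0 s2)"
proof -
  interpret L: permuted_functional M Filt X \<nu> P F \<mu> f \<pi>
    using assms by (intro permuted_functional.intro admissible_functional.intro admissible_chain.intro
        admissible_functional_axioms.intro permuted_functional_axioms.intro)
  have s2: "s2 = L.s2" unfolding s2_def by (rule L.s2_eq[symmetric])
  have "weak_conv_m (\<lambda>n. distr M borel (\<lambda>\<omega>. L.deviation n \<omega> / sqrt (real n))) (normal_law 0 L.s2)"
  proof (rule levy_continuity)
    \<comment> \<open>For \<open>n = 0\<close> the quotient is \<open>0 / 0\<close>, which is
      \<open>0\<close>, so the sequence consists of probability laws from its first term on.\<close>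
    show "real_distribution (distr M borel (\<lambda>\<omega>. L.deviation n \<omega> / sqrt (real n)))" for n
      by (intro L.real_distribution_distr borel_measurable_divide L.deviation_measurable borel_measurable_const)
    show "real_distribution (normal_law 0 L.s2)" by (rule char_normal_law(2)[OF L.s2_nonneg])
    show "(\<lambda>n. char (distr M borel (\<lambda>\<omega>. L.deviation n \<omega> / sqrt (real n))) t) \<longlonglongrightarrow> char (normal_law 0 L.s2) t" for t
      unfolding char_normal_law(1)[OF L.s2_nonneg] by (rule L.char_tendsto)
  qed
  thus ?thesis by (simp only: s2 L.deviation_def)
qed

end
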